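(* Let $G$ be any Fuchsian group. Then the profinite completion $\widehat{G}$ is not FIG (as a profinite group).
   Context: A Fuchsian group is a finitely generated non-elementary discrete group of isometries of the hyperbolic plane, oriented or non-oriented, given by a presentation of one of the following two types. Oriented type: generators $a_1,b_1,\dots,a_g,b_g$, $x_1,\dots,x_d$, $y_1,\dots,y_s$, $z_1,\dots,z_t$ with relations $x_i^{m_i}=1$ ($1\le i\le d$) and $x_1\cdots x_d\,y_1\cdots y_s\,z_1\cdots z_t\,[a_1,b_1]\cdots[a_g,b_g]=1$. Non-oriented type: generators $a_1,\dots,a_g$ (with $g\geq 1$), $x_1,\dots,x_d$, $y_1,\dots,y_s$, $z_1,\dots,z_t$ with relations $x_i^{m_i}=1$ and $x_1\cdots x_d\,y_1\cdots y_s\,z_1\cdots z_t\,a_1^2\cdots a_g^2=1$. Here $g,d,s,t\ge0$, all $m_i\ge2$, and the measure $\mu(G)=-\chi(G)=v-2+\sum_{i=1}^d(1-1/m_i)+s+t$ is positive, where $v=2g$ in the oriented case and $v=g$ in the non-oriented case. Write $s^g=g^{-1}sg$. A profinite group $\Gamma$ is invariably generated by a subset $S\subseteq\Gamma$ if $\{s^{g(s)}\mid s\in S\}$ generates $\Gamma$ topologically for every choice of elements $g(s)\in\Gamma$, $s\in S$; it is FIG if it is invariably generated, in this sense, by some finite subset. *)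

theory Defs
  imports
    "HOL-Analysis.Analysis"
    "HOL-Algebra.Bij"
    "HOL-Algebra.Product_Groups"
    "HOL-Algebra.Generated_Groups"
begin

section \<open>Discrete groups of isometries of the hyperbolic plane\<close>

text \<open>The Poincare disc model.\<close>

definition hyp_disc :: "complex set" where
  "hyp_disc = {z. cmod z < 1}"

definition hyp_dist :: "complex \<Rightarrow> complex \<Rightarrow> real" where
  "hyp_dist z w =
     arcosh (1 + 2 * (cmod (z - w))\<^sup>2 / ((1 - (cmod z)\<^sup>2) * (1 - (cmod w)\<^sup>2)))"

text \<open>All isometries, orientation-preserving or not, under composition.\<close>

definition hyp_isometry_group :: "(complex \<Rightarrow> complex) monoid" where
  "hyp_isometry_group = BijGroup hyp_disc
     \<lparr>carrier := {f \<in> Bij hyp_disc.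
        \<forall>z\<in>hyp_disc. \<forall>w\<in>hyp_disc. hyp_dist (f z) (f w) = hyp_dist z w}\<rparr>"

text \<open>The identity is isolated in the topology of pointwise convergence, which on the isometry
  group is the usual (compact-open) topology.\<close>

definition discrete_isometries :: "(complex \<Rightarrow> complex) set \<Rightarrow> bool" where
  "discrete_isometries \<Gamma> \<longleftrightarrow>
     (\<exists>F e. finite F \<and> F \<subseteq> hyp_disc \<and> e > 0 \<and>
        (\<forall>f\<in>\<Gamma>. (\<forall>z\<in>F. hyp_dist (f z) z < e) \<longrightarrow> f = \<one>\<^bsub>hyp_isometry_group\<^esub>))"

definition limit_set :: "(complex \<Rightarrow> complex) set \<Rightarrow> complex set" where
  "limit_set \<Gamma> = {\<xi>. cmod \<xi> = 1 \<and> (\<exists>z\<in>hyp_disc. \<xi> islimpt (\<lambda>f. f z) ` \<Gamma>)}"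

definition elementary :: "(complex \<Rightarrow> complex) set \<Rightarrow> bool" where
  "elementary \<Gamma> \<longleftrightarrow> finite (limit_set \<Gamma>) \<and> card (limit_set \<Gamma>) \<le> 2"


section \<open>Groups given by generators and relations\<close>

text \<open>The letter \<open>(x, True)\<close> stands for the generator \<open>x\<close> and \<open>(x, False)\<close> for its inverse.\<close>

type_synonym 'x word = "('x \<times> bool) list"

definition words :: "'x set \<Rightarrow> 'x word set" where
  "words X = lists (X \<times> UNIV)"

inductive word_eq :: "'x set \<Rightarrow> 'x word set \<Rightarrow> 'x word \<Rightarrow> 'x word \<Rightarrow> bool"
  for X :: "'x set" and R :: "'x word set" where
  refl: "w \<in> words X \<Longrightarrow> word_eq X R w w"
| sym: "word_eq X R u w \<Longrightarrow> word_eq X R w u"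
| trans: "word_eq X R u v \<Longrightarrow> word_eq X R v w \<Longrightarrow> word_eq X R u w"
| cancel: "u \<in> words X \<Longrightarrow> w \<in> words X \<Longrightarrow> x \<in> X \<Longrightarrow>
    word_eq X R (u @ [(x, b), (x, \<not> b)] @ w) (u @ w)"
| relator: "u \<in> words X \<Longrightarrow> w \<in> words X \<Longrightarrow> r \<in> R \<Longrightarrow> r \<in> words X \<Longrightarrow>
    word_eq X R (u @ r @ w) (u @ w)"

definition word_rel :: "'x set \<Rightarrow> 'x word set \<Rightarrow> 'x word rel" where
  "word_rel X R = {(u, w). word_eq X R u w}"

text \<open>\<open>\<langle>X | r = 1 (r \<in> R)\<rangle>\<close>, with multiplication induced by concatenation.\<close>

definition presented_group :: "'x set \<Rightarrow> 'x word set \<Rightarrow> 'x word set monoid" where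
  "presented_group X R =
     \<lparr>carrier = words X // word_rel X R,
      monoid.mult = (\<lambda>P Q. \<Union>u\<in>P. \<Union>w\<in>Q. word_rel X R `` {u @ w}),
      one = word_rel X R `` {[]}\<rparr>"


section \<open>Fuchsian groups\<close>

datatype fuchsian_gen = GenA nat | GenB nat | GenX nat | GenY nat | GenZ nat

definition xyz_gens :: "nat \<Rightarrow> nat \<Rightarrow> nat \<Rightarrow> fuchsian_gen set" where
  "xyz_gens d s t = GenX ` {1..d} \<union> GenY ` {1..s} \<union> GenZ ` {1..t}"

definition torsion_relators :: "nat \<Rightarrow> (nat \<Rightarrow> nat) \<Rightarrow> fuchsian_gen word set" where
  "torsion_relators d m = {replicate (m i) (GenX i, True) | i. i \<in> {1..d}}"

definition xyz_word :: "nat \<Rightarrow> nat \<Rightarrow> nat \<Rightarrow> fuchsian_gen word" where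
  "xyz_word d s t =
     map (\<lambda>i. (GenX i, True)) [1..<Suc d] @
     map (\<lambda>i. (GenY i, True)) [1..<Suc s] @
     map (\<lambda>i. (GenZ i, True)) [1..<Suc t]"

text \<open>Commutators are \<open>[a, b] = a\<^sup>-\<^sup>1 b\<^sup>-\<^sup>1 a b\<close>; the other convention gives an isomorphic group.\<close>

definition commutator_word :: "'x \<Rightarrow> 'x \<Rightarrow> 'x word" where
  "commutator_word a b = [(a, False), (b, False), (a, True), (b, True)]"

definition oriented_group ::
  "nat \<Rightarrow> nat \<Rightarrow> nat \<Rightarrow> nat \<Rightarrow> (nat \<Rightarrow> nat) \<Rightarrow> fuchsian_gen word set monoid" where
  "oriented_group g d s t m =
     presented_group
       (GenA ` {1..g} \<union> GenB ` {1..g} \<union> xyz_gens d s t)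
       (insert
         (xyz_word d s t @ concat (map (\<lambda>i. commutator_word (GenA i) (GenB i)) [1..<Suc g]))
         (torsion_relators d m))"

definition non_oriented_group ::
  "nat \<Rightarrow> nat \<Rightarrow> nat \<Rightarrow> nat \<Rightarrow> (nat \<Rightarrow> nat) \<Rightarrow> fuchsian_gen word set monoid" where
  "non_oriented_group g d s t m =
     presented_group
       (GenA ` {1..g} \<union> xyz_gens d s t)
       (insert
         (xyz_word d s t @ concat (map (\<lambda>i. replicate 2 (GenA i, True)) [1..<Suc g]))
         (torsion_relators d m))"

definition fuchsian_measure :: "nat \<Rightarrow> nat \<Rightarrow> nat \<Rightarrow> nat \<Rightarrow> (nat \<Rightarrow> nat) \<Rightarrow> real" where
  "fuchsian_measure v d s t m =
     real v - 2 + (\<Sum>i = 1..d. 1 - 1 / real (m i)) + real s + real t"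

definition has_fuchsian_presentation :: "('a, 'b) monoid_scheme \<Rightarrow> bool" where
  "has_fuchsian_presentation G \<longleftrightarrow>
     (\<exists>g d s t m. (\<forall>i\<in>{1..d}. 2 \<le> m i) \<and>
        (0 < fuchsian_measure (2 * g) d s t m \<and> G \<cong> oriented_group g d s t m \<or>
         1 \<le> g \<and> 0 < fuchsian_measure g d s t m \<and> G \<cong> non_oriented_group g d s t m))"

definition fuchsian_group :: "(complex \<Rightarrow> complex) monoid \<Rightarrow> bool" where
  "fuchsian_group G \<longleftrightarrow>
     (\<exists>\<Gamma>. subgroup \<Gamma> hyp_isometry_group \<and> G = hyp_isometry_group\<lparr>carrier := \<Gamma>\<rparr> \<and>
        (\<exists>S. finite S \<and> S \<subseteq> \<Gamma> \<and> generate G S = \<Gamma>) \<and>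
        discrete_isometries \<Gamma> \<and> \<not> elementary \<Gamma>) \<and>
     has_fuchsian_presentation G"


section \<open>Profinite completions and invariable generation\<close>

definition finite_index_normal :: "('a, 'b) monoid_scheme \<Rightarrow> 'a set set" where
  "finite_index_normal G = {N. N \<lhd> G \<and> finite (rcosets\<^bsub>G\<^esub> N)}"

text \<open>The inverse limit of the finite quotients \<open>G/N\<close>. For \<open>N \<subseteq> M\<close>, the projection \<open>G/N \<rightarrow> G/M\<close>
  sends a coset of \<open>N\<close> to the unique coset of \<open>M\<close> containing it, so \<open>\<phi> N \<subseteq> \<phi> M\<close> says
  that \<open>\<phi> N\<close> is mapped to \<open>\<phi> M\<close>.\<close>

definition profinite_completion :: "('a, 'b) monoid_scheme \<Rightarrow> ('a set \<Rightarrow> 'a set) monoid" where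
  "profinite_completion G =
     (product_group (finite_index_normal G) (\<lambda>N. G Mod N))
       \<lparr>carrier := {\<phi> \<in> (\<Pi>\<^sub>E N\<in>finite_index_normal G. carrier (G Mod N)).
          \<forall>N\<in>finite_index_normal G. \<forall>M\<in>finite_index_normal G. N \<subseteq> M \<longrightarrow> \<phi> N \<subseteq> \<phi> M}\<rparr>"

definition profinite_completion_topology ::
  "('a, 'b) monoid_scheme \<Rightarrow> ('a set \<Rightarrow> 'a set) topology" where
  "profinite_completion_topology G =
     subtopology
       (product_topology (\<lambda>N. discrete_topology (carrier (G Mod N))) (finite_index_normal G))
       (carrier (profinite_completion G))"

definition invariably_generates ::
  "('a, 'b) monoid_scheme \<Rightarrow> 'a topology \<Rightarrow> 'a set \<Rightarrow> bool" where
  "invariably_generates \<Gamma> T S \<longleftrightarrow>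
     (\<forall>c \<in> S \<rightarrow> carrier \<Gamma>.
        T closure_of generate \<Gamma> ((\<lambda>s. inv\<^bsub>\<Gamma>\<^esub> c s \<otimes>\<^bsub>\<Gamma>\<^esub> s \<otimes>\<^bsub>\<Gamma>\<^esub> c s) ` S) = carrier \<Gamma>)"

definition FIG :: "('a, 'b) monoid_scheme \<Rightarrow> 'a topology \<Rightarrow> bool" where
  "FIG \<Gamma> T \<longleftrightarrow> (\<exists>S. finite S \<and> S \<subseteq> carrier \<Gamma> \<and> invariably_generates \<Gamma> T S)"

end

theory Submission
  imports Defs "HOL-Algebra.Multiplicative_Group" "HOL-Number_Theory.Number_Theory"
    "HOL-Computational_Algebra.Polynomial_Factorial"
begin

text \<open>A profinite group is not invariably generated by \<open>S\<close> as soon as some finite quotient has a proper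
subgroup which contains a conjugate of the image of each element of \<open>S\<close>. So let \<open>S\<close> be a finite subset of the
completion of a group \<open>G\<close> with the given presentation. The proof finds such a quotient as an
extension of \<open>H = G/K\<close> by an abelian group of exponent dividing \<open>M = |H| + 1\<close>, for a suitable normal
subgroup \<open>K\<close> of finite index.

The group \<open>K\<close> has many homomorphisms to \<open>\<int>/M\<close>. Instead of these, count the functions
\<open>u : G \<rightarrow> \<int>/M\<close> with \<open>u (k g) = u k + u g\<close> for \<open>k \<in> K\<close>. They come from the cellular \<open>1\<close>-cocycles
of the finite cover of the presentation complex that belongs to \<open>K\<close>: one value in \<open>\<int>/M\<close> for each of
the \<open>|X||H|\<close> edges of the Cayley graph of \<open>H\<close>, subject to vanishing around every relator. The long
relator gives \<open>|H|\<close> conditions. The relator \<open>x^m\<close> gives only \<open>|H|/m\<close> of them when \<open>x\<close> has order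
exactly \<open>m\<close> in \<open>H\<close>, because the loop that it spells out closes up after running \<open>m\<close> times along \<open>x\<close>,
so it is the same loop from each of its vertices. Normalising \<open>u\<close> to vanish on coset
representatives costs \<open>|H|\<close> more. What is left is \<open>|H|(|X| - 2 - \<Sum> 1/m) = |H| \<mu>(G)\<close>, positive
and proportional to \<open>|H|\<close>.

For the same reason, asking \<open>u\<close> to vanish on all conjugates of \<open>g^n\<close>, where \<open>n\<close> is the order of \<open>g\<close>
in \<open>H\<close>, costs only \<open>|H|/n\<close>. Now choose \<open>K\<close> so deep that each \<open>s \<in> S\<close> either has order at least
\<open>L > |S|/\<mu>\<close> in \<open>H\<close> or has reached an order which does not grow below \<open>K\<close> (\<open>large_or_stable_orders\<close>). The
elements of the first kind cost at most \<open>|S||H|/L < |H| \<mu>\<close> in total. Those of the second kind cost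
nothing: their \<open>n\<close>-th powers are trivial in all finite quotients. Hence there is some \<open>u\<close>, nonzero
on \<open>K\<close>, which vanishes on the conjugates of \<open>s^n\<close> for every \<open>s \<in> S\<close>
(\<open>exists_left_additive_function\<close>). As \<open>M\<close> is coprime to \<open>|H|\<close>, averaging turns \<open>u\<close> into an affine
action of \<open>G\<close> on which \<open>K\<close> is transitive and nontrivial and each \<open>s\<close> has a fixed point. A point
stabiliser is the proper subgroup (\<open>exists_proper_subgroup_with_conjugates\<close>).

What remains is that the generators \<open>x_i\<close> have order exactly \<open>m_i\<close> in some finite quotient. If there
is a handle, a crosscap or a parabolic or hyperbolic boundary generator, a dihedral quotient does it. Otherwise there
are at least three \<open>x_i\<close>, and all but three of them may be sent to the identity. For the three, matrices in
\<open>SL\<^sub>2(\<int>/q)\<close> with prescribed traces give permutations of the points of the plane up to sign with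
prescribed orders and product one (\<open>finite_triangle_quotient\<close>), for a prime \<open>q\<close> with enough roots of unity.\<close>

section \<open>Words and presentations\<close>

definition word_val :: "('a, 'b) monoid_scheme \<Rightarrow> ('x \<Rightarrow> 'a) \<Rightarrow> 'x word \<Rightarrow> 'a" where
  "word_val G \<gamma> w = foldr (\<lambda>(x, b) a. (if b then \<gamma> x else inv\<^bsub>G\<^esub> \<gamma> x) \<otimes>\<^bsub>G\<^esub> a) w \<one>\<^bsub>G\<^esub>"

lemma word_val_simps [simp]:
  "word_val G \<gamma> [] = \<one>\<^bsub>G\<^esub>"
  "word_val G \<gamma> ((x, b) # w) = (if b then \<gamma> x else inv\<^bsub>G\<^esub> \<gamma> x) \<otimes>\<^bsub>G\<^esub> word_val G \<gamma> w"
  by (simp_all add: word_val_def)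

lemma words_simps [simp]:
  "[] \<in> words X" "(x, b) # w \<in> words X \<longleftrightarrow> x \<in> X \<and> w \<in> words X"
  "u @ w \<in> words X \<longleftrightarrow> u \<in> words X \<and> w \<in> words X"
  by (auto simp: words_def)

lemma (in group) word_val_closed [simp]:
  "\<gamma> \<in> X \<rightarrow> carrier G \<Longrightarrow> w \<in> words X \<Longrightarrow> word_val G \<gamma> w \<in> carrier G"
  by (induction w) (auto simp: Pi_iff)

lemma (in group) word_val_append:
  "\<gamma> \<in> X \<rightarrow> carrier G \<Longrightarrow> u \<in> words X \<Longrightarrow> w \<in> words X \<Longrightarrow>
    word_val G \<gamma> (u @ w) = word_val G \<gamma> u \<otimes> word_val G \<gamma> w"
  by (induction u) (auto simp: m_assoc Pi_iff)

lemma word_eq_words: "word_eq X R u w \<Longrightarrow> u \<in> words X \<and> w \<in> words X"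
  by (induction rule: word_eq.induct) auto

lemma (in group) word_val_word_eq:
  assumes "word_eq X R u w" "\<gamma> \<in> X \<rightarrow> carrier G" "\<And>r. r \<in> R \<Longrightarrow> r \<in> words X \<Longrightarrow> word_val G \<gamma> r = \<one>"
  shows "word_val G \<gamma> u = word_val G \<gamma> w"
  using assms(1)
proof induction
  case (cancel u w x b)
  then have "word_val G \<gamma> [(x, b), (x, \<not> b)] = \<one>"
    using assms(2) by (auto simp: Pi_iff)
  moreover have "word_val G \<gamma> (u @ [(x, b), (x, \<not> b)] @ w) =
      word_val G \<gamma> u \<otimes> (word_val G \<gamma> [(x, b), (x, \<not> b)] \<otimes> word_val G \<gamma> w)"
    using cancel assms(2) by (simp only: word_val_append words_simps simp_thms)
  ultimately show ?case
    using cancel assms(2) by (simp add: word_val_append)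
next
  case (relator u w r)
  then show ?case
    using assms by (simp add: word_val_append)
qed auto

text \<open>The generators are taken inside \<open>G\<close> itself rather than in an isomorphic quotient of a set of words,
so that cosets, powers and conjugates in \<open>G\<close> can be compared with words directly.\<close>

definition presents :: "('a, 'b) monoid_scheme \<Rightarrow> 'x set \<Rightarrow> 'x word set \<Rightarrow> ('x \<Rightarrow> 'a) \<Rightarrow> bool" where
  "presents G X R \<gamma> \<longleftrightarrow> \<gamma> \<in> X \<rightarrow> carrier G \<and> carrier G \<subseteq> word_val G \<gamma> ` words X \<and>
     (\<forall>u\<in>words X. \<forall>w\<in>words X. word_val G \<gamma> u = word_val G \<gamma> w \<longleftrightarrow> word_eq X R u w)"

lemma word_eq_context:
  "word_eq X R u w \<Longrightarrow> a \<in> words X \<Longrightarrow> b \<in> words X \<Longrightarrow> word_eq X R (a @ u @ b) (a @ w @ b)"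
proof (induction rule: word_eq.induct)
  case (refl w)
  then show ?case by (auto intro: word_eq.refl)
next
  case (sym u w)
  then show ?case by (auto intro: word_eq.sym)
next
  case (trans u v w)
  then show ?case by (blast intro: word_eq.trans)
next
  case (cancel u w x c)
  then show ?case using word_eq.cancel[of "a @ u" X "w @ b" x R c] by simp
next
  case (relator u w r)
  then show ?case using word_eq.relator[of "a @ u" X "w @ b" r R] by simp
qed

lemma word_eq_append:
  assumes "word_eq X R u u'" "word_eq X R w w'"
  shows "word_eq X R (u @ w) (u' @ w')"
proof -
  have "word_eq X R (u @ w) (u' @ w)" "word_eq X R (u' @ w) (u' @ w')"
    using word_eq_context[OF assms(1), of "[]" w] word_eq_context[OF assms(2), of u' "[]"]
      word_eq_words assms by auto
  then show ?thesis by (rule word_eq.trans)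
qed

lemma equiv_word_rel: "equiv (words X) (word_rel X R)"
  unfolding word_rel_def
  by (rule equivI) (auto simp: refl_on_def sym_def trans_def dest: word_eq_words
      intro: word_eq.refl word_eq.sym word_eq.trans)

abbreviation word_class :: "'x set \<Rightarrow> 'x word set \<Rightarrow> 'x word \<Rightarrow> 'x word set" where
  "word_class X R w \<equiv> word_rel X R `` {w}"

lemma word_class_eq:
  "u \<in> words X \<Longrightarrow> w \<in> words X \<Longrightarrow> word_class X R u = word_class X R w \<longleftrightarrow> word_eq X R u w"
  by (simp add: eq_equiv_class_iff[OF equiv_word_rel]) (simp add: word_rel_def)

lemma presented_group_mult:
  assumes "u \<in> words X" "w \<in> words X"
  shows "word_class X R u \<otimes>\<^bsub>presented_group X R\<^esub> word_class X R w = word_class X R (u @ w)"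
proof -
  have "word_class X R (a @ b) = word_class X R (u @ w)"
    if "a \<in> word_class X R u" "b \<in> word_class X R w" for a b
  proof -
    have "word_eq X R (u @ w) (a @ b)"
      using that by (auto simp: word_rel_def intro: word_eq_append)
    then show ?thesis
      using word_eq_words word_class_eq word_eq.sym by metis
  qed
  moreover have "u \<in> word_class X R u" "w \<in> word_class X R w"
    using assms by (auto simp: word_rel_def intro: word_eq.refl)
  ultimately have "(\<Union>a\<in>word_class X R u. \<Union>b\<in>word_class X R w. word_class X R (a @ b)) =
      word_class X R (u @ w)"
    by blast
  then show ?thesis by (simp add: presented_group_def)
qed

definition word_inv :: "'x word \<Rightarrow> 'x word" where
  "word_inv w = rev (map (\<lambda>(x, b). (x, \<not> b)) w)"

lemma word_inv_words [simp]: "w \<in> words X \<Longrightarrow> word_inv w \<in> words X"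
  by (induction w) (auto simp: word_inv_def)

lemma word_inv_cancel: "w \<in> words X \<Longrightarrow> word_eq X R (word_inv w @ w) []"
proof (induction w)
  case Nil
  then show ?case by (auto simp: word_inv_def intro: word_eq.refl)
next
  case (Cons a w)
  obtain x b where a: "a = (x, b)" by (cases a)
  have "word_eq X R (word_inv w @ [(x, \<not> b), (x, \<not> \<not> b)] @ w) (word_inv w @ w)"
    using Cons a by (intro word_eq.cancel) auto
  moreover have "word_inv (a # w) @ a # w = word_inv w @ [(x, \<not> b), (x, \<not> \<not> b)] @ w"
    by (simp add: a word_inv_def)
  ultimately show ?case using Cons a by (auto intro: word_eq.trans)
qed

lemma carrier_presented_group: "carrier (presented_group X R) = word_class X R ` words X"
  by (auto simp: presented_group_def quotient_def)

lemma group_presented_group: "group (presented_group X R)"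
proof (rule groupI)
  have one: "\<one>\<^bsub>presented_group X R\<^esub> = word_class X R []"
    by (simp add: presented_group_def)
  show "\<one>\<^bsub>presented_group X R\<^esub> \<in> carrier (presented_group X R)"
    unfolding one carrier_presented_group by auto
  fix P assume "P \<in> carrier (presented_group X R)"
  then obtain u where u: "u \<in> words X" "P = word_class X R u"
    unfolding carrier_presented_group by auto
  show "\<one>\<^bsub>presented_group X R\<^esub> \<otimes>\<^bsub>presented_group X R\<^esub> P = P"
    using u by (simp add: one presented_group_mult)
  have "word_class X R (word_inv u) \<otimes>\<^bsub>presented_group X R\<^esub> P = \<one>\<^bsub>presented_group X R\<^esub>"
    using u word_inv_cancel[of u X R] by (simp add: one presented_group_mult word_class_eq)
  then show "\<exists>Q\<in>carrier (presented_group X R). Q \<otimes>\<^bsub>presented_group X R\<^esub> P = \<one>\<^bsub>presented_group X R\<^esub>"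
    using u by (auto simp: carrier_presented_group)
  fix Q assume "Q \<in> carrier (presented_group X R)"
  then obtain v where v: "v \<in> words X" "Q = word_class X R v"
    unfolding carrier_presented_group by auto
  show "P \<otimes>\<^bsub>presented_group X R\<^esub> Q \<in> carrier (presented_group X R)"
    using u v by (simp add: presented_group_mult carrier_presented_group)
  fix S assume "S \<in> carrier (presented_group X R)"
  then obtain w where "w \<in> words X" "S = word_class X R w"
    unfolding carrier_presented_group by auto
  then show "P \<otimes>\<^bsub>presented_group X R\<^esub> Q \<otimes>\<^bsub>presented_group X R\<^esub> S =
      P \<otimes>\<^bsub>presented_group X R\<^esub> (Q \<otimes>\<^bsub>presented_group X R\<^esub> S)"
    using u v by (simp add: presented_group_mult)
qed

lemma (in group_hom) hom_word_val:
  "\<gamma> \<in> X \<rightarrow> carrier G \<Longrightarrow> w \<in> words X \<Longrightarrow> h (word_val G \<gamma> w) = word_val H (\<lambda>x. h (\<gamma> x)) w"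
  by (induction w) (auto simp: Pi_iff)

lemma presented_group_word_val:
  "w \<in> words X \<Longrightarrow> word_val (presented_group X R) (\<lambda>x. word_class X R [(x, True)]) w = word_class X R w"
proof (induction w)
  case Nil
  then show ?case by (simp add: presented_group_def)
next
  case (Cons a w)
  interpret P: group "presented_group X R" by (rule group_presented_group)
  obtain x b where a: "a = (x, b)" by (cases a)
  have x: "x \<in> X" "w \<in> words X" using Cons a by auto
  have "word_eq X R ([] @ [(x, False), (x, \<not> False)] @ []) ([] @ [])"
    using x by (intro word_eq.cancel) auto
  then have "word_class X R [(x, False)] \<otimes>\<^bsub>presented_group X R\<^esub> word_class X R [(x, True)] =
      word_class X R []"
    using x by (simp add: presented_group_mult word_class_eq)
  then have "inv\<^bsub>presented_group X R\<^esub> (word_class X R [(x, True)]) = word_class X R [(x, False)]"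
    using x by (intro P.inv_equality) (auto simp: carrier_presented_group presented_group_def quotient_def)
  then show ?case
    using Cons a x by (cases b) (auto simp: presented_group_mult)
qed

lemma presents_if_iso:
  assumes "group G" "G \<cong> presented_group X R"
  shows "\<exists>\<gamma>. presents G X R \<gamma>"
proof -
  let ?P = "presented_group X R"
  interpret G: group G by fact
  interpret P: group ?P by (rule group_presented_group)
  obtain h where h: "h \<in> hom G ?P" "bij_betw h (carrier G) (carrier ?P)"
    using assms(2) by (auto simp: is_iso_def iso_def)
  interpret group_hom G ?P h
    by unfold_locales (rule h)
  define \<gamma> where "\<gamma> x = inv_into (carrier G) h (word_class X R [(x, True)])" for x
  have gen: "word_class X R [(x, True)] \<in> carrier ?P" if "x \<in> X" for x
    using that by (auto simp: carrier_presented_group)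
  have \<gamma>: "\<gamma> x \<in> carrier G" "h (\<gamma> x) = word_class X R [(x, True)]" if "x \<in> X" for x
    using gen[OF that] h(2) unfolding \<gamma>_def
    by (metis bij_betw_imp_surj_on inv_into_into, metis bij_betw_inv_into_right)
  have val: "h (word_val G \<gamma> w) = word_class X R w" if w: "w \<in> words X" for w
  proof -
    have "h (word_val G \<gamma> w) = word_val ?P (\<lambda>x. h (\<gamma> x)) w"
      using \<gamma> w by (intro hom_word_val[where X = X]) auto
    also have "\<dots> = word_val ?P (\<lambda>x. word_class X R [(x, True)]) w"
      using w by (induction w) (auto simp: \<gamma>)
    finally show ?thesis using w by (simp add: presented_group_word_val)
  qed
  have "presents G X R \<gamma>"
    unfolding presents_def
  proof (intro conjI ballI subsetI)
    show "\<gamma> \<in> X \<rightarrow> carrier G" using \<gamma> by auto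
  next
    fix g assume g: "g \<in> carrier G"
    then obtain w where w: "w \<in> words X" "h g = word_class X R w"
      using carrier_presented_group[of X R] hom_closed by blast
    then have "h g = h (word_val G \<gamma> w)" by (simp add: val)
    moreover have "word_val G \<gamma> w \<in> carrier G"
      using \<gamma> w by (intro G.word_val_closed) auto
    ultimately have "g = word_val G \<gamma> w"
      using g h(2) by (auto simp: bij_betw_def inj_on_def)
    then show "g \<in> word_val G \<gamma> ` words X" using w by auto
  next
    fix u w assume uw: "u \<in> words X" "w \<in> words X"
    then have "word_val G \<gamma> u \<in> carrier G" "word_val G \<gamma> w \<in> carrier G"
      using \<gamma> by (auto intro!: G.word_val_closed[where X = X])
    then have "word_val G \<gamma> u = word_val G \<gamma> w \<longleftrightarrow> h (word_val G \<gamma> u) = h (word_val G \<gamma> w)"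
      using h(2) by (auto simp: bij_betw_def inj_on_def)
    also have "\<dots> \<longleftrightarrow> word_eq X R u w"
      using uw by (simp add: val word_class_eq)
    finally show "word_val G \<gamma> u = word_val G \<gamma> w \<longleftrightarrow> word_eq X R u w" .
  qed
  then show ?thesis by blast
qed

text \<open>Von Dyck's theorem. All finite quotients with prescribed orders of the generators arise this way.\<close>

lemma presents_universal:
  assumes "group G" "presents G X R \<gamma>" "group Q" "\<phi> \<in> X \<rightarrow> carrier Q"
    and rel: "\<And>r. r \<in> R \<Longrightarrow> r \<in> words X \<Longrightarrow> word_val Q \<phi> r = \<one>\<^bsub>Q\<^esub>"
  shows "\<exists>\<psi>\<in>hom G Q. \<forall>x\<in>X. \<psi> (\<gamma> x) = \<phi> x"
proof -
  interpret G: group G by fact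
  interpret Q: group Q by fact
  have \<gamma>: "\<gamma> \<in> X \<rightarrow> carrier G" and surj: "carrier G \<subseteq> word_val G \<gamma> ` words X"
    and eq: "\<And>u w. u \<in> words X \<Longrightarrow> w \<in> words X \<Longrightarrow> word_val G \<gamma> u = word_val G \<gamma> w \<Longrightarrow> word_eq X R u w"
    using assms(2) by (auto simp: presents_def)
  define word_for where "word_for g = (SOME w. w \<in> words X \<and> word_val G \<gamma> w = g)" for g
  have word_for: "word_for g \<in> words X" "word_val G \<gamma> (word_for g) = g" if "g \<in> carrier G" for g
    using someI_ex[of "\<lambda>w. w \<in> words X \<and> word_val G \<gamma> w = g"] surj that unfolding word_for_def by auto
  define \<psi> where "\<psi> g = word_val Q \<phi> (word_for g)" for g
  have \<psi>: "\<psi> (word_val G \<gamma> w) = word_val Q \<phi> w" if "w \<in> words X" for w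
    unfolding \<psi>_def
  proof (rule Q.word_val_word_eq[OF _ assms(4) rel])
    show "word_eq X R (word_for (word_val G \<gamma> w)) w"
      using that \<gamma> word_for by (intro eq) auto
  qed auto
  have "\<psi> \<in> hom G Q"
  proof (rule homI)
    fix g assume g: "g \<in> carrier G"
    then show "\<psi> g \<in> carrier Q"
      unfolding \<psi>_def using assms(4) word_for by auto
    fix h assume h: "h \<in> carrier G"
    have "\<psi> (word_val G \<gamma> (word_for g @ word_for h)) = \<psi> g \<otimes>\<^bsub>Q\<^esub> \<psi> h"
      using g h word_for assms(4) by (subst \<psi>) (auto simp: Q.word_val_append \<psi>_def)
    then show "\<psi> (g \<otimes>\<^bsub>G\<^esub> h) = \<psi> g \<otimes>\<^bsub>Q\<^esub> \<psi> h"
      using g h word_for \<gamma> by (simp add: G.word_val_append)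
  qed
  moreover have "\<psi> (\<gamma> x) = \<phi> x" if "x \<in> X" for x
    using \<psi>[of "[(x, True)]"] that \<gamma> assms(4) by (auto simp: Pi_iff)
  ultimately show ?thesis by blast
qed

section \<open>Normal subgroups of finite index\<close>

lemma (in group) rcos_eq_iff:
  assumes "N \<lhd> G" "g \<in> carrier G" "h \<in> carrier G"
  shows "N #> g = N #> h \<longleftrightarrow> g \<otimes> inv h \<in> N"
proof -
  interpret normal N G by fact
  have "N #> g = N #> h \<longleftrightarrow> g \<in> N #> h"
    using assms(2,3) rcos_self repr_independence is_subgroup by metis
  also have "\<dots> \<longleftrightarrow> g \<otimes> inv h \<in> N"
    using assms(2,3) by (intro rcos_module) auto
  finally show ?thesis .
qed

text \<open>Each coset is determined by the value of \<open>f\<close> at any of its elements, so finitely many values allow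
only finitely many cosets.\<close>

lemma (in group) finite_index_normalI:
  assumes "N \<lhd> G" "finite (f ` carrier G)"
    "\<And>g h. g \<in> carrier G \<Longrightarrow> h \<in> carrier G \<Longrightarrow> f g = f h \<Longrightarrow> g \<otimes> inv h \<in> N"
  shows "N \<in> finite_index_normal G"
proof -
  define r where "r y = (SOME g. g \<in> carrier G \<and> f g = y)" for y
  have r: "r (f g) \<in> carrier G" "f (r (f g)) = f g" if "g \<in> carrier G" for g
    using someI[of "\<lambda>h. h \<in> carrier G \<and> f h = f g" g] that by (auto simp: r_def)
  have "N #> g = N #> r (f g)" if "g \<in> carrier G" for g
    using assms r[OF that] that by (subst rcos_eq_iff) auto
  then have "rcosets N \<subseteq> (\<lambda>y. N #> r y) ` f ` carrier G"
    by (auto simp: RCOSETS_def)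
  then show ?thesis
    using assms finite_surj by (auto simp: finite_index_normal_def)
qed

lemma (in group) finite_index_normal_kernel:
  assumes "group Q" "finite (carrier Q)" "h \<in> hom G Q"
  shows "kernel G Q h \<in> finite_index_normal G"
proof -
  note finI = finite_index_normalI
  interpret group_hom G Q h
    using assms by (simp add: group_hom_def group_hom_axioms_def)
  have "h ` carrier G \<subseteq> carrier Q" by auto
  then show ?thesis
    using assms(2) by (intro finI[of _ h] normal_kernel)
      (auto simp: kernel_def intro: finite_subset)
qed

lemma (in group) finite_index_normal_Int:
  assumes "N \<in> finite_index_normal G" "M \<in> finite_index_normal G"
  shows "N \<inter> M \<in> finite_index_normal G"
proof -
  have N: "N \<lhd> G" "M \<lhd> G" "finite (rcosets N)" "finite (rcosets M)"
    using assms by (auto simp: finite_index_normal_def)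
  have "N \<inter> M \<lhd> G"
    using N by (auto simp: normal_inv_iff intro: subgroups_Inter_pair)
  moreover have "(\<lambda>g. (N #> g, M #> g)) ` carrier G \<subseteq> (rcosets N) \<times> (rcosets M)"
    by (auto simp: RCOSETS_def)
  then have "finite ((\<lambda>g. (N #> g, M #> g)) ` carrier G)"
    using N finite_subset by blast
  ultimately show ?thesis
    using N rcos_eq_iff by (intro finite_index_normalI[of _ "\<lambda>g. (N #> g, M #> g)"]) auto
qed

lemma (in group) finite_index_normal_INT:
  assumes "finite D" "\<And>x. x \<in> D \<Longrightarrow> \<exists>N\<in>finite_index_normal G. Q x N"
    and mono: "\<And>x N M. Q x M \<Longrightarrow> N \<subseteq> M \<Longrightarrow> Q x N"
  shows "\<exists>N\<in>finite_index_normal G. \<forall>x\<in>D. Q x N"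
  using assms(1,2)
proof (induction D rule: finite_induct)
  case empty
  have "carrier G \<in> finite_index_normal G"
    by (rule finite_index_normalI[of _ "\<lambda>_. ()"])
      (auto simp: normal_inv_iff subgroup_self)
  then show ?case by blast
next
  case (insert x D)
  obtain N where N: "N \<in> finite_index_normal G" "\<forall>x\<in>D. Q x N"
    using insert.IH insert.prems by blast
  obtain M where M: "M \<in> finite_index_normal G" "Q x M" using insert.prems by blast
  have "\<forall>y\<in>insert x D. Q y (N \<inter> M)"
    using N(2) M(2) mono[of _ N "N \<inter> M"] mono[of x M "N \<inter> M"] by auto
  then show ?case using finite_index_normal_Int[OF N(1) M(1)] by blast
qed

text \<open>The argument is a coset and not an element of \<open>G\<close>, since an element of the profinite completion
only provides cosets.\<close>

definition mod_ord :: "('a, 'b) monoid_scheme \<Rightarrow> 'a set \<Rightarrow> 'a set \<Rightarrow> nat" where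
  "mod_ord G N C = group.ord (G Mod N) C"

lemma (in group) mod_ord_dvd_iff:
  assumes "N \<lhd> G" "g \<in> carrier G"
  shows "mod_ord G N (N #> g) dvd k \<longleftrightarrow> g [^] k \<in> N"
proof -
  interpret normal N G by fact
  interpret Q: group "G Mod N" by (rule factorgroup_is_group)
  have "N #> g \<in> carrier (G Mod N)" using assms by (auto simp: carrier_FactGroup)
  then have "mod_ord G N (N #> g) dvd k \<longleftrightarrow> N #> (g [^] k) = N"
    using assms by (simp add: mod_ord_def flip: Q.pow_eq_id add: FactGroup_pow)
  also have "\<dots> \<longleftrightarrow> g [^] k \<in> N"
    using assms coset_join1 coset_join2 is_subgroup subset by (metis nat_pow_closed)
  finally show ?thesis .
qed

lemma (in group) mod_ord_dvd_index:
  assumes "N \<in> finite_index_normal G" "C \<in> carrier (G Mod N)"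
  shows "mod_ord G N C dvd card (rcosets N)" "mod_ord G N C > 0"
proof -
  interpret normal N G using assms by (auto simp: finite_index_normal_def)
  interpret Q: group "G Mod N" by (rule factorgroup_is_group)
  have fin: "finite (carrier (G Mod N))"
    using assms by (auto simp: finite_index_normal_def FactGroup_def)
  show "mod_ord G N C dvd card (rcosets N)" "mod_ord G N C > 0"
    using Q.ord_dvd_group_order[OF assms(2)] Q.ord_ge_1[OF fin assms(2)]
    by (auto simp: mod_ord_def order_def FactGroup_def)
qed

section \<open>The profinite completion\<close>

lemma (in group) subgroup_profinite_completion:
  "subgroup (carrier (profinite_completion G))
     (product_group (finite_index_normal G) (\<lambda>N. G Mod N))"
proof -
  let ?I = "finite_index_normal G"
  let ?P = "product_group ?I (\<lambda>N. G Mod N)"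
  have nrm: "N \<lhd> G" if "N \<in> ?I" for N using that by (auto simp: finite_index_normal_def)
  have gr: "group (G Mod N)" if "N \<in> ?I" for N using nrm[OF that] by (rule normal.factorgroup_is_group)
  then interpret P: group ?P by simp
  show ?thesis
  proof (rule P.subgroupI)
    show "carrier (profinite_completion G) \<subseteq> carrier ?P"
      by (auto simp: profinite_completion_def)
    have "(\<lambda>N\<in>?I. N) \<in> carrier (profinite_completion G)"
      using gr group.is_monoid monoid.one_closed by (force simp: profinite_completion_def)
    then show "carrier (profinite_completion G) \<noteq> {}" by blast
  next
    fix \<phi> assume "\<phi> \<in> carrier (profinite_completion G)"
    then have \<phi>: "\<phi> \<in> (\<Pi>\<^sub>E N\<in>?I. carrier (G Mod N))" "\<And>N M. N \<in> ?I \<Longrightarrow> M \<in> ?I \<Longrightarrow> N \<subseteq> M \<Longrightarrow> \<phi> N \<subseteq> \<phi> M"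
      by (auto simp: profinite_completion_def)
    have "inv\<^bsub>?P\<^esub> \<phi> \<in> carrier ?P" using \<phi> by (intro P.inv_closed) simp
    moreover have "inv\<^bsub>?P\<^esub> \<phi> = (\<lambda>N\<in>?I. set_inv (\<phi> N))"
      using \<phi> gr nrm by (auto simp: inv_product_group normal.inv_FactGroup PiE_iff intro!: restrict_ext)
    moreover have "set_inv (\<phi> N) \<subseteq> set_inv (\<phi> M)" if "N \<in> ?I" "M \<in> ?I" "N \<subseteq> M" for N M
      using \<phi>(2)[OF that] by (auto simp: SET_INV_def)
    ultimately show "inv\<^bsub>?P\<^esub> \<phi> \<in> carrier (profinite_completion G)"
      by (auto simp: profinite_completion_def)
    fix \<psi> assume "\<psi> \<in> carrier (profinite_completion G)"
    then have \<psi>: "\<psi> \<in> (\<Pi>\<^sub>E N\<in>?I. carrier (G Mod N))" "\<And>N M. N \<in> ?I \<Longrightarrow> M \<in> ?I \<Longrightarrow> N \<subseteq> M \<Longrightarrow> \<psi> N \<subseteq> \<psi> M"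
      by (auto simp: profinite_completion_def)
    have "\<phi> \<otimes>\<^bsub>?P\<^esub> \<psi> \<in> carrier ?P" using \<phi>(1) \<psi>(1) by (intro P.m_closed) auto
    moreover have "\<phi> N <#> \<psi> N \<subseteq> \<phi> M <#> \<psi> M" if "N \<in> ?I" "M \<in> ?I" "N \<subseteq> M" for N M
      using \<phi>(2)[OF that] \<psi>(2)[OF that] by (auto simp: set_mult_def)
    ultimately show "\<phi> \<otimes>\<^bsub>?P\<^esub> \<psi> \<in> carrier (profinite_completion G)"
      by (auto simp: profinite_completion_def)
  qed
qed

lemma (in group) group_profinite_completion: "group (profinite_completion G)"
proof -
  let ?P = "product_group (finite_index_normal G) (\<lambda>N. G Mod N)"
  have "group ?P"
    by (intro product_group) (auto simp: finite_index_normal_def intro!: normal.factorgroup_is_group)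
  then have "group (?P\<lparr>carrier := carrier (profinite_completion G)\<rparr>)"
    using subgroup_profinite_completion by (rule subgroup.subgroup_is_group[rotated])
  then show ?thesis by (simp add: profinite_completion_def)
qed

lemma (in group) profinite_projection_hom:
  "N \<in> finite_index_normal G \<Longrightarrow> (\<lambda>\<phi>. \<phi> N) \<in> hom (profinite_completion G) (G Mod N)"
  by (auto simp: hom_def profinite_completion_def)

lemma (in group) profinite_element_coset:
  assumes "\<phi> \<in> carrier (profinite_completion G)" "N \<in> finite_index_normal G"
  shows "\<exists>g\<in>carrier G. \<phi> N = N #> g"
  using assms by (force simp: profinite_completion_def PiE_iff carrier_FactGroup)

lemma (in group) canonical_in_profinite_completion:
  assumes "g \<in> carrier G"
  shows "(\<lambda>N\<in>finite_index_normal G. N #> g) \<in> carrier (profinite_completion G)"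
  using assms by (auto simp: profinite_completion_def carrier_FactGroup r_coset_def)

lemma (in group) profinite_coset_mono:
  assumes "\<phi> \<in> carrier (profinite_completion G)"
    "N \<in> finite_index_normal G" "M \<in> finite_index_normal G" "N \<subseteq> M" "g \<in> carrier G" "\<phi> N = N #> g"
  shows "\<phi> M = M #> g"
proof -
  have nrm: "N \<lhd> G" "M \<lhd> G" using assms by (auto simp: finite_index_normal_def)
  have "\<phi> N \<subseteq> \<phi> M" using assms(1-4) by (auto simp: profinite_completion_def)
  then have "g \<in> \<phi> M"
    using assms(5,6) rcos_self[OF assms(5) normal_imp_subgroup[OF nrm(1)]] by auto
  moreover obtain h where "h \<in> carrier G" "\<phi> M = M #> h"
    using profinite_element_coset[OF assms(1,3)] by blast
  ultimately show ?thesis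
    using repr_independence[of g M h] normal_imp_subgroup[OF nrm(2)] by simp
qed

lemma (in group) mod_ord_mono:
  assumes "\<phi> \<in> carrier (profinite_completion G)"
    "N \<in> finite_index_normal G" "M \<in> finite_index_normal G" "N \<subseteq> M"
  shows "mod_ord G M (\<phi> M) dvd mod_ord G N (\<phi> N)"
proof -
  have nrm: "N \<lhd> G" "M \<lhd> G" using assms by (auto simp: finite_index_normal_def)
  obtain g where g: "g \<in> carrier G" "\<phi> N = N #> g"
    using profinite_element_coset[OF assms(1,2)] by blast
  have M: "\<phi> M = M #> g"
    using profinite_coset_mono[where \<phi> = \<phi> and N = N and M = M and g = g] assms g by simp
  have "g [^] mod_ord G N (\<phi> N) \<in> N"
    using mod_ord_dvd_iff[OF nrm(1) g(1)] g(2) dvd_refl by metis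
  then show ?thesis
    using mod_ord_dvd_iff[OF nrm(2) g(1)] M assms(4) by auto
qed

text \<open>Orders can only grow when the quotient gets larger. If they are unbounded for \<open>s\<close>, some quotient
makes the order large; if they are bounded, a quotient where the maximum is attained makes it
stable. Both properties survive passing to a smaller subgroup, hence a finite intersection.\<close>

lemma (in group) large_or_stable_orders:
  assumes "finite S" "S \<subseteq> carrier (profinite_completion G)" "N0 \<in> finite_index_normal G"
  shows "\<exists>K\<in>finite_index_normal G. K \<subseteq> N0 \<and> (\<forall>s\<in>S. L \<le> mod_ord G K (s K) \<or>
    (\<forall>N\<in>finite_index_normal G. N \<subseteq> K \<longrightarrow> mod_ord G N (s N) = mod_ord G K (s K)))"
  using assms(1,2)
proof (induction S rule: finite_induct)
  case empty
  then show ?case using assms(3) by auto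
next
  case (insert s S)
  let ?I = "finite_index_normal G"
  let ?good = "\<lambda>s K. L \<le> mod_ord G K (s K) \<or> (\<forall>N\<in>?I. N \<subseteq> K \<longrightarrow> mod_ord G N (s N) = mod_ord G K (s K))"
  have pos: "mod_ord G N (\<phi> N) > 0" if "\<phi> \<in> carrier (profinite_completion G)" "N \<in> ?I" for \<phi> N
    using that by (intro mod_ord_dvd_index) (auto simp: profinite_completion_def)
  have mono: "?good \<phi> N" if "?good \<phi> M" "N \<subseteq> M" "N \<in> ?I" "M \<in> ?I" "\<phi> \<in> carrier (profinite_completion G)" for \<phi> N M
  proof (cases "L \<le> mod_ord G M (\<phi> M)")
    case True
    have "mod_ord G M (\<phi> M) \<le> mod_ord G N (\<phi> N)"
      by (rule dvd_imp_le[OF mod_ord_mono[OF that(5,3,4,2)] pos[OF that(5,3)]])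
    then show ?thesis using True by simp
  next
    case False
    then have "\<forall>N'\<in>?I. N' \<subseteq> M \<longrightarrow> mod_ord G N' (\<phi> N') = mod_ord G M (\<phi> M)"
      using that(1) by blast
    then show ?thesis using that(2,3) by (metis subset_trans)
  qed
  obtain K where K: "K \<in> ?I" "K \<subseteq> N0" "\<forall>s\<in>S. ?good s K"
  proof -
    have "S \<subseteq> carrier (profinite_completion G)" using insert.prems by auto
    from insert.IH[OF this] show ?thesis using that by blast
  qed
  have s: "s \<in> carrier (profinite_completion G)" using insert by auto
  have "\<exists>N\<in>?I. ?good s N"
  proof (cases "\<exists>N\<in>?I. L \<le> mod_ord G N (s N)")
    case True
    then show ?thesis by blast
  next
    case False
    define m where "m = Max ((\<lambda>N. mod_ord G N (s N)) ` ?I)"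
    have "(\<lambda>N. mod_ord G N (s N)) ` ?I \<subseteq> {..L}" using False by auto
    then have fin: "finite ((\<lambda>N. mod_ord G N (s N)) ` ?I)" using finite_subset by blast
    then have "m \<in> (\<lambda>N. mod_ord G N (s N)) ` ?I"
      unfolding m_def using K by (intro Max_in) auto
    then obtain N where N: "N \<in> ?I" "mod_ord G N (s N) = m" by blast
    have "mod_ord G N' (s N') = m" if "N' \<in> ?I" "N' \<subseteq> N" for N'
    proof (rule antisym)
      show "mod_ord G N' (s N') \<le> m" unfolding m_def using fin that by auto
      show "m \<le> mod_ord G N' (s N')"
        using dvd_imp_le[OF mod_ord_mono[OF s that(1) N(1) that(2)] pos[OF s that(1)]] N(2) by simp
    qed
    then have "?good s N" using N(2) by simp
    with N(1) show ?thesis by blast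
  qed
  then obtain N where N: "N \<in> ?I" "?good s N" by blast
  have KN: "K \<inter> N \<in> ?I" using K N by (intro finite_index_normal_Int)
  have "?good t (K \<inter> N)" if "t \<in> insert s S" for t
  proof (cases "t = s")
    case True
    then show ?thesis using mono[OF N(2) _ KN N(1) s] by simp
  next
    case False
    then have t: "t \<in> S" "t \<in> carrier (profinite_completion G)" using that insert.prems by auto
    have "?good t K" using K(3) t(1) by blast
    then show ?thesis by (rule mono[OF _ _ KN K(1) t(2)]) simp
  qed
  then show ?case using KN K(2) by (intro bexI[of _ "K \<inter> N"] conjI ballI) auto
qed

text \<open>The elements of the completion whose component at \<open>N\<close> lies in \<open>P/N\<close> form a closed subgroup. It
contains suitable conjugates of all elements of \<open>S\<close>, the conjugating elements being taken from \<open>G\<close>, so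
invariable generation forces it to be everything.\<close>

lemma (in group) invariable_generation_finite_quotient:
  assumes inv_gen: "invariably_generates (profinite_completion G) (profinite_completion_topology G) S"
    and S: "S \<subseteq> carrier (profinite_completion G)"
    and N: "N \<in> finite_index_normal G" and P: "subgroup P G" "N \<subseteq> P"
    and conj: "\<And>s. s \<in> S \<Longrightarrow> \<exists>g\<in>carrier G. \<exists>k\<in>carrier G. s N = N #> g \<and> inv k \<otimes> g \<otimes> k \<in> P"
  shows "P = carrier G"
proof -
  let ?C = "profinite_completion G" and ?T = "profinite_completion_topology G"
  interpret C: group ?C by (rule group_profinite_completion)
  interpret N: normal N G using N by (auto simp: finite_index_normal_def)
  interpret Q: group "G Mod N" by (rule N.factorgroup_is_group)
  interpret p: group_hom ?C "G Mod N" "\<lambda>\<phi>. \<phi> N"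
    by unfold_locales (rule profinite_projection_hom[OF N])
  interpret q: group_hom G "G Mod N" "\<lambda>g. N #> g"
    by unfold_locales (rule N.r_coset_hom_Mod)
  define PN where "PN = (\<lambda>g. N #> g) ` P"
  interpret PN: subgroup PN "G Mod N"
    unfolding PN_def by (rule q.subgroup_img_is_subgroup[OF P(1)])
  obtain g k where g: "g s \<in> carrier G" "k s \<in> carrier G" "s N = N #> g s"
    "inv (k s) \<otimes> g s \<otimes> k s \<in> P" if "s \<in> S" for s
    using conj by metis
  define c where "c s = (\<lambda>M\<in>finite_index_normal G. M #> k s)" for s
  have c: "c \<in> S \<rightarrow> carrier ?C"
    using g canonical_in_profinite_completion by (auto simp: c_def)
  let ?D = "(\<lambda>s. inv\<^bsub>?C\<^esub> c s \<otimes>\<^bsub>?C\<^esub> s \<otimes>\<^bsub>?C\<^esub> c s) ` S"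
  define U where "U = {\<phi> \<in> carrier ?C. \<phi> N \<in> PN}"
  have D: "?D \<subseteq> U"
  proof safe
    fix s assume s: "s \<in> S"
    then have cs: "c s \<in> carrier ?C" "s \<in> carrier ?C" "c s N = N #> k s"
      using c S N by (auto simp: c_def)
    then have "(inv\<^bsub>?C\<^esub> c s \<otimes>\<^bsub>?C\<^esub> s \<otimes>\<^bsub>?C\<^esub> c s) N =
        inv\<^bsub>G Mod N\<^esub> (N #> k s) \<otimes>\<^bsub>G Mod N\<^esub> (N #> g s) \<otimes>\<^bsub>G Mod N\<^esub> (N #> k s)"
      using g(3)[OF s] p.hom_mult p.hom_inv C.inv_closed C.m_closed by metis
    also have "\<dots> = N #> (inv (k s) \<otimes> g s \<otimes> k s)"
      using g[OF s] q.hom_mult q.hom_inv inv_closed m_closed by metis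
    finally show "inv\<^bsub>?C\<^esub> c s \<otimes>\<^bsub>?C\<^esub> s \<otimes>\<^bsub>?C\<^esub> c s \<in> U"
      using g(4)[OF s] cs by (auto simp: U_def PN_def)
  qed
  have "subgroup U ?C"
  proof (rule C.subgroupI)
    show "U \<subseteq> carrier ?C" by (auto simp: U_def)
    have "\<one>\<^bsub>?C\<^esub> \<in> U" using p.hom_one PN.one_closed by (auto simp: U_def)
    then show "U \<noteq> {}" by blast
  next
    fix \<phi> assume \<phi>: "\<phi> \<in> U"
    then show "inv\<^bsub>?C\<^esub> \<phi> \<in> U" using p.hom_inv PN.m_inv_closed by (auto simp: U_def)
    fix \<psi> assume "\<psi> \<in> U"
    then show "\<phi> \<otimes>\<^bsub>?C\<^esub> \<psi> \<in> U" using \<phi> p.hom_mult PN.m_closed by (auto simp: U_def)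
  qed
  then have "generate ?C ?D \<subseteq> U"
    using D C.generate_subgroup_incl by blast
  moreover have "closedin ?T U"
  proof -
    let ?X = "product_topology (\<lambda>N. discrete_topology (carrier (G Mod N))) (finite_index_normal G)"
    have "continuous_map ?X (discrete_topology (carrier (G Mod N))) (\<lambda>\<phi>. \<phi> N)"
      using continuous_map_product_projection[OF N, of "\<lambda>N. discrete_topology (carrier (G Mod N))"]
      by simp
    then have "closedin ?X {\<phi> \<in> topspace ?X. \<phi> N \<in> PN}"
      using PN.subset by (intro closedin_continuous_map_preimage) auto
    moreover have "U = {\<phi> \<in> topspace ?X. \<phi> N \<in> PN} \<inter> carrier ?C"
      by (auto simp: U_def profinite_completion_def)
    ultimately show ?thesis
      unfolding profinite_completion_topology_def closedin_subtopology by blast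
  qed
  ultimately have "?T closure_of generate ?C ?D \<subseteq> U"
    by (rule closure_of_minimal)
  then have U: "carrier ?C \<subseteq> U"
    using inv_gen c by (auto simp: invariably_generates_def)
  have "h \<in> P" if h: "h \<in> carrier G" for h
  proof -
    have "(\<lambda>M\<in>finite_index_normal G. M #> h) \<in> U"
      using U canonical_in_profinite_completion[OF h] by blast
    then obtain h' where h': "h' \<in> P" "N #> h = N #> h'"
      using N by (auto simp: U_def PN_def)
    then have "h' \<in> carrier G" "h \<otimes> inv h' \<in> P"
      using h P rcos_eq_iff[OF N.normal_axioms h] subgroup.mem_carrier[OF P(1)] by auto
    then have "h \<otimes> inv h' \<otimes> h' \<in> P"
      using P(1) h'(1) subgroup.m_closed by metis
    then show ?thesis using h \<open>h' \<in> carrier G\<close> by (simp add: m_assoc)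
  qed
  then show ?thesis using subgroup.subset[OF P(1)] by blast
qed

section \<open>Proper subgroups from additive functions\<close>

lemma (in group) mult_inv_cancel:
  assumes "x \<in> carrier G" "y \<in> carrier G"
  shows "x \<otimes> (inv x \<otimes> y) = y" "inv x \<otimes> (x \<otimes> y) = y"
  using assms by (simp_all flip: m_assoc)

text \<open>Consider the functions \<open>f : G \<rightarrow> \<int>/M\<close> with \<open>f (k x) = u k + f x\<close> for \<open>k \<in> K\<close>, on which \<open>g\<close> acts by
\<open>f \<mapsto> f (_ g)\<close>. An element \<open>k \<in> K\<close> acts by adding \<open>x \<mapsto> u (x k x\<^sup>-\<^sup>1)\<close>. Averaging \<open>u\<close> over \<open>G/K\<close> gives
an \<open>f\<close> whose \<open>G\<close>-orbit is a single \<open>K\<close>-orbit, and \<open>P\<close> is its stabiliser. If \<open>g^n\<close> acts trivially,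
the average of \<open>f\<close> over the powers of \<open>g\<close> is a point of the orbit which \<open>g\<close> fixes, so a conjugate of
\<open>g\<close> fixes \<open>f\<close>. The choice \<open>M = |G/K| + 1\<close> makes \<open>|G/K|\<close> and its divisors invertible, with
\<open>1/|G/K| = -1\<close>.\<close>

lemma (in group) exists_proper_subgroup_with_conjugates:
  fixes u :: "'a \<Rightarrow> int"
  assumes K: "K \<lhd> G" and fin: "finite (rcosets K)" and M: "M = int (card (rcosets K)) + 1"
    and hom: "\<forall>k\<in>K. \<forall>g\<in>carrier G. [u (k \<otimes> g) = u k + u g] (mod M)"
    and nz: "\<exists>k\<in>K. \<not> [u k = 0] (mod M)"
  shows "\<exists>P. subgroup P G \<and> P \<noteq> carrier G \<and>
    (\<forall>n\<in>K. (\<forall>x\<in>carrier G. [u (x \<otimes> n \<otimes> inv x) = 0] (mod M)) \<longrightarrow> n \<in> P) \<and>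
    (\<forall>g\<in>carrier G. \<forall>n. n dvd card (rcosets K) \<and> g [^] n \<in> K \<and>
        (\<forall>x\<in>carrier G. [u (x \<otimes> g [^] n \<otimes> inv x) = 0] (mod M)) \<longrightarrow>
      (\<exists>k\<in>carrier G. inv k \<otimes> g \<otimes> k \<in> P))"
proof -
  interpret normal K G by fact
  have u: "[u (k \<otimes> g) = u k + u g] (mod M)" if "k \<in> K" "g \<in> carrier G" for k g
    using hom that by blast
  define c where "c = card (rcosets K)"
  have c: "[- int c = 1] (mod M)"
  proof -
    have "- int c - 1 = - M" by (simp add: M c_def)
    then show ?thesis by (simp only: cong_iff_dvd_diff dvd_minus_iff dvd_refl)
  qed
  have Kc: "k \<in> carrier G" if "k \<in> K" for k using that subset by auto
  have conjK: "x \<otimes> k \<otimes> inv x \<in> K" if "x \<in> carrier G" "k \<in> K" for x k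
    using that inv_op_closed2 by blast
  have u1: "[u \<one> = 0] (mod M)"
    using u[of \<one> \<one>] by (simp add: cong_iff_dvd_diff)
  \<comment> \<open>the translations by elements of \<open>K\<close>; they form a group, so averages of them stay inside\<close>
  define \<Lambda> where "\<Lambda> = {l. \<exists>\<kappa>\<in>K. \<forall>x\<in>carrier G. [l x = u (x \<otimes> \<kappa> \<otimes> inv x)] (mod M)}"
  have LE: "\<exists>\<kappa>\<in>K. \<forall>x\<in>carrier G. [l x = u (x \<otimes> \<kappa> \<otimes> inv x)] (mod M)" if "l \<in> \<Lambda>" for l
    using that by (simp add: \<Lambda>_def)
  have L0: "(\<lambda>x. 0) \<in> \<Lambda>"
    unfolding \<Lambda>_def using u1 by (auto intro!: bexI[of _ \<one>] simp: cong_sym)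
  have Ladd: "(\<lambda>x. l x + l' x) \<in> \<Lambda>" if "l \<in> \<Lambda>" "l' \<in> \<Lambda>" for l l'
  proof -
    from LE[OF that(1)] LE[OF that(2)] obtain \<kappa> \<kappa>' where \<kappa>: "\<kappa> \<in> K" "\<And>x. x \<in> carrier G \<Longrightarrow> [l x = u (x \<otimes> \<kappa> \<otimes> inv x)] (mod M)"
      "\<kappa>' \<in> K" "\<And>x. x \<in> carrier G \<Longrightarrow> [l' x = u (x \<otimes> \<kappa>' \<otimes> inv x)] (mod M)"
      by blast
    have "[l x + l' x = u (x \<otimes> (\<kappa> \<otimes> \<kappa>') \<otimes> inv x)] (mod M)" if x: "x \<in> carrier G" for x
    proof -
      have "x \<otimes> (\<kappa> \<otimes> \<kappa>') \<otimes> inv x = (x \<otimes> \<kappa> \<otimes> inv x) \<otimes> (x \<otimes> \<kappa>' \<otimes> inv x)"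
        using x \<kappa>(1,3) Kc by (simp add: m_assoc mult_inv_cancel)
      then have "[u (x \<otimes> (\<kappa> \<otimes> \<kappa>') \<otimes> inv x) = u (x \<otimes> \<kappa> \<otimes> inv x) + u (x \<otimes> \<kappa>' \<otimes> inv x)] (mod M)"
        using u[OF conjK[OF x \<kappa>(1)] Kc[OF conjK[OF x \<kappa>(3)]]] by simp
      then show ?thesis
        by (rule cong_trans[OF cong_add[OF \<kappa>(2)[OF x] \<kappa>(4)[OF x]] cong_sym])
    qed
    then show ?thesis unfolding \<Lambda>_def using \<kappa>(1,3) by blast
  qed
  have Lneg: "(\<lambda>x. - l x) \<in> \<Lambda>" if "l \<in> \<Lambda>" for l
  proof -
    from LE[OF that] obtain \<kappa> where \<kappa>: "\<kappa> \<in> K" "\<And>x. x \<in> carrier G \<Longrightarrow> [l x = u (x \<otimes> \<kappa> \<otimes> inv x)] (mod M)"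
      by blast
    have "[- l x = u (x \<otimes> inv \<kappa> \<otimes> inv x)] (mod M)" if x: "x \<in> carrier G" for x
    proof -
      have "(x \<otimes> \<kappa> \<otimes> inv x) \<otimes> (x \<otimes> inv \<kappa> \<otimes> inv x) = \<one>"
        using x \<kappa>(1) Kc by (simp add: m_assoc mult_inv_cancel)
      then have "[u \<one> = u (x \<otimes> \<kappa> \<otimes> inv x) + u (x \<otimes> inv \<kappa> \<otimes> inv x)] (mod M)"
        using u[OF conjK[OF x \<kappa>(1)], of "x \<otimes> inv \<kappa> \<otimes> inv x"] x \<kappa>(1) Kc by simp
      then have "[u (x \<otimes> \<kappa> \<otimes> inv x) + u (x \<otimes> inv \<kappa> \<otimes> inv x) = 0] (mod M)"
        using u1 by (blast intro: cong_trans cong_sym)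
      from cong_diff[OF this cong_sym[OF \<kappa>(2)[OF x]]] show ?thesis
        by (simp add: cong_sym_eq)
    qed
    then show ?thesis unfolding \<Lambda>_def using \<kappa>(1) m_inv_closed by blast
  qed
  have Lsum: "(\<lambda>x. \<Sum>a\<in>A. l a x) \<in> \<Lambda>" if "finite A" "\<And>a. a \<in> A \<Longrightarrow> l a \<in> \<Lambda>"
    for A :: "'z set" and l :: "'z \<Rightarrow> 'a \<Rightarrow> int"
    using that by (induction A rule: finite_induct) (auto intro!: L0 Ladd)
  have Lcong: "l \<in> \<Lambda>" if "l' \<in> \<Lambda>" "\<And>x. x \<in> carrier G \<Longrightarrow> [l x = l' x] (mod M)" for l l'
    using that unfolding \<Lambda>_def by (blast intro: cong_trans)
  define rep where "rep C = (SOME g. g \<in> C)" for C :: "'a set"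
  have rep: "rep C \<in> C" "rep C \<in> carrier G" "K #> rep C = C" if C: "C \<in> rcosets K" for C
  proof -
    obtain g where g: "g \<in> carrier G" "C = K #> g" using C by (auto simp: RCOSETS_def)
    then have "g \<in> C" using rcos_self is_subgroup by auto
    then show r: "rep C \<in> C" unfolding rep_def by (rule someI)
    then show "rep C \<in> carrier G" using g subset r_coset_subset_G by blast
    show "K #> rep C = C" using r g repr_independence is_subgroup by metis
  qed
  \<comment> \<open>the average of \<open>u\<close> over the cosets: the minus sign is the factor \<open>1/|G/K|\<close>\<close>
  define f where "f x = - (\<Sum>C\<in>rcosets K. u (x \<otimes> rep C))" for x
  have fK: "[f (k \<otimes> x) = u k + f x] (mod M)" if "k \<in> K" "x \<in> carrier G" for k x
  proof -
    have "[(\<Sum>C\<in>rcosets K. u (k \<otimes> x \<otimes> rep C)) = (\<Sum>C\<in>rcosets K. u k + u (x \<otimes> rep C))] (mod M)"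
      using that rep Kc by (intro cong_sum) (simp add: m_assoc u)
    also have "(\<Sum>C\<in>rcosets K. u k + u (x \<otimes> rep C)) = int c * u k - f x"
      by (simp add: sum.distrib f_def c_def)
    finally have "[f (k \<otimes> x) = - int c * u k + f x] (mod M)"
      by (simp add: f_def cong_iff_dvd_diff dvd_diff_commute algebra_simps)
    moreover have "[- int c * u k + f x = 1 * u k + f x] (mod M)"
      by (intro cong_add cong_mult c cong_refl)
    ultimately have "[f (k \<otimes> x) = 1 * u k + f x] (mod M)" by (rule cong_trans)
    then show ?thesis by simp
  qed
  have fG: "(\<lambda>x. f (x \<otimes> g) - f x) \<in> \<Lambda>" if g: "g \<in> carrier G" for g
  proof -
    \<comment> \<open>multiplication by \<open>g\<close> permutes the cosets, up to elements \<open>\<kappa> C\<close> of \<open>K\<close>\<close>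
    define \<sigma> where "\<sigma> C = K #> (g \<otimes> rep C)" for C
    have \<sigma>: "\<sigma> C \<in> rcosets K" if "C \<in> rcosets K" for C
      using g rep(2)[OF that] unfolding \<sigma>_def by (intro rcosetsI subset) auto
    define \<kappa> where "\<kappa> C = g \<otimes> rep C \<otimes> inv rep (\<sigma> C)" for C
    have \<kappa>: "\<kappa> C \<in> K" "g \<otimes> rep C = \<kappa> C \<otimes> rep (\<sigma> C)" if C: "C \<in> rcosets K" for C
    proof -
      have "g \<otimes> rep C \<in> K #> rep (\<sigma> C)"
        using rep[OF \<sigma>[OF C]] rep(2)[OF C] g rcos_self is_subgroup by (auto simp: \<sigma>_def)
      then obtain k where k: "k \<in> K" "g \<otimes> rep C = k \<otimes> rep (\<sigma> C)" by (auto simp: r_coset_def)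
      then have "\<kappa> C = k" using rep(2)[OF \<sigma>[OF C]] Kc by (simp add: \<kappa>_def m_assoc)
      then show "\<kappa> C \<in> K" "g \<otimes> rep C = \<kappa> C \<otimes> rep (\<sigma> C)" using k by auto
    qed
    have "inj_on \<sigma> (rcosets K)"
    proof (rule inj_onI)
      fix C D assume CD: "C \<in> rcosets K" "D \<in> rcosets K" "\<sigma> C = \<sigma> D"
      then have "g \<otimes> rep C \<otimes> inv (g \<otimes> rep D) \<in> K"
        using g rep(2) rcos_eq_iff[OF K] by (auto simp: \<sigma>_def)
      then have "inv g \<otimes> (g \<otimes> rep C \<otimes> inv (g \<otimes> rep D)) \<otimes> g \<in> K"
        using g inv_op_closed1 by blast
      moreover have "inv g \<otimes> (g \<otimes> rep C \<otimes> inv (g \<otimes> rep D)) \<otimes> g = rep C \<otimes> inv rep D"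
        using g rep(2)[OF CD(1)] rep(2)[OF CD(2)] by (simp add: inv_mult_group m_assoc mult_inv_cancel)
      ultimately have "rep C \<otimes> inv rep D \<in> K" by simp
      then have "K #> rep C = K #> rep D"
        using rep(2)[OF CD(1)] rep(2)[OF CD(2)] rcos_eq_iff[OF K] by simp
      then show "C = D" using rep(3) CD by simp
    qed
    then have bij: "bij_betw \<sigma> (rcosets K) (rcosets K)"
      using \<sigma> endo_inj_surj[OF fin, of \<sigma>] by (auto simp: bij_betw_def)
    have "(\<lambda>x. - (\<Sum>C\<in>rcosets K. u (x \<otimes> \<kappa> C \<otimes> inv x))) \<in> \<Lambda>"
    proof (rule Lneg, rule Lsum[OF fin])
      fix C assume "C \<in> rcosets K"
      then show "(\<lambda>x. u (x \<otimes> \<kappa> C \<otimes> inv x)) \<in> \<Lambda>"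
        unfolding \<Lambda>_def using \<kappa> by (auto intro!: bexI[of _ "\<kappa> C"])
    qed
    then show ?thesis
    proof (rule Lcong)
      fix x assume x: "x \<in> carrier G"
      have "[(\<Sum>C\<in>rcosets K. u (x \<otimes> g \<otimes> rep C)) =
          (\<Sum>C\<in>rcosets K. u (x \<otimes> \<kappa> C \<otimes> inv x) + u (x \<otimes> rep (\<sigma> C)))] (mod M)"
      proof (rule cong_sum)
        fix C assume C: "C \<in> rcosets K"
        have "x \<otimes> g \<otimes> rep C = x \<otimes> \<kappa> C \<otimes> inv x \<otimes> (x \<otimes> rep (\<sigma> C))"
          using x g rep(2)[OF C] rep(2)[OF \<sigma>[OF C]] \<kappa>[OF C] Kc by (simp add: m_assoc mult_inv_cancel)
        then show "[u (x \<otimes> g \<otimes> rep C) = u (x \<otimes> \<kappa> C \<otimes> inv x) + u (x \<otimes> rep (\<sigma> C))] (mod M)"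
          using u[OF conjK[OF x \<kappa>(1)[OF C]], of "x \<otimes> rep (\<sigma> C)"] x rep(2)[OF \<sigma>[OF C]] by simp
      qed
      also have "(\<Sum>C\<in>rcosets K. u (x \<otimes> \<kappa> C \<otimes> inv x) + u (x \<otimes> rep (\<sigma> C))) =
          (\<Sum>C\<in>rcosets K. u (x \<otimes> \<kappa> C \<otimes> inv x)) - f x"
        using sum.reindex_bij_betw[OF bij, of "\<lambda>C. u (x \<otimes> rep C)"] by (simp add: sum.distrib f_def)
      finally show "[f (x \<otimes> g) - f x = - (\<Sum>C\<in>rcosets K. u (x \<otimes> \<kappa> C \<otimes> inv x))] (mod M)"
        by (simp add: f_def cong_iff_dvd_diff dvd_diff_commute algebra_simps)
    qed
  qed
  define P where "P = {g \<in> carrier G. \<forall>x\<in>carrier G. [f (x \<otimes> g) = f x] (mod M)}"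
  have "subgroup P G"
  proof (rule subgroupI)
    show "P \<subseteq> carrier G" by (auto simp: P_def)
    have "\<one> \<in> P" by (auto simp: P_def)
    then show "P \<noteq> {}" by blast
  next
    fix g assume g: "g \<in> P"
    have "[f (x \<otimes> inv g) = f x] (mod M)" if x: "x \<in> carrier G" for x
    proof -
      have "[f (x \<otimes> inv g \<otimes> g) = f (x \<otimes> inv g)] (mod M)" using g x by (auto simp: P_def)
      then show ?thesis using g x by (simp add: P_def m_assoc cong_sym)
    qed
    then show "inv g \<in> P" using g by (auto simp: P_def)
    fix h assume h: "h \<in> P"
    have "[f (x \<otimes> (g \<otimes> h)) = f x] (mod M)" if x: "x \<in> carrier G" for x
    proof -
      have "[f (x \<otimes> g \<otimes> h) = f (x \<otimes> g)] (mod M)" "[f (x \<otimes> g) = f x] (mod M)"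
        using g h x by (auto simp: P_def)
      then show ?thesis using g h x by (auto simp: P_def m_assoc intro: cong_trans)
    qed
    then show "g \<otimes> h \<in> P" using g h by (auto simp: P_def)
  qed
  moreover have "P \<noteq> carrier G"
  proof
    assume "P = carrier G"
    moreover obtain k where k: "k \<in> K" "\<not> [u k = 0] (mod M)" using nz by auto
    ultimately have "k \<in> P" using Kc by simp
    then have "[f (\<one> \<otimes> k) = f \<one>] (mod M)" unfolding P_def by blast
    moreover have "[f (k \<otimes> \<one>) = u k + f \<one>] (mod M)" using k by (intro fK) auto
    ultimately have "[u k + f \<one> = 0 + f \<one>] (mod M)"
      using k Kc by (auto intro: cong_trans cong_sym)
    then show False using k(2) cong_add_rcancel by blast
  qed
  moreover have "n \<in> P" if n: "n \<in> K" "\<forall>x\<in>carrier G. [u (x \<otimes> n \<otimes> inv x) = 0] (mod M)" for n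
  proof -
    have "[f (x \<otimes> n) = f x] (mod M)" if x: "x \<in> carrier G" for x
    proof -
      have "[f (x \<otimes> n \<otimes> inv x \<otimes> x) = u (x \<otimes> n \<otimes> inv x) + f x] (mod M)"
        using x n conjK by (intro fK) auto
      moreover have "[u (x \<otimes> n \<otimes> inv x) + f x = 0 + f x] (mod M)"
        using n(2) x by (intro cong_add) auto
      ultimately have "[f (x \<otimes> n \<otimes> inv x \<otimes> x) = 0 + f x] (mod M)" by (rule cong_trans)
      then show ?thesis using x n Kc by (simp add: m_assoc)
    qed
    then show ?thesis using n Kc by (auto simp: P_def)
  qed
  moreover have "\<exists>k\<in>carrier G. inv k \<otimes> g \<otimes> k \<in> P"
    if g: "g \<in> carrier G" and n: "n dvd c" "g [^] n \<in> K"
      and triv: "\<forall>x\<in>carrier G. [u (x \<otimes> g [^] n \<otimes> inv x) = 0] (mod M)" for g n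
  proof -
    obtain q where q: "c = n * q" using n(1) by auto
    \<comment> \<open>the average over the powers of \<open>g\<close>: since \<open>n q = |G/K|\<close>, the factor \<open>1/n\<close> is \<open>- q\<close>\<close>
    define F where "F x = - int q * (\<Sum>i<n. f (x \<otimes> g [^] i))" for x
    have fn: "[f (x \<otimes> g [^] n) = f x] (mod M)" if x: "x \<in> carrier G" for x
    proof -
      have "[f (x \<otimes> g [^] n \<otimes> inv x \<otimes> x) = u (x \<otimes> g [^] n \<otimes> inv x) + f x] (mod M)"
        using x n conjK by (intro fK) auto
      moreover have "[u (x \<otimes> g [^] n \<otimes> inv x) + f x = 0 + f x] (mod M)"
        using triv x by (intro cong_add) auto
      ultimately have "[f (x \<otimes> g [^] n \<otimes> inv x \<otimes> x) = 0 + f x] (mod M)" by (rule cong_trans)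
      then show ?thesis using x g by (simp add: m_assoc)
    qed
    have Fg: "[F (x \<otimes> g) = F x] (mod M)" if x: "x \<in> carrier G" for x
    proof -
      have "x \<otimes> g \<otimes> g [^] i = x \<otimes> g [^] Suc i" for i
        using x g by (simp add: m_assoc flip: nat_pow_Suc2)
      then have "(\<Sum>i<n. f (x \<otimes> g \<otimes> g [^] i)) = (\<Sum>i<n. f (x \<otimes> g [^] Suc i))" by simp
      also have "\<dots> = (\<Sum>i<n. f (x \<otimes> g [^] i)) + (f (x \<otimes> g [^] n) - f (x \<otimes> g [^] (0::nat)))"
        using sum_lessThan_telescope[of "\<lambda>i. f (x \<otimes> g [^] i)" n] by (simp add: sum_subtractf)
      finally have "(\<Sum>i<n. f (x \<otimes> g \<otimes> g [^] i)) = (\<Sum>i<n. f (x \<otimes> g [^] i)) + (f (x \<otimes> g [^] n) - f x)"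
        using x by simp
      then have "[(\<Sum>i<n. f (x \<otimes> g \<otimes> g [^] i)) = (\<Sum>i<n. f (x \<otimes> g [^] i))] (mod M)"
        using fn[OF x] by (simp add: cong_iff_dvd_diff)
      then show ?thesis unfolding F_def by (intro cong_mult) auto
    qed
    \<comment> \<open>\<open>F\<close> differs from \<open>f\<close> by a translation, that is, it lies in the \<open>K\<close>-orbit of \<open>f\<close>\<close>
    have "(\<lambda>x. - (\<Sum>j<q. \<Sum>i<n. f (x \<otimes> g [^] i) - f x)) \<in> \<Lambda>"
      using g by (intro Lneg Lsum[OF finite_lessThan] fG) auto
    from LE[OF this] obtain \<kappa> where \<kappa>: "\<kappa> \<in> K"
      "\<And>x. x \<in> carrier G \<Longrightarrow> [- (\<Sum>j<q. \<Sum>i<n. f (x \<otimes> g [^] i) - f x) = u (x \<otimes> \<kappa> \<otimes> inv x)] (mod M)"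
      by blast
    have F: "[f (x \<otimes> \<kappa>) = F x] (mod M)" if x: "x \<in> carrier G" for x
    proof -
      have "[f (x \<otimes> \<kappa> \<otimes> inv x \<otimes> x) = u (x \<otimes> \<kappa> \<otimes> inv x) + f x] (mod M)"
        using x \<kappa> conjK by (intro fK) auto
      then have 1: "[f (x \<otimes> \<kappa>) = u (x \<otimes> \<kappa> \<otimes> inv x) + f x] (mod M)"
        using x \<kappa>(1) Kc by (simp add: m_assoc)
      have 2: "[u (x \<otimes> \<kappa> \<otimes> inv x) + f x = - (\<Sum>j<q. \<Sum>i<n. f (x \<otimes> g [^] i) - f x) + f x] (mod M)"
        using \<kappa>(2)[OF x] by (intro cong_add) (auto intro: cong_sym)
      have 3: "- (\<Sum>j<q. \<Sum>i<n. f (x \<otimes> g [^] i) - f x) + f x = F x + (int c + 1) * f x"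
        by (simp add: F_def q sum_subtractf algebra_simps)
      have 4: "[F x + (int c + 1) * f x = F x] (mod M)"
        by (simp add: cong_iff_dvd_diff M c_def)
      show ?thesis by (rule cong_trans[OF 1 cong_trans[OF 2[unfolded 3] 4]])
    qed
    have "[f (x \<otimes> (inv \<kappa> \<otimes> g \<otimes> \<kappa>)) = f x] (mod M)" if x: "x \<in> carrier G" for x
    proof -
      have "[f (x \<otimes> inv \<kappa> \<otimes> g \<otimes> \<kappa>) = F (x \<otimes> inv \<kappa> \<otimes> g)] (mod M)"
        "[F (x \<otimes> inv \<kappa> \<otimes> g) = F (x \<otimes> inv \<kappa>)] (mod M)"
        "[f (x \<otimes> inv \<kappa> \<otimes> \<kappa>) = F (x \<otimes> inv \<kappa>)] (mod M)"
        using x g \<kappa>(1) Kc by (auto intro!: F Fg)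
      then have "[f (x \<otimes> inv \<kappa> \<otimes> g \<otimes> \<kappa>) = f (x \<otimes> inv \<kappa> \<otimes> \<kappa>)] (mod M)"
        by (blast intro: cong_trans cong_sym)
      then show ?thesis using x g \<kappa>(1) Kc by (simp add: m_assoc)
    qed
    then have "inv \<kappa> \<otimes> g \<otimes> \<kappa> \<in> P" using g \<kappa>(1) Kc by (auto simp: P_def)
    then show ?thesis using \<kappa>(1) Kc by blast
  qed
  ultimately show ?thesis unfolding c_def by blast
qed

section \<open>Cocycles on finite covers of the presentation complex\<close>

text \<open>Fewer homogeneous linear conditions than unknowns leave a nonzero solution: two of the
\<open>M^(card I)\<close> vectors have the same values, and their difference is a solution. Counting instead of
linear algebra makes this work modulo any \<open>M\<close>.\<close>

lemma exists_nonzero_solution_mod: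
  fixes l :: "'j \<Rightarrow> ('i \<Rightarrow> int) \<Rightarrow> int"
  assumes fin: "finite I" "finite J" and card: "card J < card I" and M: "M \<ge> 2"
    and lin: "\<And>j a b c. j \<in> J \<Longrightarrow> (\<And>i. i \<in> I \<Longrightarrow> [c i = a i - b i] (mod M)) \<Longrightarrow>
      [l j c = l j a - l j b] (mod M)"
  shows "\<exists>c\<in>I \<rightarrow>\<^sub>E {0..<M}. (\<exists>i\<in>I. c i \<noteq> 0) \<and> (\<forall>j\<in>J. [l j c = 0] (mod M))"
proof -
  define \<Phi> where "\<Phi> a = (\<lambda>j\<in>J. l j a mod M)" for a
  have "\<Phi> ` (I \<rightarrow>\<^sub>E {0..<M}) \<subseteq> J \<rightarrow>\<^sub>E {0..<M}"
    using M by (auto simp: \<Phi>_def)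
  then have "card (\<Phi> ` (I \<rightarrow>\<^sub>E {0..<M})) \<le> card (J \<rightarrow>\<^sub>E {0..<M})"
    using fin by (intro card_mono finite_PiE) auto
  also have "\<dots> < card (I \<rightarrow>\<^sub>E {0..<M})"
    using fin card M by (simp add: card_PiE)
  finally have "\<not> inj_on \<Phi> (I \<rightarrow>\<^sub>E {0..<M})"
    by (rule pigeonhole)
  then obtain a b where ab: "a \<in> I \<rightarrow>\<^sub>E {0..<M}" "b \<in> I \<rightarrow>\<^sub>E {0..<M}" "a \<noteq> b" "\<Phi> a = \<Phi> b"
    by (auto simp: inj_on_def)
  define c where "c = (\<lambda>i\<in>I. (a i - b i) mod M)"
  have "c \<in> I \<rightarrow>\<^sub>E {0..<M}" using M by (auto simp: c_def)
  moreover obtain i where i: "i \<in> I" "a i \<noteq> b i" using ab by (metis PiE_ext)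
  moreover have "c i \<noteq> 0"
  proof
    assume "c i = 0"
    then have "[a i = b i] (mod M)" using i by (simp add: c_def cong_iff_dvd_diff mod_eq_0_iff_dvd)
    moreover have "a i \<in> {0..<M}" "b i \<in> {0..<M}" using ab i by auto
    ultimately show False using i by (simp add: cong_def)
  qed
  moreover have "[l j c = 0] (mod M)" if j: "j \<in> J" for j
  proof -
    have "[l j c = l j a - l j b] (mod M)" using j by (intro lin) (auto simp: c_def)
    moreover have "l j a mod M = l j b mod M"
      using j fun_cong[OF ab(4), of j] by (simp add: \<Phi>_def)
    then have "[l j a - l j b = 0] (mod M)" by (simp add: cong_iff_dvd_diff mod_eq_dvd_iff)
    ultimately show ?thesis by (rule cong_trans)
  qed
  ultimately show ?thesis by blast
qed

text \<open>Representatives of the left cosets of the subgroup generated by \<open>c\<close>. They are the inverses of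
representatives of right cosets, for which Lagrange's theorem is stated.\<close>

lemma (in group) cyclic_transversal:
  assumes "finite (carrier G)" "c \<in> carrier G"
  shows "\<exists>T\<subseteq>carrier G. card T * ord c = order G \<and> (\<forall>x\<in>carrier G. \<exists>t\<in>T. \<exists>j::nat. x = t \<otimes> c [^] j)"
proof -
  define A where "A = generate G {c}"
  have A: "subgroup A G" using assms by (auto simp: A_def intro: generate_is_subgroup)
  interpret A: subgroup A G by (rule A)
  have "ord c \<noteq> 0" using ord_ge_1[OF assms] by simp
  have A_eq: "A = {c [^] j | j. j \<in> (UNIV :: nat set)}"
    using generate_pow_nat[OF assms(2) \<open>ord c \<noteq> 0\<close>] by (simp add: A_def)
  define T where "T = (\<lambda>D. inv (SOME d. d \<in> D)) ` (rcosets A)"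
  have T: "(SOME d. d \<in> D) \<in> D" if "D \<in> rcosets A" for D
  proof -
    have "D \<noteq> {}" using that rcos_self[OF _ A] by (auto simp: RCOSETS_def)
    then show ?thesis by (simp add: some_in_eq)
  qed
  have D: "d \<in> carrier G" if "D \<in> rcosets A" "d \<in> D" for d D
    using that A.rcosets_carrier is_group by blast
  have "inj_on (\<lambda>D. inv (SOME d. d \<in> D)) (rcosets A)"
  proof (rule inj_onI)
    fix D E assume DE: "D \<in> rcosets A" "E \<in> rcosets A" "inv (SOME d. d \<in> D) = inv (SOME d. d \<in> E)"
    then have "(SOME d. d \<in> D) = (SOME d. d \<in> E)"
      using D T by (metis inv_inv)
    then have "D \<inter> E \<noteq> {}" using T DE by (metis IntI empty_iff)
    then show "D = E" using rcos_disjoint[OF A] DE(1,2) by (auto simp: pairwise_def disjnt_def)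
  qed
  then have "card T = card (rcosets A)" by (simp add: T_def card_image)
  moreover have "card A = ord c" using generate_pow_card[OF assms(2)] by (simp add: A_def)
  ultimately have "card T * ord c = order G"
    using lagrange[OF A] by simp
  moreover have "\<exists>t\<in>T. \<exists>j::nat. x = t \<otimes> c [^] j" if x: "x \<in> carrier G" for x
  proof -
    have ix: "A #> inv x \<in> rcosets A" using x by (auto simp: RCOSETS_def)
    define d where "d = (SOME d. d \<in> A #> inv x)"
    have d: "d \<in> A #> inv x" "d \<in> carrier G" using T[OF ix] D[OF ix] by (auto simp: d_def)
    then obtain a where a: "a \<in> A" "d = a \<otimes> inv x" by (auto simp: r_coset_def)
    then obtain j :: nat where j: "a = c [^] j" using A_eq by auto
    have "inv d \<otimes> a = x" using a x A.subset by (auto simp: inv_mult_group m_assoc)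
    then have "x = inv d \<otimes> c [^] j" using j by simp
    moreover have "inv d \<in> T" using ix by (auto simp: T_def d_def)
    ultimately show ?thesis by blast
  qed
  moreover have "T \<subseteq> carrier G" using T D by (auto simp: T_def)
  ultimately show ?thesis by blast
qed

text \<open>The Cayley graph of \<open>G/K\<close> has an edge from \<open>C\<close> to \<open>C x\<close> for each coset \<open>C\<close> and generator \<open>x\<close>, labelled
\<open>(x, C)\<close>. A word read from the coset of \<open>a\<close> traces a path, along which the \<open>1\<close>-cochain \<open>\<omega>\<close> is summed; an
inverse letter runs through its edge backwards, hence the shifted coset and the sign.\<close>

primrec path_sum :: "('a, 'b) monoid_scheme \<Rightarrow> ('x \<Rightarrow> 'a) \<Rightarrow> 'a set \<Rightarrow> ('x \<times> 'a set \<Rightarrow> int) \<Rightarrow>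
    'x word \<Rightarrow> 'a \<Rightarrow> int" where
  "path_sum G \<gamma> K \<omega> [] a = 0"
| "path_sum G \<gamma> K \<omega> (l # w) a =
    (if snd l then \<omega> (fst l, K #>\<^bsub>G\<^esub> a) + path_sum G \<gamma> K \<omega> w (a \<otimes>\<^bsub>G\<^esub> \<gamma> (fst l))
     else - \<omega> (fst l, K #>\<^bsub>G\<^esub> (a \<otimes>\<^bsub>G\<^esub> inv\<^bsub>G\<^esub> \<gamma> (fst l))) +
       path_sum G \<gamma> K \<omega> w (a \<otimes>\<^bsub>G\<^esub> inv\<^bsub>G\<^esub> \<gamma> (fst l)))"

locale presentation_cover = group G for G (structure) +
  fixes X :: "'x set" and R :: "'x word set" and \<gamma> :: "'x \<Rightarrow> 'a" and K :: "'a set" and M :: int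
  assumes pres: "presents G X R \<gamma>" and K: "K \<in> finite_index_normal G"
    and X: "finite X" and M: "M \<ge> 2"
begin

abbreviation "val \<equiv> word_val G \<gamma>"
abbreviation "ps \<equiv> path_sum G \<gamma> K"

lemma normal_K: "K \<lhd> G" and finite_rcosets_K: "finite (rcosets K)"
  using K by (auto simp: finite_index_normal_def)

lemma K_closed: "k \<in> K \<Longrightarrow> k \<in> carrier G"
  using normal_imp_subgroup[OF normal_K] subgroup.mem_carrier by metis

lemma gen [simp]: "x \<in> X \<Longrightarrow> \<gamma> x \<in> carrier G" and gen': "\<gamma> \<in> X \<rightarrow> carrier G"
  using pres by (auto simp: presents_def)

lemma val_closed [simp]: "w \<in> words X \<Longrightarrow> val w \<in> carrier G"
  by (rule word_val_closed[OF gen'])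

lemma val_append [simp]: "u \<in> words X \<Longrightarrow> w \<in> words X \<Longrightarrow> val (u @ w) = val u \<otimes> val w"
  by (rule word_val_append[OF gen'])

lemma rcos_in_rcosets: "a \<in> carrier G \<Longrightarrow> K #> a \<in> rcosets K"
  by (auto simp: RCOSETS_def)

lemma val_eq_iff: "u \<in> words X \<Longrightarrow> w \<in> words X \<Longrightarrow> val u = val w \<longleftrightarrow> word_eq X R u w"
  using pres by (simp add: presents_def)

lemma rcos_K_eq:
  assumes "k \<in> K" "a \<in> carrier G"
  shows "K #> (k \<otimes> a) = K #> a" "K #> (a \<otimes> k) = K #> a"
proof -
  have k: "k \<in> carrier G" using assms K_closed by simp
  have "k \<otimes> a \<otimes> inv a \<in> K" using assms k by (simp add: m_assoc)
  then show "K #> (k \<otimes> a) = K #> a" using assms k by (simp add: rcos_eq_iff[OF normal_K])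
  have "a \<otimes> k \<otimes> inv a \<in> K" using assms normal.inv_op_closed2[OF normal_K] by simp
  then show "K #> (a \<otimes> k) = K #> a" using assms k by (simp add: rcos_eq_iff[OF normal_K])
qed

lemma rcos_K_mult:
  assumes "K #> a = K #> b" "a \<in> carrier G" "b \<in> carrier G" "g \<in> carrier G"
  shows "K #> (a \<otimes> g) = K #> (b \<otimes> g)"
  using assms normal_imp_subgroup[OF normal_K] subgroup.subset by (metis coset_mult_assoc)

lemma path_sum_cong_start:
  "w \<in> words X \<Longrightarrow> a \<in> carrier G \<Longrightarrow> b \<in> carrier G \<Longrightarrow> K #> a = K #> b \<Longrightarrow> ps \<omega> w a = ps \<omega> w b"
proof (induction w arbitrary: a b)
  case (Cons l w)
  obtain x c where l: "l = (x, c)" by (cases l)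
  have x: "x \<in> X" "w \<in> words X" using Cons.prems l by auto
  have "K #> (a \<otimes> \<gamma> x) = K #> (b \<otimes> \<gamma> x)" "K #> (a \<otimes> inv \<gamma> x) = K #> (b \<otimes> inv \<gamma> x)"
    using Cons.prems x by (simp_all add: rcos_K_mult[of a b])
  then show ?case using Cons.prems Cons.IH x l by auto
qed auto

lemma path_sum_append:
  "u \<in> words X \<Longrightarrow> w \<in> words X \<Longrightarrow> a \<in> carrier G \<Longrightarrow> ps \<omega> (u @ w) a = ps \<omega> u a + ps \<omega> w (a \<otimes> val u)"
proof (induction u arbitrary: a)
  case (Cons l u)
  obtain x c where l: "l = (x, c)" by (cases l)
  then show ?case using Cons by (auto simp: m_assoc)
qed auto

lemma path_sum_linear:
  "w \<in> words X \<Longrightarrow> a \<in> carrier G \<Longrightarrow>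
    (\<And>x C. x \<in> X \<Longrightarrow> C \<in> rcosets K \<Longrightarrow> [\<omega> (x, C) = \<omega>1 (x, C) - \<omega>2 (x, C)] (mod M)) \<Longrightarrow>
    [ps \<omega> w a = ps \<omega>1 w a - ps \<omega>2 w a] (mod M)"
proof (induction w arbitrary: a)
  case (Cons l w)
  obtain x c where l: "l = (x, c)" by (cases l)
  have x: "x \<in> X" "w \<in> words X" using Cons.prems l by auto
  have r: "K #> b \<in> rcosets K" if "b \<in> carrier G" for b using that by (auto simp: RCOSETS_def)
  show ?case
  proof (cases c)
    case True
    have "[\<omega> (x, K #> a) + ps \<omega> w (a \<otimes> \<gamma> x) = (\<omega>1 (x, K #> a) - \<omega>2 (x, K #> a)) +
        (ps \<omega>1 w (a \<otimes> \<gamma> x) - ps \<omega>2 w (a \<otimes> \<gamma> x))] (mod M)"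
      using Cons.prems x r by (intro cong_add Cons.IH) auto
    then show ?thesis using True l by (simp add: algebra_simps)
  next
    case False
    let ?b = "a \<otimes> inv \<gamma> x"
    have "[ps \<omega> w ?b - \<omega> (x, K #> ?b) = (ps \<omega>1 w ?b - ps \<omega>2 w ?b) - (\<omega>1 (x, K #> ?b) - \<omega>2 (x, K #> ?b))] (mod M)"
      using Cons.prems x r by (intro cong_diff Cons.IH) auto
    then show ?thesis using False l by (simp add: algebra_simps)
  qed
qed auto

definition cocycle :: "('x \<times> 'a set \<Rightarrow> int) \<Rightarrow> bool" where
  "cocycle \<omega> \<longleftrightarrow> (\<forall>r\<in>R. r \<in> words X \<longrightarrow> (\<forall>a\<in>carrier G. [ps \<omega> r a = 0] (mod M)))"

lemma val_relator: "r \<in> R \<Longrightarrow> r \<in> words X \<Longrightarrow> val r = \<one>"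
  using word_eq.relator[of "[]" X "[]" r R] val_eq_iff[of r "[]"] by simp

text \<open>Cancelling a letter against its inverse does not change the sum, and inserting a relator adds the
sum along a closed loop, which vanishes for a cocycle. This is homotopy invariance.\<close>

lemma path_sum_word_eq:
  assumes "cocycle \<omega>" "word_eq X R u w" "a \<in> carrier G"
  shows "[ps \<omega> u a = ps \<omega> w a] (mod M)"
  using assms(2,3)
proof (induction arbitrary: a)
  case (sym u w)
  then show ?case using cong_sym by blast
next
  case (trans u v w)
  then show ?case using cong_trans by blast
next
  case (cancel u w x b)
  define c where "c = a \<otimes> val u"
  have c: "c \<in> carrier G" using cancel by (simp add: c_def)
  have "ps \<omega> ([(x, b), (x, \<not> b)] @ w) c = ps \<omega> w c"
    using cancel c by (auto simp: m_assoc)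
  moreover have "[(x, b), (x, \<not> b)] @ w \<in> words X" using cancel by simp
  ultimately show ?case
    using cancel by (simp only: path_sum_append c_def cong_refl)
next
  case (relator u w r)
  have "ps \<omega> (u @ r @ w) a = ps \<omega> u a + (ps \<omega> r (a \<otimes> val u) + ps \<omega> w (a \<otimes> val u))"
    using relator by (simp add: path_sum_append val_relator)
  moreover have "[ps \<omega> r (a \<otimes> val u) = 0] (mod M)"
    using relator assms(1) by (simp add: cocycle_def)
  then have "[ps \<omega> u a + (ps \<omega> r (a \<otimes> val u) + ps \<omega> w (a \<otimes> val u)) =
      ps \<omega> u a + (0 + ps \<omega> w (a \<otimes> val u))] (mod M)"
    by (intro cong_add cong_refl)
  ultimately show ?case using relator by (simp add: path_sum_append)
qed auto

definition word_for :: "'a \<Rightarrow> 'x word" where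
  "word_for g = (SOME w. w \<in> words X \<and> val w = g)"

lemma word_for [simp]: "g \<in> carrier G \<Longrightarrow> word_for g \<in> words X" "g \<in> carrier G \<Longrightarrow> val (word_for g) = g"
proof -
  have "word_for g \<in> words X \<and> val (word_for g) = g" if "g \<in> carrier G"
    unfolding word_for_def using pres that
    by (intro someI_ex[of "\<lambda>w. w \<in> words X \<and> val w = g"]) (auto simp: presents_def)
  then show "g \<in> carrier G \<Longrightarrow> word_for g \<in> words X" "g \<in> carrier G \<Longrightarrow> val (word_for g) = g" by auto
qed

text \<open>By homotopy invariance the sum depends, modulo \<open>M\<close>, only on the starting coset and on the group
element that the word spells; any word for it will do.\<close>

definition transport :: "('x \<times> 'a set \<Rightarrow> int) \<Rightarrow> 'a \<Rightarrow> 'a \<Rightarrow> int" where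
  "transport \<omega> a g = ps \<omega> (word_for g) a"

lemma transport_val:
  assumes "cocycle \<omega>" "a \<in> carrier G" "w \<in> words X"
  shows "[transport \<omega> a (val w) = ps \<omega> w a] (mod M)"
  unfolding transport_def using assms
  by (intro path_sum_word_eq) (simp_all flip: val_eq_iff)

lemma transport_mult:
  assumes "cocycle \<omega>" "a \<in> carrier G" "g \<in> carrier G" "h \<in> carrier G"
  shows "[transport \<omega> a (g \<otimes> h) = transport \<omega> a g + transport \<omega> (a \<otimes> g) h] (mod M)"
  using transport_val[of \<omega> a "word_for g @ word_for h"] assms by (simp add: path_sum_append transport_def)

lemma transport_cong_start:
  assumes "a \<in> carrier G" "b \<in> carrier G" "g \<in> carrier G" "K #> a = K #> b"
  shows "transport \<omega> a g = transport \<omega> b g"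
  unfolding transport_def using assms by (intro path_sum_cong_start) auto

lemma transport_one:
  assumes "cocycle \<omega>" "a \<in> carrier G"
  shows "[transport \<omega> a \<one> = 0] (mod M)"
  using transport_val[of \<omega> a "[]"] assms by simp

lemma transport_inv:
  assumes "cocycle \<omega>" "a \<in> carrier G" "g \<in> carrier G"
  shows "[transport \<omega> (a \<otimes> g) (inv g) = - transport \<omega> a g] (mod M)"
proof -
  have "[transport \<omega> a g + transport \<omega> (a \<otimes> g) (inv g) = transport \<omega> a \<one>] (mod M)"
    using transport_mult[of \<omega> a g "inv g"] assms by (simp add: cong_sym)
  then have "[transport \<omega> a g + transport \<omega> (a \<otimes> g) (inv g) = 0] (mod M)"
    using cong_trans[OF _ transport_one[OF assms(1,2)]] by simp
  from cong_diff[OF this cong_refl[of "transport \<omega> a g"]] show ?thesis by simp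
qed

text \<open>The path out along \<open>x\<close> and the path back along \<open>inv x\<close> cancel, because a loop labelled by
\<open>k \<in> K\<close> closes up in between.\<close>

lemma transport_conj:
  assumes "cocycle \<omega>" "a \<in> carrier G" "x \<in> carrier G" "k \<in> K"
  shows "[transport \<omega> a (x \<otimes> k \<otimes> inv x) = transport \<omega> (a \<otimes> x) k] (mod M)"
proof -
  have k: "k \<in> carrier G" using assms K_closed by auto
  have "[transport \<omega> a (x \<otimes> k \<otimes> inv x) = transport \<omega> a (x \<otimes> k) + transport \<omega> (a \<otimes> (x \<otimes> k)) (inv x)] (mod M)"
    using assms k by (intro transport_mult) auto
  also have "transport \<omega> (a \<otimes> (x \<otimes> k)) (inv x) = transport \<omega> (a \<otimes> x) (inv x)"
    using assms k by (intro transport_cong_start) (auto simp: rcos_K_eq simp flip: m_assoc)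
  finally have 1: "[transport \<omega> a (x \<otimes> k \<otimes> inv x) =
      transport \<omega> a (x \<otimes> k) + transport \<omega> (a \<otimes> x) (inv x)] (mod M)" .
  have "[transport \<omega> a (x \<otimes> k) + transport \<omega> (a \<otimes> x) (inv x) =
      (transport \<omega> a x + transport \<omega> (a \<otimes> x) k) + - transport \<omega> a x] (mod M)"
    using assms k by (intro cong_add transport_mult transport_inv) auto
  from cong_trans[OF 1 this] show ?thesis by simp
qed

definition cocycles :: "('x \<times> 'a set \<Rightarrow> int) set" where
  "cocycles = {\<omega> \<in> (X \<times> (rcosets K)) \<rightarrow>\<^sub>E {0..<M}. cocycle \<omega>}"

text \<open>The cocycle that is constructed later has to vanish on elements of \<open>G\<close> that represent elements of the
completion. Modulo this subgroup, on which all cocycles vanish, such representatives can be chosen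
before the cocycle is known.\<close>

definition trivial_part :: "'a set" where
  "trivial_part = {k \<in> K. \<forall>\<omega>\<in>cocycles. \<forall>a\<in>carrier G. [transport \<omega> a k = 0] (mod M)}"

lemma finite_cocycles: "finite cocycles"
proof (rule finite_subset)
  show "cocycles \<subseteq> X \<times> (rcosets K) \<rightarrow>\<^sub>E {0..<M}" by (auto simp: cocycles_def)
  show "finite (X \<times> (rcosets K) \<rightarrow>\<^sub>E {0..<M})"
    using X finite_rcosets_K by (intro finite_PiE) auto
qed

definition rep :: "'a set \<Rightarrow> 'a" where
  "rep C = (SOME g. g \<in> carrier G \<and> K #> g = C)"

lemma rep: "C \<in> rcosets K \<Longrightarrow> rep C \<in> carrier G" "C \<in> rcosets K \<Longrightarrow> K #> rep C = C"
proof -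
  have "rep C \<in> carrier G \<and> K #> rep C = C" if "C \<in> rcosets K"
    unfolding rep_def using that
    by (intro someI_ex[of "\<lambda>g. g \<in> carrier G \<and> K #> g = C"]) (auto simp: RCOSETS_def)
  then show "C \<in> rcosets K \<Longrightarrow> rep C \<in> carrier G" "C \<in> rcosets K \<Longrightarrow> K #> rep C = C" by auto
qed

lemma K_subgroup: "subgroup K G"
  by (rule normal_imp_subgroup[OF normal_K])

lemma normal_trivial_part: "trivial_part \<lhd> G"
proof -
  have cz: "cocycle \<omega>" if "\<omega> \<in> cocycles" for \<omega> using that by (simp add: cocycles_def)
  have "subgroup trivial_part G"
  proof (rule subgroupI)
    show "trivial_part \<subseteq> carrier G" using K_closed by (auto simp: trivial_part_def)
    have "\<one> \<in> trivial_part"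
      using cz transport_one subgroup.one_closed[OF K_subgroup] by (auto simp: trivial_part_def)
    then show "trivial_part \<noteq> {}" by blast
  next
    fix g assume g: "g \<in> trivial_part"
    then have gK: "g \<in> K" "g \<in> carrier G" using K_closed by (auto simp: trivial_part_def)
    have "[transport \<omega> a (inv g) = 0] (mod M)" if "\<omega> \<in> cocycles" "a \<in> carrier G" for \<omega> a
    proof -
      have "[transport \<omega> a g = 0] (mod M)" using g that by (auto simp: trivial_part_def)
      then have "[- transport \<omega> a g = 0] (mod M)" by (simp add: cong_0_iff)
      moreover have "transport \<omega> (a \<otimes> g) (inv g) = transport \<omega> a (inv g)"
        using that gK by (intro transport_cong_start) (auto simp: rcos_K_eq)
      ultimately show ?thesis using cong_trans[OF transport_inv[OF cz[OF that(1)] that(2) gK(2)]] by simp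
    qed
    then show "inv g \<in> trivial_part"
      using gK subgroup.m_inv_closed[OF K_subgroup] by (auto simp: trivial_part_def)
    fix h assume h: "h \<in> trivial_part"
    then have hK: "h \<in> K" "h \<in> carrier G" using K_closed by (auto simp: trivial_part_def)
    have "[transport \<omega> a (g \<otimes> h) = 0] (mod M)" if "\<omega> \<in> cocycles" "a \<in> carrier G" for \<omega> a
    proof -
      have "[transport \<omega> a g + transport \<omega> (a \<otimes> g) h = 0 + 0] (mod M)"
        using g h gK that by (intro cong_add) (auto simp: trivial_part_def)
      from cong_trans[OF transport_mult[OF cz[OF that(1)] that(2) gK(2) hK(2)] this]
      show ?thesis by simp
    qed
    then show "g \<otimes> h \<in> trivial_part"
      using gK hK subgroup.m_closed[OF K_subgroup] by (auto simp: trivial_part_def)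
  qed
  moreover have "x \<otimes> k \<otimes> inv x \<in> trivial_part" if x: "x \<in> carrier G" and k: "k \<in> trivial_part" for x k
  proof -
    have kK: "k \<in> K" using k by (auto simp: trivial_part_def)
    have "[transport \<omega> a (x \<otimes> k \<otimes> inv x) = 0] (mod M)" if "\<omega> \<in> cocycles" "a \<in> carrier G" for \<omega> a
    proof (rule cong_trans[OF transport_conj[OF cz[OF that(1)] that(2) x kK]])
      show "[transport \<omega> (a \<otimes> x) k = 0] (mod M)" using k x that by (auto simp: trivial_part_def)
    qed
    then show ?thesis
      using kK x normal.inv_op_closed2[OF normal_K] by (auto simp: trivial_part_def)
  qed
  ultimately show ?thesis by (auto simp: normal_inv_iff)
qed

text \<open>There are only finitely many cocycles with values in \<open>{0..<M}\<close>, and an element of \<open>G\<close> is determined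
modulo \<open>trivial_part\<close> by its coset modulo \<open>K\<close> together with its transports under all of them.\<close>

lemma finite_index_trivial_part: "trivial_part \<in> finite_index_normal G"
proof -
  define f where "f g = (K #> g, \<lambda>p\<in>cocycles \<times> (rcosets K). transport (fst p) (rep (snd p)) g mod M)" for g
  have "f ` carrier G \<subseteq> (rcosets K) \<times> ((cocycles \<times> (rcosets K)) \<rightarrow>\<^sub>E {0..<M})"
  proof (rule image_subsetI)
    fix g assume g: "g \<in> carrier G"
    have "z mod M \<in> {0..<M}" for z using M by simp
    then have "snd (f g) \<in> (cocycles \<times> (rcosets K)) \<rightarrow>\<^sub>E {0..<M}"
      unfolding f_def snd_conv by (intro PiE_I) (simp_all only: restrict_apply' restrict_apply if_True if_False simp_thms)
    then show "f g \<in> (rcosets K) \<times> ((cocycles \<times> (rcosets K)) \<rightarrow>\<^sub>E {0..<M})"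
      using rcos_in_rcosets[OF g] by (simp add: f_def mem_Times_iff)
  qed
  moreover have "finite ((rcosets K) \<times> ((cocycles \<times> (rcosets K)) \<rightarrow>\<^sub>E {0..<M}))"
    using finite_cocycles finite_rcosets_K by (intro finite_cartesian_product finite_PiE) auto
  ultimately have fin: "finite (f ` carrier G)" using finite_subset by blast
  show ?thesis
  proof (rule finite_index_normalI[OF normal_trivial_part fin])
    fix g h assume gh: "g \<in> carrier G" "h \<in> carrier G" "f g = f h"
    have Kgh: "g \<otimes> inv h \<in> K" using gh rcos_eq_iff[OF normal_K] by (auto simp: f_def)
    have "[transport \<omega> a (g \<otimes> inv h) = 0] (mod M)" if "\<omega> \<in> cocycles" and a: "a \<in> carrier G" for \<omega> a
    proof -
      have cz: "cocycle \<omega>" using that by (simp add: cocycles_def)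
      let ?C = "K #> a"
      have C: "?C \<in> rcosets K" using a by (auto simp: RCOSETS_def)
      have "transport \<omega> (rep ?C) g mod M = transport \<omega> (rep ?C) h mod M"
        using fun_cong[OF arg_cong[OF gh(3), of snd], of "(\<omega>, ?C)"] that C by (simp add: f_def)
      moreover have "transport \<omega> (rep ?C) k = transport \<omega> a k" if "k \<in> carrier G" for k
        using that a rep[OF C] by (intro transport_cong_start) auto
      ultimately have eq: "[transport \<omega> a g = transport \<omega> a h] (mod M)"
        using gh by (simp add: cong_def)
      have "transport \<omega> (a \<otimes> g) (inv h) = transport \<omega> (a \<otimes> h) (inv h)"
      proof (rule transport_cong_start)
        have "g = (g \<otimes> inv h) \<otimes> h" using gh by (simp add: m_assoc)
        then have "a \<otimes> g = (a \<otimes> (g \<otimes> inv h)) \<otimes> h" using gh a by (simp add: m_assoc)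
        then show "K #> (a \<otimes> g) = K #> (a \<otimes> h)"
          using rcos_K_mult[of "a \<otimes> (g \<otimes> inv h)" a h] Kgh gh a by (simp add: rcos_K_eq(2))
      qed (use gh a in auto)
      then have "[transport \<omega> a (g \<otimes> inv h) = transport \<omega> a g + transport \<omega> (a \<otimes> h) (inv h)] (mod M)"
        using transport_mult[OF cz a gh(1) inv_closed[OF gh(2)]] by simp
      also have "[transport \<omega> a g + transport \<omega> (a \<otimes> h) (inv h) = transport \<omega> a h + - transport \<omega> a h] (mod M)"
        using cz a gh by (intro cong_add eq transport_inv)
      finally show ?thesis by simp
    qed
    then show "g \<otimes> inv h \<in> trivial_part" using Kgh by (auto simp: trivial_part_def)
  qed
qed

text \<open>The shortest power of \<open>y\<close> which traces closed loops in the Cayley graph of \<open>G/K\<close>.\<close>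

definition order_power :: "'x word \<Rightarrow> 'x word" where
  "order_power y = concat (replicate (mod_ord G K (K #> val y)) y)"

lemma concat_replicate_words: "y \<in> words X \<Longrightarrow> concat (replicate n y) \<in> words X"
  by (induction n) auto

lemma concat_replicate_commute: "concat (replicate n y) @ y = y @ concat (replicate n y)"
  by (induction n) auto

lemma val_concat_replicate: "y \<in> words X \<Longrightarrow> val (concat (replicate n y)) = val y [^] n"
proof (induction n)
  case (Suc n)
  then show ?case using nat_pow_Suc2[of "val y" n] by (simp add: concat_replicate_words)
qed simp

lemma order_power_K: "y \<in> words X \<Longrightarrow> val (order_power y) \<in> K"
  using mod_ord_dvd_iff[OF normal_K val_closed, of y "mod_ord G K (K #> val y)"]
  by (simp add: order_power_def val_concat_replicate)

text \<open>The loop may be started at any of the vertices that it visits after a full copy of \<open>y\<close>. Therefore the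
condition that it has sum zero for all starting points is only one condition for each coset of the
cyclic group generated by \<open>y\<close>.\<close>

lemma path_sum_order_power_shift:
  assumes "y \<in> words X" "a \<in> carrier G"
  shows "ps \<omega> (order_power y) (a \<otimes> val y [^] (j::nat)) = ps \<omega> (order_power y) a"
proof (induction j)
  case (Suc j)
  define b where "b = a \<otimes> val y [^] j"
  have b: "b \<in> carrier G" using assms by (simp add: b_def)
  have w: "order_power y \<in> words X" using assms by (simp add: order_power_def concat_replicate_words)
  have "ps \<omega> (y @ order_power y) b = ps \<omega> (order_power y @ y) b"
    by (simp add: order_power_def concat_replicate_commute)
  then have "ps \<omega> y b + ps \<omega> (order_power y) (b \<otimes> val y) = ps \<omega> (order_power y) b + ps \<omega> y (b \<otimes> val (order_power y))"
    using assms w b by (simp add: path_sum_append)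
  moreover have "ps \<omega> y (b \<otimes> val (order_power y)) = ps \<omega> y b"
    using assms w b order_power_K by (intro path_sum_cong_start) (auto simp: rcos_K_eq)
  moreover have "a \<otimes> val y [^] Suc j = b \<otimes> val y"
    using assms by (simp add: b_def m_assoc)
  ultimately show ?case using Suc by (simp only: b_def)
qed (use assms in simp)

lemma coset_transversal:
  assumes "g \<in> carrier G"
  shows "\<exists>T\<subseteq>carrier G. finite T \<and> card T * mod_ord G K (K #> g) \<le> card (rcosets K) \<and>
    (\<forall>a\<in>carrier G. \<exists>t\<in>T. \<exists>j::nat. K #> a = K #> (t \<otimes> g [^] j))"
proof -
  interpret K: normal K G by (rule normal_K)
  interpret Q: group "G Mod K" by (rule K.factorgroup_is_group)
  have c: "K #> g \<in> carrier (G Mod K)" using assms by (auto simp: carrier_FactGroup)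
  have car: "carrier (G Mod K) = rcosets K" by (simp add: FactGroup_def)
  have "finite (carrier (G Mod K))" using finite_rcosets_K by (simp only: car)
  from Q.cyclic_transversal[OF this c] obtain T where T: "T \<subseteq> rcosets K"
    "card T * mod_ord G K (K #> g) = card (rcosets K)"
    "\<forall>C\<in>rcosets K. \<exists>t\<in>T. \<exists>j::nat. C = t \<otimes>\<^bsub>G Mod K\<^esub> (K #> g) [^]\<^bsub>G Mod K\<^esub> j"
    unfolding car order_def by (elim exE conjE) (rule that, simp_all add: mod_ord_def)
  have finT: "finite T" using T(1) finite_rcosets_K finite_subset by blast
  have "\<exists>t\<in>rep ` T. \<exists>j::nat. K #> a = K #> (t \<otimes> g [^] j)" if a: "a \<in> carrier G" for a
  proof -
    have "K #> a \<in> rcosets K" using a by (auto simp: RCOSETS_def)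
    then obtain t j where t: "t \<in> T" "K #> a = t \<otimes>\<^bsub>G Mod K\<^esub> (K #> g) [^]\<^bsub>G Mod K\<^esub> (j::nat)"
      using T(3) by blast
    have r: "rep t \<in> carrier G" "K #> rep t = t" using rep T(1) t(1) by auto
    have "(K #> g) [^]\<^bsub>G Mod K\<^esub> j = K #> (g [^] j)"
      using K.FactGroup_pow assms by simp
    then have "K #> a = (K #> rep t) <#> (K #> (g [^] j))" using t r by simp
    then have "K #> a = K #> (rep t \<otimes> g [^] j)"
      using K.rcos_sum[of "rep t" "g [^] j"] r assms by simp
    then show ?thesis using t(1) by blast
  qed
  moreover have "card (rep ` T) * mod_ord G K (K #> g) \<le> card (rcosets K)"
    using card_image_le[OF finT, of rep] T(2) by (metis mult_le_mono1)
  moreover have "rep ` T \<subseteq> carrier G" using rep T(1) by auto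
  ultimately show ?thesis using finT by (intro exI[of _ "rep ` T"]) auto
qed

text \<open>There are \<open>card X\<close> unknowns for each coset of \<open>K\<close>. For each coset, the conditions are one for \<open>\<rho>\<close>, one
for the representative, and on average \<open>1 / n\<close> for each \<open>y \<in> Y\<close>, where \<open>n\<close> is the order of \<open>y\<close>
modulo \<open>K\<close>.\<close>

lemma exists_cocycle:
  assumes Y: "finite Y" "Y \<subseteq> words X" and \<rho>: "\<rho> \<in> words X" and R: "R \<subseteq> insert \<rho> (order_power ` Y)"
    and size: "2 + (\<Sum>y\<in>Y. 1 / real (mod_ord G K (K #> val y))) < real (card X)"
  shows "\<exists>\<omega>\<in>cocycles. (\<exists>p\<in>X \<times> (rcosets K). \<omega> p \<noteq> 0) \<and>
    (\<forall>C\<in>rcosets K. [transport \<omega> \<one> (rep C) = 0] (mod M)) \<and>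
    (\<forall>y\<in>Y. \<forall>a\<in>carrier G. [ps \<omega> (order_power y) a = 0] (mod M))"
proof -
  let ?h = "card (rcosets K)"
  have h: "?h > 0"
    using finite_rcosets_K coset_join2[OF one_closed K_subgroup]
    by (auto simp: card_gt_0_iff RCOSETS_def)
  have "\<exists>T\<subseteq>carrier G. finite T \<and> card T * mod_ord G K (K #> val y) \<le> ?h \<and>
    (\<forall>a\<in>carrier G. \<exists>t\<in>T. \<exists>j::nat. K #> a = K #> (t \<otimes> val y [^] j))" if "y \<in> Y" for y
    using that Y by (intro coset_transversal) auto
  then obtain T where T: "\<And>y. y \<in> Y \<Longrightarrow> T y \<subseteq> carrier G" "\<And>y. y \<in> Y \<Longrightarrow> finite (T y)"
    "\<And>y. y \<in> Y \<Longrightarrow> card (T y) * mod_ord G K (K #> val y) \<le> ?h"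
    "\<And>y a. y \<in> Y \<Longrightarrow> a \<in> carrier G \<Longrightarrow> \<exists>t\<in>T y. \<exists>j::nat. K #> a = K #> (t \<otimes> val y [^] j)"
    by metis
  \<comment> \<open>each condition is a word together with the starting point of the path along which the sum has to vanish\<close>
  define J where "J = (\<lambda>C. (\<rho>, rep C)) ` (rcosets K) \<union> (\<lambda>C. (word_for (rep C), \<one>)) ` (rcosets K) \<union>
    (\<Union>y\<in>Y. (\<lambda>t. (order_power y, t)) ` T y)"
  have order_power_words: "order_power y \<in> words X" if "y \<in> Y" for y
    using that Y by (auto simp: order_power_def intro: concat_replicate_words)
  have J: "fst j \<in> words X \<and> snd j \<in> carrier G" if "j \<in> J" for j
    using that \<rho> rep T(1)[THEN subsetD] order_power_words by (auto simp: J_def)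
  have finJ: "finite J" using finite_rcosets_K Y T by (auto simp: J_def)
  have "card (\<Union>y\<in>Y. (\<lambda>t. (order_power y, t)) ` T y) \<le> (\<Sum>y\<in>Y. card ((\<lambda>t. (order_power y, t)) ` T y))"
    using Y(1) by (rule card_UN_le)
  also have "\<dots> \<le> (\<Sum>y\<in>Y. card (T y))"
    using T by (intro sum_mono card_image_le) auto
  finally have "card J \<le> ?h + ?h + (\<Sum>y\<in>Y. card (T y))"
    unfolding J_def
    using card_Un_le card_image_le[OF finite_rcosets_K] by (meson add_mono le_trans)
  then have "real (card J) \<le> real ?h + real ?h + (\<Sum>y\<in>Y. real (card (T y)))"
    by (metis of_nat_add of_nat_le_iff of_nat_sum)
  also have "(\<Sum>y\<in>Y. real (card (T y))) \<le> (\<Sum>y\<in>Y. real ?h * (1 / real (mod_ord G K (K #> val y))))"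
  proof (rule sum_mono)
    fix y assume y: "y \<in> Y"
    have "K #> val y \<in> carrier (G Mod K)" using y Y by (auto simp: carrier_FactGroup)
    then have "mod_ord G K (K #> val y) > 0" using K by (rule mod_ord_dvd_index(2)[rotated])
    moreover have "real (card (T y)) * real (mod_ord G K (K #> val y)) \<le> real ?h"
      using T(3)[OF y] by (metis of_nat_le_iff of_nat_mult)
    ultimately show "real (card (T y)) \<le> real ?h * (1 / real (mod_ord G K (K #> val y)))"
      by (simp add: field_simps)
  qed
  also have "real ?h + real ?h + (\<Sum>y\<in>Y. real ?h * (1 / real (mod_ord G K (K #> val y)))) =
      real ?h * (2 + (\<Sum>y\<in>Y. 1 / real (mod_ord G K (K #> val y))))"
    by (simp add: sum_distrib_left distrib_left)
  also have "\<dots> < real ?h * real (card X)"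
    using size h by (intro mult_strict_left_mono) auto
  finally have "card J < card (X \<times> (rcosets K))"
    by (simp add: card_cartesian_product mult.commute flip: of_nat_mult)
  then have "\<exists>c\<in>X \<times> (rcosets K) \<rightarrow>\<^sub>E {0..<M}. (\<exists>i\<in>X \<times> (rcosets K). c i \<noteq> 0) \<and>
      (\<forall>j\<in>J. [ps c (fst j) (snd j) = 0] (mod M))"
    using X finite_rcosets_K finJ M J
    by (intro exists_nonzero_solution_mod) (auto intro!: path_sum_linear)
  then obtain \<omega> where \<omega>: "\<omega> \<in> X \<times> (rcosets K) \<rightarrow>\<^sub>E {0..<M}" "\<exists>p\<in>X \<times> (rcosets K). \<omega> p \<noteq> 0"
    and J0: "\<forall>j\<in>J. [ps \<omega> (fst j) (snd j) = 0] (mod M)"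
    by (elim bexE[of "_ \<rightarrow>\<^sub>E _"] conjE) (rule that)
  have J0: "[ps \<omega> w a = 0] (mod M)" if "(w, a) \<in> J" for w a
    using bspec[OF J0 that] by simp
  have pow: "[ps \<omega> (order_power y) a = 0] (mod M)" if y: "y \<in> Y" and a: "a \<in> carrier G" for y a
  proof -
    obtain t j where t: "t \<in> T y" "K #> a = K #> (t \<otimes> val y [^] (j::nat))"
      using T(4)[OF y a] by blast
    have tc: "t \<in> carrier G" "y \<in> words X" using T(1)[OF y] t y Y by auto
    have "ps \<omega> (order_power y) a = ps \<omega> (order_power y) (t \<otimes> val y [^] j)"
      using t tc a order_power_words[OF y] by (intro path_sum_cong_start) auto
    also have "\<dots> = ps \<omega> (order_power y) t" using tc by (intro path_sum_order_power_shift)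
    finally show ?thesis using J0[of "order_power y" t] t y by (auto simp: J_def)
  qed
  moreover have long: "[ps \<omega> \<rho> a = 0] (mod M)" if a: "a \<in> carrier G" for a
  proof -
    have C: "K #> a \<in> rcosets K" using a by (auto simp: RCOSETS_def)
    then have "ps \<omega> \<rho> a = ps \<omega> \<rho> (rep (K #> a))"
      using a \<rho> rep[OF C] by (intro path_sum_cong_start) auto
    then show ?thesis using J0[of \<rho> "rep (K #> a)"] C by (auto simp: J_def)
  qed
  moreover have "cocycle \<omega>"
    unfolding cocycle_def using pow long R by blast
  moreover have "[transport \<omega> \<one> (rep C) = 0] (mod M)" if "C \<in> rcosets K" for C
    unfolding transport_def using J0 that by (auto simp: J_def)
  ultimately show ?thesis
    using \<omega> by (intro bexI[of _ \<omega>] conjI ballI) (simp_all add: cocycles_def)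
qed

text \<open>The function is \<open>u g = transport \<omega> \<one> g\<close>, for which \<open>u (x k x\<^sup>-\<^sup>1) = transport \<omega> x k\<close> when \<open>k \<in> K\<close>. It cannot
vanish on \<open>K\<close>: it vanishes on coset representatives, so it would vanish on all of \<open>G\<close>, and
then so would \<open>\<omega>\<close>, whose values are differences of values of \<open>u\<close>.\<close>

lemma exists_left_additive_function:
  assumes Y: "finite Y" "Y \<subseteq> words X" and \<rho>: "\<rho> \<in> words X" and R: "R \<subseteq> insert \<rho> (order_power ` Y)"
    and size: "2 + (\<Sum>y\<in>Y. 1 / real (mod_ord G K (K #> val y))) < real (card X)"
  shows "\<exists>u. (\<forall>k\<in>K. \<forall>g\<in>carrier G. [u (k \<otimes> g) = u k + u g] (mod M)) \<and>
    (\<exists>k\<in>K. \<not> [u k = 0] (mod M)) \<and>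
    (\<forall>k\<in>trivial_part. \<forall>x\<in>carrier G. [u (x \<otimes> k \<otimes> inv x) = 0] (mod M)) \<and>
    (\<forall>y\<in>Y. \<forall>x\<in>carrier G. [u (x \<otimes> val y [^] mod_ord G K (K #> val y) \<otimes> inv x) = 0] (mod M))"
proof -
  obtain \<omega> where \<omega>: "\<omega> \<in> cocycles" "\<exists>p\<in>X \<times> (rcosets K). \<omega> p \<noteq> 0"
    "\<And>C. C \<in> rcosets K \<Longrightarrow> [transport \<omega> \<one> (rep C) = 0] (mod M)"
    "\<And>y a. y \<in> Y \<Longrightarrow> a \<in> carrier G \<Longrightarrow> [ps \<omega> (order_power y) a = 0] (mod M)"
    using exists_cocycle[OF assms] by blast
  have cz: "cocycle \<omega>" using \<omega> by (simp add: cocycles_def)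
  define u where "u g = transport \<omega> \<one> g" for g
  have u: "[u (k \<otimes> g) = u k + u g] (mod M)" if "k \<in> K" "g \<in> carrier G" for k g
  proof -
    have "transport \<omega> (\<one> \<otimes> k) g = transport \<omega> \<one> g"
      using that K_closed rcos_K_eq(2)[OF that(1) one_closed] by (intro transport_cong_start) simp_all
    then show ?thesis
      using transport_mult[OF cz one_closed, of k g] that K_closed by (simp add: u_def)
  qed
  have conj: "[u (x \<otimes> k \<otimes> inv x) = transport \<omega> x k] (mod M)" if "x \<in> carrier G" "k \<in> K" for x k
    using transport_conj[OF cz one_closed that] that by (simp add: u_def)
  have "\<exists>k\<in>K. \<not> [u k = 0] (mod M)"
  proof (rule ccontr)
    assume "\<not> (\<exists>k\<in>K. \<not> [u k = 0] (mod M))"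
    then have uK: "[u k = 0] (mod M)" if "k \<in> K" for k using that by blast
    have u0: "[u g = 0] (mod M)" if g: "g \<in> carrier G" for g
    proof -
      have C: "K #> g \<in> rcosets K" using g by (auto simp: RCOSETS_def)
      define k where "k = g \<otimes> inv rep (K #> g)"
      have k: "k \<in> K" using rcos_eq_iff[OF normal_K g rep(1)[OF C]] rep(2)[OF C] by (simp add: k_def)
      have "[u (k \<otimes> rep (K #> g)) = u k + u (rep (K #> g))] (mod M)"
        using k rep(1)[OF C] by (intro u)
      moreover have "[u k + u (rep (K #> g)) = 0 + 0] (mod M)"
        using \<omega>(3)[OF C] uK[OF k] by (intro cong_add) (auto simp: u_def)
      ultimately have "[u (k \<otimes> rep (K #> g)) = 0 + 0] (mod M)" by (rule cong_trans)
      then show ?thesis using g rep(1)[OF C] by (simp add: k_def m_assoc)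
    qed
    obtain x C where x: "x \<in> X" "C \<in> rcosets K" "\<omega> (x, C) \<noteq> 0" using \<omega>(2) by auto
    have a: "rep C \<in> carrier G" "K #> rep C = C" using rep x by auto
    have "[transport \<omega> \<one> (rep C \<otimes> \<gamma> x) = transport \<omega> \<one> (rep C) + transport \<omega> (\<one> \<otimes> rep C) (\<gamma> x)] (mod M)"
      using cz a x by (intro transport_mult) auto
    moreover have "[transport \<omega> (rep C) (val [(x, True)]) = ps \<omega> [(x, True)] (rep C)] (mod M)"
      using cz a x by (intro transport_val) auto
    then have "[transport \<omega> (rep C) (\<gamma> x) = \<omega> (x, C)] (mod M)"
      using a x by simp
    ultimately have "[u (rep C \<otimes> \<gamma> x) = u (rep C) + \<omega> (x, C)] (mod M)"
      using cong_trans[OF _ cong_add[OF cong_refl]] a by (simp add: u_def)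
    moreover have "[u (rep C \<otimes> \<gamma> x) = 0] (mod M)" "[u (rep C) = 0] (mod M)"
      using a x by (auto intro!: u0)
    ultimately have "[u (rep C) + \<omega> (x, C) = 0] (mod M)" "M dvd u (rep C)"
      using cong_trans[OF cong_sym] by (blast, simp add: cong_0_iff)
    then have "[\<omega> (x, C) = 0] (mod M)"
      by (simp add: cong_0_iff dvd_add_right_iff)
    moreover have "\<omega> (x, C) \<in> {0..<M}" using \<omega>(1) x by (auto simp: cocycles_def)
    ultimately show False using x(3) by (simp add: cong_def)
  qed
  moreover have "[u (x \<otimes> k \<otimes> inv x) = 0] (mod M)" if "k \<in> trivial_part" "x \<in> carrier G" for k x
  proof (rule cong_trans[OF conj])
    show "x \<in> carrier G" "k \<in> K" "[transport \<omega> x k = 0] (mod M)"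
      using that \<omega>(1) by (auto simp: trivial_part_def)
  qed
  moreover have "[u (x \<otimes> val y [^] mod_ord G K (K #> val y) \<otimes> inv x) = 0] (mod M)"
    if y: "y \<in> Y" and x: "x \<in> carrier G" for x y
  proof (rule cong_trans[OF conj])
    have yw: "y \<in> words X" using y Y by auto
    have eq: "val y [^] mod_ord G K (K #> val y) = val (order_power y)"
      using yw by (simp add: order_power_def val_concat_replicate)
    show "val y [^] mod_ord G K (K #> val y) \<in> K" using order_power_K[OF yw] by (simp add: eq)
    show "[transport \<omega> x (val y [^] mod_ord G K (K #> val y)) = 0] (mod M)"
      unfolding eq
    proof (rule cong_trans[OF transport_val[OF cz x]])
      show "order_power y \<in> words X" using yw by (simp add: order_power_def concat_replicate_words)
      show "[ps \<omega> (order_power y) x = 0] (mod M)" using \<omega>(4) y x by blast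
    qed
  qed (rule x)
  ultimately show ?thesis using u by (intro exI[of _ u]) blast
qed

end

section \<open>From a presentation to the failure of FIG\<close>

lemma concat_replicate_single: "concat (replicate n [x]) = replicate n x"
  by (induction n) auto

lemma sum_Un_le_nonneg:
  fixes f :: "'c \<Rightarrow> real"
  assumes "finite A" "finite B" "\<And>x. x \<in> A \<inter> B \<Longrightarrow> 0 \<le> f x"
  shows "sum f (A \<union> B) \<le> sum f A + sum f B"
  using sum.union_inter[OF assms(1,2), of f] sum_nonneg[of "A \<inter> B" f] assms(3) by simp

text \<open>The inequality says that the measure is positive. The hypothesis on orders makes the count of
conditions from the torsion relators exact: without it, a relator \<open>x^m\<close> could cost more than \<open>|G/K|/m\<close>.\<close>

lemma (in group) not_FIG_if_presentation:
  fixes X :: "'x set"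
  assumes pres: "presents G X R \<gamma>" and X: "finite X" and \<rho>: "\<rho> \<in> words X"
    and R: "R = insert \<rho> ((\<lambda>x. replicate (m x) (x, True)) ` D)" and D: "D \<subseteq> X"
    and size: "2 + (\<Sum>x\<in>D. 1 / real (m x)) < real (card X)"
    and exact: "\<And>x. x \<in> D \<Longrightarrow> \<exists>N\<in>finite_index_normal G. \<forall>j::nat. \<gamma> x [^] j \<in> N \<longrightarrow> m x dvd j"
  shows "\<not> FIG (profinite_completion G) (profinite_completion_topology G)"
proof
  assume "FIG (profinite_completion G) (profinite_completion_topology G)"
  then obtain S where S: "finite S" "S \<subseteq> carrier (profinite_completion G)"
    "invariably_generates (profinite_completion G) (profinite_completion_topology G) S"
    by (auto simp: FIG_def)
  have finD: "finite D" using D X finite_subset by blast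
  have "\<exists>N\<in>finite_index_normal G. \<forall>x\<in>D. \<forall>j::nat. \<gamma> x [^] j \<in> N \<longrightarrow> m x dvd j"
    by (rule finite_index_normal_INT[OF finD exact]) auto
  then obtain N0 where N0: "N0 \<in> finite_index_normal G"
    "\<And>x j. x \<in> D \<Longrightarrow> \<gamma> x [^]\<^bsub>G\<^esub> (j::nat) \<in> N0 \<Longrightarrow> m x dvd j" by blast
  define \<mu> where "\<mu> = real (card X) - 2 - (\<Sum>x\<in>D. 1 / real (m x))"
  have \<mu>: "\<mu> > 0" using size by (simp add: \<mu>_def)
  \<comment> \<open>orders of at least \<open>L\<close> keep the total cost of \<open>S\<close> below \<open>\<mu>\<close> for each coset of \<open>K\<close>\<close>
  obtain L :: nat where L: "real (card S) / \<mu> < real L" using reals_Archimedean2 by blast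
  have L0: "real L > 0" using L \<mu> by (meson divide_nonneg_pos le_less_trans of_nat_0_le_iff)
  have SL: "real (card S) * (1 / real L) < \<mu>" using L \<mu> L0 by (simp add: field_simps)
  obtain K where cover: "K \<in> finite_index_normal G" "K \<subseteq> N0"
    "\<forall>s\<in>S. L \<le> mod_ord G K (s K) \<or>
      (\<forall>N\<in>finite_index_normal G. N \<subseteq> K \<longrightarrow> mod_ord G N (s N) = mod_ord G K (s K))"
    using large_or_stable_orders[OF S(1,2) N0(1), of L] by blast
  have K_normal: "K \<lhd> G" and fin: "finite (rcosets K)" using cover(1) by (auto simp: finite_index_normal_def)
  define M where "M = int (card (rcosets K)) + 1"
  have "card (rcosets K) > 0"
    using fin coset_join2[OF one_closed] normal_imp_subgroup[OF K_normal]
    by (auto simp: card_gt_0_iff RCOSETS_def)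
  then have "M \<ge> 2" by (simp add: M_def)
  then interpret presentation_cover G X R \<gamma> K M
    using pres cover(1) X by unfold_locales
  let ?N = trivial_part
  have N: "?N \<in> finite_index_normal G" "?N \<lhd> G" "?N \<subseteq> K"
    using finite_index_trivial_part normal_trivial_part by (auto simp: trivial_part_def)
  have "\<forall>s\<in>S. \<exists>h. h \<in> carrier G \<and> s ?N = ?N #> h"
    using profinite_element_coset[OF _ N(1)] S(2) by blast
  from bchoice[OF this] obtain g where g: "g s \<in> carrier G" "s ?N = ?N #> g s" if "s \<in> S" for s
    by blast
  have gK: "s K = K #> g s" if "s \<in> S" for s
    using profinite_coset_mono[where \<phi> = s and N = ?N and M = K and g = "g s"] N cover(1) g[OF that]
      subsetD[OF S(2) that] by simp
  \<comment> \<open>the elements on whose powers vanishing has to be imposed; for the others it is automatic\<close>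
  define S' where "S' = {s \<in> S. L \<le> mod_ord G K (s K)}"
  define w where "w x = [(x, True)]" for x :: 'x
  define Y where "Y = w ` D \<union> (\<lambda>s. word_for (g s)) ` S'"
  have finY: "finite Y" using finD S(1) by (auto simp: Y_def S'_def)
  have Yw: "Y \<subseteq> words X" using D g by (auto simp: Y_def S'_def w_def)
  have val_w: "val (w x) = \<gamma> x" if "x \<in> D" for x using that D by (auto simp: w_def)
  have ord_w: "mod_ord G K (K #> val (w x)) = m x" if x: "x \<in> D" for x
  proof (rule dvd_antisym)
    have xX: "x \<in> X" using x D by auto
    have ww: "w x \<in> words X" using xX by (simp add: w_def)
    have "concat (replicate (m x) (w x)) = replicate (m x) (x, True)"
      by (simp add: w_def concat_replicate_single)
    then have "\<gamma> x [^] m x = val (replicate (m x) (x, True))"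
      using val_concat_replicate[OF ww, of "m x"] val_w[OF x] by simp
    also have "\<dots> = \<one>"
    proof (rule val_relator)
      show "replicate (m x) (x, True) \<in> R" using x R by blast
      show "replicate (m x) (x, True) \<in> words X" using xX by (auto simp: words_def)
    qed
    finally have "\<gamma> x [^] m x \<in> K" using subgroup.one_closed[OF K_subgroup] by simp
    then show "mod_ord G K (K #> val (w x)) dvd m x"
      using mod_ord_dvd_iff[OF K_normal gen[OF xX], of "m x"] val_w[OF x] by simp
    have "\<gamma> x [^] mod_ord G K (K #> \<gamma> x) \<in> K"
      using mod_ord_dvd_iff[OF K_normal gen[OF xX], of "mod_ord G K (K #> \<gamma> x)"] by simp
    then show "m x dvd mod_ord G K (K #> val (w x))"
      using N0(2)[OF x] cover(2) val_w[OF x] by auto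
  qed
  have relators: "R \<subseteq> insert \<rho> (order_power ` Y)"
  proof -
    have "replicate (m x) (x, True) = order_power (w x)" if "x \<in> D" for x
      unfolding order_power_def ord_w[OF that] by (simp add: w_def concat_replicate_single)
    then show ?thesis unfolding R Y_def by blast
  qed
  have sizeY: "2 + (\<Sum>y\<in>Y. 1 / real (mod_ord G K (K #> val y))) < real (card X)"
  proof -
    let ?f = "\<lambda>y. 1 / real (mod_ord G K (K #> val y))"
    have "sum ?f Y \<le> sum ?f (w ` D) + sum ?f ((\<lambda>s. word_for (g s)) ` S')"
      unfolding Y_def using finD S(1) by (intro sum_Un_le_nonneg) (auto simp: S'_def)
    also have "sum ?f (w ` D) \<le> sum (?f \<circ> w) D"
      using finD by (intro sum_image_le) auto
    also have "sum (?f \<circ> w) D = (\<Sum>x\<in>D. 1 / real (m x))"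
      by (intro sum.cong) (simp_all add: ord_w)
    also have "sum ?f ((\<lambda>s. word_for (g s)) ` S') \<le> sum (?f \<circ> (\<lambda>s. word_for (g s))) S'"
      using S(1) by (intro sum_image_le) (auto simp: S'_def)
    also have "sum (?f \<circ> (\<lambda>s. word_for (g s))) S' \<le> (\<Sum>s\<in>S'. 1 / real L)"
    proof (rule sum_mono)
      fix s assume s: "s \<in> S'"
      then have "s \<in> S" by (simp add: S'_def)
      then have "L \<le> mod_ord G K (K #> val (word_for (g s)))"
        using s g(1) gK by (simp add: S'_def)
      then show "(?f \<circ> (\<lambda>s. word_for (g s))) s \<le> 1 / real L"
        using L0 by (simp add: frac_le)
    qed
    also have "(\<Sum>s\<in>S'. 1 / real L) \<le> real (card S) * (1 / real L)"
      using S(1) L0 by (simp add: S'_def divide_right_mono card_mono)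
    finally have "sum ?f Y < (\<Sum>x\<in>D. 1 / real (m x)) + \<mu>" using SL by simp
    then show ?thesis by (simp add: \<mu>_def)
  qed
  obtain u where u: "\<forall>k\<in>K. \<forall>g\<in>carrier G. [u (k \<otimes> g) = u k + u g] (mod M)"
    "\<exists>k\<in>K. \<not> [u k = 0] (mod M)"
    "\<forall>k\<in>?N. \<forall>x\<in>carrier G. [u (x \<otimes> k \<otimes> inv x) = 0] (mod M)"
    "\<forall>y\<in>Y. \<forall>x\<in>carrier G. [u (x \<otimes> val y [^] mod_ord G K (K #> val y) \<otimes> inv x) = 0] (mod M)"
    using exists_left_additive_function[OF finY Yw \<rho> relators sizeY] by (elim exE conjE) (rule that)
  from exists_proper_subgroup_with_conjugates[OF K_normal fin M_def u(1,2)]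
  obtain P where P: "subgroup P G" "P \<noteq> carrier G"
    "\<forall>n\<in>K. (\<forall>x\<in>carrier G. [u (x \<otimes> n \<otimes> inv x) = 0] (mod M)) \<longrightarrow> n \<in> P"
    "\<forall>g\<in>carrier G. \<forall>n. n dvd card (rcosets K) \<and> g [^] n \<in> K \<and>
        (\<forall>x\<in>carrier G. [u (x \<otimes> g [^] n \<otimes> inv x) = 0] (mod M)) \<longrightarrow>
      (\<exists>k\<in>carrier G. inv k \<otimes> g \<otimes> k \<in> P)"
    by (elim exE conjE) (rule that)
  have NP: "?N \<subseteq> P" using P(3) u(3) N(3) by blast
  have conj: "\<exists>h\<in>carrier G. \<exists>k\<in>carrier G. s ?N = ?N #> h \<and> inv k \<otimes> h \<otimes> k \<in> P" if s: "s \<in> S" for s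
  proof -
    let ?n = "mod_ord G K (s K)"
    have sC: "s \<in> carrier (profinite_completion G)" using s S(2) by auto
    have "K #> g s \<in> carrier (G Mod K)" using g(1)[OF s] by (auto simp: carrier_FactGroup)
    then have 1: "?n dvd card (rcosets K)" using mod_ord_dvd_index(1)[OF cover(1)] gK[OF s] by simp
    have 2: "g s [^] ?n \<in> K"
      using mod_ord_dvd_iff[OF K_normal g(1)[OF s], of ?n] gK[OF s] by simp
    have 3: "\<forall>x\<in>carrier G. [u (x \<otimes> g s [^] ?n \<otimes> inv x) = 0] (mod M)"
    proof (cases "s \<in> S'")
      case True
      then have "word_for (g s) \<in> Y" by (auto simp: Y_def)
      from bspec[OF u(4) this] show ?thesis using g(1)[OF s] gK[OF s] by simp
    next
      case False
      then have "mod_ord G ?N (s ?N) = ?n" using cover(3) s N(1,3) by (auto simp: S'_def)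
      then have "g s [^] ?n \<in> ?N"
        using mod_ord_dvd_iff[OF N(2) g(1)[OF s], of ?n] g(2)[OF s] by simp
      then show ?thesis using u(3) by blast
    qed
    obtain k where "k \<in> carrier G" "inv k \<otimes> g s \<otimes> k \<in> P"
      using P(4) g(1)[OF s] 1 2 3 by blast
    then show ?thesis using g[OF s] by blast
  qed
  have "P = carrier G"
    using conj
    by (intro invariable_generation_finite_quotient[where S = S and N = ?N and P = P] S N(1) P(1) NP)
  then show False using P(2) by simp
qed


section \<open>Primes with an element of given order\<close>

lemma poly_map_of_int_mult:
  fixes z :: complex
  shows "poly (map_poly of_int (p * q)) z = poly (map_poly of_int p) z * poly (map_poly of_int q) z"
proof -
  have add: "poly (map_poly of_int (p + q)) z = poly (map_poly of_int p) z + poly (map_poly of_int q) z"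
    for p q :: "int poly"
  proof -
    have "map_poly of_int (p + q) = (map_poly of_int p + map_poly of_int q :: complex poly)"
      by (rule poly_eqI) (simp add: coeff_map_poly)
    then show ?thesis by simp
  qed
  have smult: "poly (map_poly of_int (Polynomial.smult c p)) z = of_int c * poly (map_poly of_int p) z"
    for c and p :: "int poly"
  proof -
    have "map_poly of_int (Polynomial.smult c p) = (Polynomial.smult (of_int c) (map_poly of_int p) :: complex poly)"
      by (rule poly_eqI) (simp add: coeff_map_poly)
    then show ?thesis by simp
  qed
  show ?thesis
    by (induction p) (simp_all add: add smult map_poly_pCons algebra_simps)
qed

text \<open>Let \<open>g\<close> be the part of \<open>F = X^N - 1\<close> that it shares with the polynomials \<open>X^(N/r) - 1\<close> for primes \<open>r\<close>
dividing \<open>N\<close>. A primitive \<open>N\<close>-th root of unity is no root of \<open>g\<close>, so the cofactor \<open>h\<close> is not constant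
and \<open>h a\<close> has a prime divisor \<open>q\<close> for some multiple \<open>a\<close> of \<open>N\<close>. If \<open>a^(N/r) = 1\<close> modulo \<open>q\<close>, then \<open>q\<close>
divides both \<open>g a\<close> and \<open>h a\<close>, so \<open>a\<close> is a double root of \<open>F\<close> modulo \<open>q\<close>. But the derivative \<open>N a^(N-1)\<close> is
prime to \<open>q\<close>, because \<open>N\<close> divides \<open>a\<close> and \<open>q\<close> divides \<open>a^N - 1\<close>. Hence \<open>a\<close> has order \<open>N\<close>.\<close>

lemma exists_prime_ord:
  assumes "N \<ge> 1"
  shows "\<exists>q a :: nat. prime q \<and> ord q a = N"
proof -
  define F :: "int poly" where "F = Polynomial.monom 1 N - 1"
  define D :: "nat \<Rightarrow> int poly" where "D r = Polynomial.monom 1 (N div r) - 1" for r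
  define P where "P = (\<Prod>r\<in>prime_factors N. D r)"
  define g where "g = gcd F P"
  obtain h where h: "F = g * h" unfolding g_def by (metis gcd_dvd1 dvdE)
  have pF: "poly F x = x ^ N - 1" for x by (simp add: F_def poly_monom)
  have F0: "F \<noteq> 0" using pF[of 0] assms by (auto simp: power_0_left)
  have DF: "D r dvd F" if "r \<in> prime_factors N" for r
  proof -
    have "N = (N div r) * r" using that by (auto simp: in_prime_factors_iff)
    then have "(Polynomial.monom 1 N :: int poly) = Polynomial.monom 1 (N div r) ^ r"
      by (simp add: monom_power)
    then show ?thesis
      unfolding F_def D_def by (simp add: power_diff_1_eq)
  qed
  have Dg: "D r dvd g" if "r \<in> prime_factors N" for r
    unfolding g_def P_def using that DF by (intro gcd_greatest dvd_prodI) auto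
  have deg: "degree h > 0"
  proof (rule ccontr)
    let ?z = "cis (2 * pi / N)"
    have z: "?z ^ j \<noteq> 1" if j: "0 < j" "j < N" for j
    proof
      assume "?z ^ j = 1"
      then have eq: "cis (2 * pi * real j / real N) = cis (2 * pi * real 0 / real N)"
        by (simp add: Complex.DeMoivre mult.commute)
      have inj: "inj_on (\<lambda>k. cis (2 * pi * real k / real N)) {..<N}"
        using Complex.bij_betw_roots_unity[of N] assms by (auto simp: bij_betw_def)
      have "j = 0" using j by (intro inj_onD[OF inj eq]) auto
      then show False using j by simp
    qed
    have mono: "poly (map_poly of_int (Polynomial.monom 1 k - 1)) ?z = ?z ^ k - 1" for k
    proof -
      have "map_poly of_int (Polynomial.monom 1 k - 1) = (Polynomial.monom 1 k - 1 :: complex poly)"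
        by (rule poly_eqI) (simp add: coeff_map_poly)
      then show ?thesis by (simp add: poly_monom)
    qed
    have "poly (map_poly of_int P) ?z \<noteq> 0"
    proof -
      have D0: "poly (map_poly of_int (D r)) ?z \<noteq> 0" if "r \<in> prime_factors N" for r
      proof -
        have "r dvd N" "r > 1" using that prime_gt_1_nat[of r] by (auto simp: in_prime_factors_iff)
        then have "0 < N div r" "N div r < N"
          using assms by (auto intro!: div_less_dividend simp: div_greater_zero_iff dvd_imp_le)
        then show ?thesis using z unfolding D_def mono by auto
      qed
      have "poly (map_poly of_int (\<Prod>r\<in>A. D r)) ?z \<noteq> 0" if "finite A" "A \<subseteq> prime_factors N" for A
        using that by (induction A rule: finite_induct) (auto simp: poly_map_of_int_mult D0)
      then show ?thesis unfolding P_def by simp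
    qed
    moreover obtain k where "P = g * k" unfolding g_def by (metis gcd_dvd2 dvdE)
    ultimately have g: "poly (map_poly of_int g) ?z \<noteq> 0" by (auto simp: poly_map_of_int_mult)
    have "?z ^ N = 1" using assms by (simp add: Complex.DeMoivre)
    then have "poly (map_poly of_int F) ?z = 0" unfolding F_def mono by simp
    then have hz: "poly (map_poly of_int h) ?z = 0" using g by (simp add: h poly_map_of_int_mult)
    assume "\<not> degree h > 0"
    then obtain c where c: "h = [:c:]" using degree_eq_zeroE by blast
    then have "c = 0" using hz by (simp add: map_poly_pCons)
    then show False using F0 h c by simp
  qed
  \<comment> \<open>the arguments at which \<open>h\<close> is \<open>0\<close> or a unit, hence without prime divisor or divisible by all primes\<close>
  define Z where "Z = {x. poly (h * (h - 1) * (h + 1)) x = 0}"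
  have "h \<noteq> 0" "h - 1 \<noteq> 0" "h + 1 \<noteq> 0"
  proof -
    show "h \<noteq> 0" using deg by auto
    have "h \<noteq> 1" using deg by auto
    then show "h - 1 \<noteq> 0" by simp
    have "h \<noteq> - 1" using deg by auto
    then show "h + 1 \<noteq> 0" by (simp add: eq_neg_iff_add_eq_0)
  qed
  then have "finite Z" unfolding Z_def by (intro poly_roots_finite) simp
  moreover have "infinite (range (\<lambda>b::nat. int (N * b)))"
    using assms by (intro range_inj_infinite) (auto simp: inj_def)
  ultimately have "\<not> range (\<lambda>b::nat. int (N * b)) \<subseteq> Z" using finite_subset by blast
  then obtain b where b: "int (N * b) \<notin> Z" by auto
  define a where "a = N * b"
  have ha: "poly h (int a) \<noteq> 0" "poly h (int a) \<noteq> 1" "poly h (int a) \<noteq> - 1"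
    using b by (auto simp: Z_def a_def)
  then have "\<not> is_unit (poly h (int a))" by (auto simp: zdvd1_eq)
  then obtain q where q: "prime q" "q dvd poly h (int a)"
    using ha(1) prime_divisor_exists by blast
  have qF: "q dvd int a ^ N - 1"
    using q(2) pF[of "int a"] unfolding h by (metis dvd_mult poly_mult)
  have qa: "\<not> q dvd int a"
  proof
    assume "q dvd int a"
    then have "q dvd int a ^ N" using assms dvd_trans[OF _ dvd_power[of N "int a"]] by simp
    then have "q dvd int a ^ N - (int a ^ N - 1)" using qF by (rule dvd_diff)
    then have "q dvd 1" by simp
    then show False using q(1) by (meson not_prime_unit)
  qed
  have qN: "\<not> q dvd int N" using qa by (auto simp: a_def)
  have qD: "\<not> q dvd int a ^ (N div r) - 1" if r: "r \<in> prime_factors N" for r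
  proof
    assume "q dvd int a ^ (N div r) - 1"
    then have "q dvd poly (D r) (int a)" by (simp add: D_def poly_monom)
    then have qg: "q dvd poly g (int a)" using Dg[OF r] by (metis dvdE dvd_mult2 poly_mult)
    have "poly (pderiv F) (int a) = int N * int a ^ (N - 1)"
      by (simp add: F_def pderiv_diff pderiv_monom poly_monom)
    moreover have "pderiv F = g * pderiv h + h * pderiv g" by (simp add: h pderiv_mult)
    ultimately have "int N * int a ^ (N - 1) =
        poly g (int a) * poly (pderiv h) (int a) + poly h (int a) * poly (pderiv g) (int a)"
      by (metis poly_add poly_mult)
    then have "q dvd int N * int a ^ (N - 1)" using qg q(2) by simp
    then show False using q(1) qN qa by (auto simp: prime_dvd_mult_iff dest: prime_dvd_power)
  qed
  obtain p where p: "q = int p" "prime p" using q(1) by (metis prime_gt_0_int pos_int_cases prime_nat_int_transfer)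
  have iff: "q dvd int a ^ j - 1 \<longleftrightarrow> ord p a dvd j" for j
  proof -
    have "q dvd int a ^ j - 1 \<longleftrightarrow> [int (a ^ j) = int 1] (mod int p)"
      by (simp add: cong_iff_dvd_diff p)
    also have "\<dots> \<longleftrightarrow> [a ^ j = 1] (mod p)" by (rule cong_int_iff)
    finally show ?thesis by (simp add: ord_divides')
  qed
  have "ord p a = N"
  proof (rule ccontr)
    assume ne: "ord p a \<noteq> N"
    have "ord p a dvd N" using qF iff by simp
    then obtain e where e: "N = ord p a * e" by blast
    have "e \<noteq> 1" using ne e by auto
    then obtain r where r: "prime r" "r dvd e" using prime_factor_nat by blast
    then obtain e' where e': "e = r * e'" by blast
    have "N div r = ord p a * e'" using e e' r prime_gt_0_nat by (simp add: ac_simps)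
    then have "q dvd int a ^ (N div r) - 1" using iff by simp
    moreover have "r \<in> prime_factors N" using r e assms by (auto simp: in_prime_factors_iff)
    ultimately show False using qD by blast
  qed
  then show ?thesis using p by blast
qed

section \<open>Finite triangle and dihedral quotients\<close>

lemma BijGroup_mult_apply:
  "f \<in> carrier (BijGroup S) \<Longrightarrow> g \<in> carrier (BijGroup S) \<Longrightarrow> x \<in> S \<Longrightarrow> (f \<otimes>\<^bsub>BijGroup S\<^esub> g) x = f (g x)"
  by (simp add: BijGroup_def compose_def)

lemma BijGroup_eqI:
  assumes "f \<in> carrier (BijGroup S)" "g \<in> carrier (BijGroup S)" "\<And>x. x \<in> S \<Longrightarrow> f x = g x"
  shows "f = g"
  using assms by (intro extensionalityI[of f S g]) (auto simp: BijGroup_def Bij_def)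

lemma BijGroup_closed:
  "f \<in> carrier (BijGroup S) \<Longrightarrow> x \<in> S \<Longrightarrow> f x \<in> S"
  by (auto simp: BijGroup_def Bij_def bij_betw_def)

lemma BijGroup_pow_apply:
  assumes "f \<in> carrier (BijGroup S)" "x \<in> S"
  shows "(f [^]\<^bsub>BijGroup S\<^esub> (j::nat)) x = (f ^^ j) x"
  using assms(2)
proof (induction j arbitrary: x)
  case 0
  then show ?case by (simp add: BijGroup_def nat_pow_def)
next
  case (Suc j)
  interpret group "BijGroup S" by (rule group_BijGroup)
  show ?case
    using Suc assms(1) BijGroup_closed[OF assms(1)] by (simp add: BijGroup_mult_apply funpow_swap1)
qed

lemma finite_BijGroup: "finite S \<Longrightarrow> finite (carrier (BijGroup S))"
proof (rule finite_subset)
  show "carrier (BijGroup S) \<subseteq> S \<rightarrow>\<^sub>E S"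
    by (auto simp: BijGroup_def Bij_def bij_betw_def PiE_def)
qed (auto intro: finite_PiE)

text \<open>The characteristic polynomial of the recurrence has the roots \<open>\<nu>\<close> and \<open>\<nu>'\<close>; applying the factor of
\<open>\<nu>'\<close> leaves a geometric sequence with ratio \<open>\<nu>\<close>.\<close>

lemma linear_recurrence_split:
  fixes x :: "nat \<Rightarrow> int"
  assumes rec: "\<And>j. [x (Suc (Suc j)) = (\<nu> + \<nu>') * x (Suc j) - x j] (mod q)" and inv: "[\<nu> * \<nu>' = 1] (mod q)"
  shows "[x (Suc j) - \<nu>' * x j = \<nu> ^ j * (x 1 - \<nu>' * x 0)] (mod q)"
proof (induction j)
  case (Suc j)
  have "[x (Suc (Suc j)) - \<nu>' * x (Suc j) = ((\<nu> + \<nu>') * x (Suc j) - 1 * x j) - \<nu>' * x (Suc j)] (mod q)"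
    using rec[of j] by (intro cong_diff) auto
  also have "[((\<nu> + \<nu>') * x (Suc j) - 1 * x j) - \<nu>' * x (Suc j) =
      ((\<nu> + \<nu>') * x (Suc j) - (\<nu> * \<nu>') * x j) - \<nu>' * x (Suc j)] (mod q)"
    using inv by (intro cong_diff cong_mult) (auto intro: cong_sym)
  also have "((\<nu> + \<nu>') * x (Suc j) - (\<nu> * \<nu>') * x j) - \<nu>' * x (Suc j) = \<nu> * (x (Suc j) - \<nu>' * x j)"
    by (simp add: algebra_simps)
  also have "[\<nu> * (x (Suc j) - \<nu>' * x j) = \<nu> * (\<nu> ^ j * (x 1 - \<nu>' * x 0))] (mod q)"
    using Suc by (intro cong_mult) auto
  finally show ?case by (simp add: mult.assoc)
qed simp

text \<open>The quadruple \<open>(a, b, c, d)\<close> is the matrix with rows \<open>(a, b)\<close> and \<open>(c, d)\<close>.\<close>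

definition mat_act :: "int \<Rightarrow> int \<times> int \<times> int \<times> int \<Rightarrow> int \<times> int \<Rightarrow> int \<times> int" where
  "mat_act q = (\<lambda>(a, b, c, d) (x, y). ((a * x + b * y) mod q, (c * x + d * y) mod q))"

definition mat_mult :: "int \<times> int \<times> int \<times> int \<Rightarrow> int \<times> int \<times> int \<times> int \<Rightarrow> int \<times> int \<times> int \<times> int" where
  "mat_mult = (\<lambda>(a, b, c, d) (a', b', c', d').
     (a * a' + b * c', a * b' + b * d', c * a' + d * c', c * b' + d * d'))"

definition plane :: "int \<Rightarrow> (int \<times> int) set" where
  "plane q = {0..<q} \<times> {0..<q}"

definition neg_mod :: "int \<Rightarrow> int \<times> int \<Rightarrow> int \<times> int" where
  "neg_mod q = (\<lambda>(x, y). ((- x) mod q, (- y) mod q))"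

text \<open>\<open>SL\<^sub>2(\<int>/q)\<close> modulo its centre acts on the vectors up to sign. This realises \<open>PSL\<^sub>2(\<int>/q)\<close> by
permutations of a finite set.\<close>

definition signed_points :: "int \<Rightarrow> (int \<times> int) set set" where
  "signed_points q = (\<lambda>v. {v, neg_mod q v}) ` plane q"

definition sign_perm :: "int \<Rightarrow> int \<times> int \<times> int \<times> int \<Rightarrow> (int \<times> int) set \<Rightarrow> (int \<times> int) set" where
  "sign_perm q A = (\<lambda>S\<in>signed_points q. mat_act q A ` S)"

lemma mat_act_plane: "q > 0 \<Longrightarrow> mat_act q A v \<in> plane q"
  by (cases A, cases v) (auto simp: mat_act_def plane_def)

lemma mod_linear: "(a * (x mod q) + b * (y mod q)) mod q = (a * x + b * y) mod (q :: int)"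
  by (metis mod_add_eq mod_mult_right_eq)

lemma mat_act_mult: "mat_act q A (mat_act q B v) = mat_act q (mat_mult A B) v"
  by (cases A, cases B, cases v) (simp add: mat_act_def mat_mult_def mod_linear algebra_simps)

lemma mat_act_neg: "mat_act q A (neg_mod q v) = neg_mod q (mat_act q A v)"
  by (cases A, cases v) (simp add: mat_act_def neg_mod_def mod_linear mod_minus_eq algebra_simps)

lemma neg_neg: "v \<in> plane q \<Longrightarrow> neg_mod q (neg_mod q v) = v"
  by (cases v) (simp add: neg_mod_def plane_def mod_simps)

definition unimodular :: "int \<Rightarrow> int \<times> int \<times> int \<times> int \<Rightarrow> bool" where
  "unimodular q = (\<lambda>(a, b, c, d). [a * d - b * c = 1] (mod q))"

lemma unimodular_mult: "unimodular q A \<Longrightarrow> unimodular q B \<Longrightarrow> unimodular q (mat_mult A B)"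
proof (cases A, cases B)
  fix a b c d a' b' c' d' assume AB: "A = (a, b, c, d)" "B = (a', b', c', d')"
    and "unimodular q A" "unimodular q B"
  then have "[(a * d - b * c) * (a' * d' - b' * c') = 1 * 1] (mod q)"
    by (intro cong_mult) (auto simp: unimodular_def)
  then show ?thesis by (simp add: AB unimodular_def mat_mult_def algebra_simps)
qed

lemma mat_act_inverse:
  assumes "unimodular q (a, b, c, d)" "v \<in> plane q"
  shows "mat_act q (d, - b, - c, a) (mat_act q (a, b, c, d) v) = v"
proof -
  obtain x y where v: "v = (x, y)" by (cases v)
  have "[(a * d - b * c) * x = 1 * x] (mod q)" "[(a * d - b * c) * y = 1 * y] (mod q)"
    using assms(1) by (auto intro!: cong_scalar_right simp: unimodular_def simp del: mult_1)
  then have "((a * d - b * c) * x) mod q = x" "((a * d - b * c) * y) mod q = y"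
    using assms(2) by (auto simp: v plane_def cong_def)
  then show ?thesis
    unfolding mat_act_mult by (simp add: v mat_act_def mat_mult_def algebra_simps)
qed

lemma sign_perm_apply:
  assumes "v \<in> plane q"
  shows "sign_perm q A {v, neg_mod q v} = {mat_act q A v, neg_mod q (mat_act q A v)}"
  using assms by (auto simp: sign_perm_def signed_points_def mat_act_neg)

lemma sign_perm_closed: "q > 0 \<Longrightarrow> S \<in> signed_points q \<Longrightarrow> sign_perm q A S \<in> signed_points q"
  unfolding signed_points_def by (elim imageE) (auto simp: sign_perm_apply intro: mat_act_plane)

lemma sign_perm_mult:
  assumes "q > 0" "S \<in> signed_points q"
  shows "sign_perm q A (sign_perm q B S) = sign_perm q (mat_mult A B) S"
  using assms by (auto simp: signed_points_def sign_perm_apply mat_act_plane mat_act_mult)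

lemma sign_perm_Bij:
  assumes "q > 0" "unimodular q A"
  shows "sign_perm q A \<in> carrier (BijGroup (signed_points q))"
proof -
  obtain a b c d where A: "A = (a, b, c, d)" by (cases A)
  let ?B = "(d, - b, - c, a)"
  have B: "unimodular q ?B" using assms(2) by (simp add: A unimodular_def mult.commute)
  have "sign_perm q ?B (sign_perm q A S) = S" "sign_perm q A (sign_perm q ?B S) = S"
    if "S \<in> signed_points q" for S
    using that assms mat_act_inverse[OF assms(2)[unfolded A]] mat_act_inverse[OF B]
    by (auto simp: signed_points_def sign_perm_apply mat_act_plane A)
  then have "bij_betw (sign_perm q A) (signed_points q) (signed_points q)"
    using assms(1) sign_perm_closed[OF assms(1)] by (intro bij_betw_byWitness[of _ "sign_perm q ?B"])
      (simp_all add: image_subset_iff)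
  then show ?thesis by (auto simp: BijGroup_def Bij_def sign_perm_def)
qed

text \<open>A matrix of determinant one with the distinct eigenvalues \<open>\<nu>\<close> and \<open>\<nu>'\<close> is diagonalisable, so its
\<open>j\<close>-th power is \<open>\<plusminus>1\<close> only if \<open>\<nu>^j = \<plusminus>1\<close>, and its \<open>n\<close>-th power is \<open>-1\<close>. By the theorem of
Cayley and Hamilton the coordinates along an orbit satisfy a linear recurrence, from which this can be
read off without changing the basis.\<close>

lemma sign_perm_pow_eq_one_iff:
  assumes q: "prime q" and A: "A = (a, b, c, d)" "unimodular q A"
    and trace: "[a + d = \<nu> + \<nu>'] (mod q)" and inv: "[\<nu> * \<nu>' = 1] (mod q)"
    and ord: "\<And>j. [\<nu> ^ j = 1] (mod q) \<longleftrightarrow> 2 * n dvd j" and n: "n \<ge> 2"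
  shows "sign_perm q A [^]\<^bsub>BijGroup (signed_points q)\<^esub> (j::nat) = \<one>\<^bsub>BijGroup (signed_points q)\<^esub> \<longleftrightarrow> n dvd j"
proof -
  let ?Q = "BijGroup (signed_points q)"
  interpret Q: group ?Q by (rule group_BijGroup)
  have q0: "q > 0" using q by (simp add: prime_gt_0_int)
  let ?T = "mat_act q A"
  define X where "X v j = fst ((?T ^^ j) v)" for v j
  define Y where "Y v j = snd ((?T ^^ j) v)" for v j
  have XY: "(?T ^^ j) v = (X v j, Y v j)" for v j by (simp add: X_def Y_def)
  have step: "[X v (Suc j) = a * X v j + b * Y v j] (mod q)" "[Y v (Suc j) = c * X v j + d * Y v j] (mod q)" for v j
    by (simp_all add: X_def Y_def A mat_act_def case_prod_beta cong_def)
  have rec: "[X v (Suc (Suc j)) = (\<nu> + \<nu>') * X v (Suc j) - X v j] (mod q)"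
    "[Y v (Suc (Suc j)) = (\<nu> + \<nu>') * Y v (Suc j) - Y v j] (mod q)" for v j
  proof -
    obtain k where k: "X v (Suc j) = a * X v j + b * Y v j + q * k"
      using step(1)[of v j] by (metis cong_iff_lin cong_sym)
    obtain l where l: "Y v (Suc j) = c * X v j + d * Y v j + q * l"
      using step(2)[of v j] by (metis cong_iff_lin cong_sym)
    obtain k' where k': "X v (Suc (Suc j)) = a * X v (Suc j) + b * Y v (Suc j) + q * k'"
      using step(1)[of v "Suc j"] by (metis cong_iff_lin cong_sym)
    obtain l' where l': "Y v (Suc (Suc j)) = c * X v (Suc j) + d * Y v (Suc j) + q * l'"
      using step(2)[of v "Suc j"] by (metis cong_iff_lin cong_sym)
    obtain t where t: "\<nu> + \<nu>' = a + d + q * t" using trace by (metis cong_iff_lin)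
    obtain e where e: "a * d - b * c = 1 + q * e"
      using A by (auto simp: unimodular_def) (metis cong_iff_lin cong_sym)
    have ad: "a * d = 1 + q * e + b * c" using e by simp
    have "X v (Suc (Suc j)) - ((\<nu> + \<nu>') * X v (Suc j) - X v j) =
        q * (k' + b * l - t * X v (Suc j) - d * k - e * X v j) + X v j * (1 + q * e + b * c - a * d)"
      unfolding k' t l k by (simp add: algebra_simps)
    then show "[X v (Suc (Suc j)) = (\<nu> + \<nu>') * X v (Suc j) - X v j] (mod q)"
      by (simp add: cong_iff_dvd_diff ad)
    have "Y v (Suc (Suc j)) - ((\<nu> + \<nu>') * Y v (Suc j) - Y v j) =
        q * (l' + c * k - t * Y v (Suc j) - a * l - e * Y v j) + Y v j * (1 + q * e + b * c - a * d)"
      unfolding l' t l k by (simp add: algebra_simps)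
    then show "[Y v (Suc (Suc j)) = (\<nu> + \<nu>') * Y v (Suc j) - Y v j] (mod q)"
      by (simp add: cong_iff_dvd_diff ad)
  qed
  have nu: "\<not> [\<nu> = \<nu>'] (mod q)"
  proof
    assume "[\<nu> = \<nu>'] (mod q)"
    then have "[\<nu> * \<nu> = \<nu> * \<nu>'] (mod q)" by (intro cong_mult) auto
    then have "[\<nu> ^ 2 = 1] (mod q)" using inv cong_trans by (fastforce simp: power2_eq_square)
    then show False using ord[of 2] n by (auto dest: dvd_imp_le)
  qed
  have nn: "[\<nu> ^ n = - 1] (mod q)"
  proof -
    have "[\<nu> ^ (2 * n) = 1] (mod q)" using ord by simp
    then have "q dvd (\<nu> ^ n - 1) * (\<nu> ^ n + 1)"
      unfolding mult_2 power_add by (simp add: cong_iff_dvd_diff algebra_simps)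
    moreover have "\<not> q dvd \<nu> ^ n - 1"
      using ord[of n] n by (auto simp: cong_iff_dvd_diff dest: dvd_imp_le)
    ultimately show ?thesis using q by (simp add: cong_iff_dvd_diff prime_dvd_mult_iff)
  qed
  have nn': "[\<nu>' ^ n = - 1] (mod q)"
  proof -
    have "[\<nu> ^ n * \<nu>' ^ n = 1] (mod q)"
      using cong_pow[OF inv, of n] by (simp add: power_mult_distrib)
    moreover have "[\<nu> ^ n * \<nu>' ^ n = - 1 * \<nu>' ^ n] (mod q)" using nn by (intro cong_mult) auto
    ultimately have "[- 1 * \<nu>' ^ n = 1] (mod q)" using cong_sym cong_trans by blast
    then have "[- 1 * (- 1 * \<nu>' ^ n) = - 1 * 1] (mod q)" by (intro cong_mult) auto
    then show ?thesis by simp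
  qed
  have half: "[x n = - x 0] (mod q)"
    if rec: "\<And>j. [x (Suc (Suc j)) = (\<nu> + \<nu>') * x (Suc j) - x j] (mod q)" for x
  proof -
    have 1: "[x (Suc n) - \<nu>' * x n = \<nu> ^ n * (x 1 - \<nu>' * x 0)] (mod q)"
      by (rule linear_recurrence_split[where x = x and \<nu> = \<nu> and \<nu>' = \<nu>', OF rec inv])
    have 2: "[x (Suc n) - \<nu> * x n = \<nu>' ^ n * (x 1 - \<nu> * x 0)] (mod q)"
      using rec inv
      by (intro linear_recurrence_split[where x = x and \<nu> = \<nu>' and \<nu>' = \<nu>]) (simp_all add: add.commute mult.commute)
    have "[\<nu> ^ n * (x 1 - \<nu>' * x 0) - \<nu>' ^ n * (x 1 - \<nu> * x 0) =
        - 1 * (x 1 - \<nu>' * x 0) - - 1 * (x 1 - \<nu> * x 0)] (mod q)"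
      by (intro cong_diff cong_mult nn nn') auto
    with cong_diff[OF 1 2] have "[(x (Suc n) - \<nu>' * x n) - (x (Suc n) - \<nu> * x n) =
        - 1 * (x 1 - \<nu>' * x 0) - - 1 * (x 1 - \<nu> * x 0)] (mod q)" by (rule cong_trans)
    then have "q dvd (\<nu> - \<nu>') * (x n + x 0)" by (simp add: cong_iff_dvd_diff algebra_simps)
    moreover have "\<not> q dvd \<nu> - \<nu>'" using nu by (simp add: cong_iff_dvd_diff)
    ultimately show ?thesis using q by (simp add: cong_iff_dvd_diff prime_dvd_mult_iff)
  qed
  have Tpl: "(?T ^^ j) v \<in> plane q" if "v \<in> plane q" for v j
    using that mat_act_plane[OF q0] by (cases j) auto
  have Tn: "(?T ^^ n) v = neg_mod q v" if v: "v \<in> plane q" for v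
  proof -
    have "[X v n = - X v 0] (mod q)" "[Y v n = - Y v 0] (mod q)" by (intro half rec)+
    moreover have "0 \<le> X v n" "X v n < q" "0 \<le> Y v n" "Y v n < q"
      using Tpl[OF v, of n] by (auto simp: XY plane_def)
    ultimately have "X v n = (- X v 0) mod q" "Y v n = (- Y v 0) mod q"
      by (simp_all add: cong_def)
    moreover have "v = (X v 0, Y v 0)" by (simp add: X_def Y_def)
    ultimately show ?thesis unfolding XY by (metis (no_types, lifting) neg_mod_def case_prod_conv)
  qed
  have Bij: "sign_perm q A \<in> carrier ?Q" using q0 A by (intro sign_perm_Bij) auto
  have pow: "(sign_perm q A [^]\<^bsub>?Q\<^esub> j) {v, neg_mod q v} = {(?T ^^ j) v, neg_mod q ((?T ^^ j) v)}"
    if v: "v \<in> plane q" for v j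
  proof -
    have "(sign_perm q A ^^ j) {v, neg_mod q v} = {(?T ^^ j) v, neg_mod q ((?T ^^ j) v)}"
      by (induction j) (simp_all add: sign_perm_apply[OF Tpl[OF v]])
    moreover have "{v, neg_mod q v} \<in> signed_points q" using v by (auto simp: signed_points_def)
    ultimately show ?thesis using BijGroup_pow_apply[OF Bij] by metis
  qed
  have one: "\<one>\<^bsub>?Q\<^esub> S = S" if "S \<in> signed_points q" for S using that by (simp add: BijGroup_def)
  have "sign_perm q A [^]\<^bsub>?Q\<^esub> n = \<one>\<^bsub>?Q\<^esub>"
  proof (rule BijGroup_eqI)
    fix S assume S: "S \<in> signed_points q"
    then obtain v where v: "v \<in> plane q" "S = {v, neg_mod q v}" by (auto simp: signed_points_def)
    then show "(sign_perm q A [^]\<^bsub>?Q\<^esub> n) S = \<one>\<^bsub>?Q\<^esub> S"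
      using S by (simp add: pow one Tn neg_neg insert_commute)
  qed (use Bij in auto)
  then have "sign_perm q A [^]\<^bsub>?Q\<^esub> j = \<one>\<^bsub>?Q\<^esub>" if "n dvd j"
    using that Q.nat_pow_pow[OF Bij, of n] by (auto simp: dvd_def Q.nat_pow_one)
  moreover have "n dvd j" if j: "sign_perm q A [^]\<^bsub>?Q\<^esub> j = \<one>\<^bsub>?Q\<^esub>"
  proof -
    have pm: "(?T ^^ j) v = v \<or> (?T ^^ j) v = neg_mod q v" if v: "v \<in> plane q" for v
    proof -
      have "{v, neg_mod q v} \<in> signed_points q" using v by (auto simp: signed_points_def)
      then have "{(?T ^^ j) v, neg_mod q ((?T ^^ j) v)} = {v, neg_mod q v}"
        using pow[OF v, of j] one j by simp
      then show ?thesis by blast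
    qed
    have key: "n dvd j" if w: "\<not> [x 1 - \<nu>' * x 0 = 0] (mod q)"
      and rec: "\<And>j. [x (Suc (Suc j)) = (\<nu> + \<nu>') * x (Suc j) - x j] (mod q)"
      and s: "[x j = s * x 0] (mod q)" "[x (Suc j) = s * x 1] (mod q)" "s = 1 \<or> s = - 1" for x s
    proof -
      have "[x (Suc j) - \<nu>' * x j = s * x 1 - \<nu>' * (s * x 0)] (mod q)"
        using s by (intro cong_diff cong_mult) auto
      moreover have "[x (Suc j) - \<nu>' * x j = \<nu> ^ j * (x 1 - \<nu>' * x 0)] (mod q)"
        by (rule linear_recurrence_split[where x = x and \<nu> = \<nu> and \<nu>' = \<nu>', OF rec inv])
      ultimately have "[\<nu> ^ j * (x 1 - \<nu>' * x 0) = s * x 1 - \<nu>' * (s * x 0)] (mod q)"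
        using cong_sym cong_trans by blast
      then have "q dvd (\<nu> ^ j - s) * (x 1 - \<nu>' * x 0)"
        by (simp add: cong_iff_dvd_diff algebra_simps)
      then have "[\<nu> ^ j = s] (mod q)"
        using w q by (simp add: cong_iff_dvd_diff prime_dvd_mult_iff)
      then have "[(\<nu> ^ j) ^ 2 = s ^ 2] (mod q)" by (rule cong_pow)
      moreover have "s ^ 2 = 1" using s(3) by auto
      ultimately have "[\<nu> ^ (2 * j) = 1] (mod q)" by (simp add: power_mult mult.commute flip: power_mult)
      then have "2 * n dvd 2 * j" by (simp only: ord)
      then show ?thesis by simp
    qed
    have "q > 1" using q prime_gt_1_int by blast
    have nz: "\<exists>v\<in>plane q. \<not> [X v 1 - \<nu>' * X v 0 = 0] (mod q) \<or> \<not> [Y v 1 - \<nu>' * Y v 0 = 0] (mod q)"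
    proof (rule ccontr)
      assume "\<not> ?thesis"
      then have *: "[X v 1 - \<nu>' * X v 0 = 0] (mod q)" "[Y v 1 - \<nu>' * Y v 0 = 0] (mod q)" if "v \<in> plane q" for v
        using that by auto
      have "[a - \<nu>' = 0] (mod q)" "[d - \<nu>' = 0] (mod q)"
        using *(1)[of "(1, 0)"] *(2)[of "(0, 1)"] \<open>q > 1\<close>
        by (auto simp: plane_def X_def Y_def A mat_act_def cong_def mod_simps)
      then have "[(a - \<nu>') + (d - \<nu>') = 0 + 0] (mod q)" by (rule cong_add)
      then have "q dvd a + d - 2 * \<nu>'" by (simp add: cong_iff_dvd_diff algebra_simps)
      moreover have "q dvd (a + d) - (\<nu> + \<nu>')" using trace by (simp add: cong_iff_dvd_diff)
      ultimately have "q dvd (a + d - 2 * \<nu>') - ((a + d) - (\<nu> + \<nu>'))" by (rule dvd_diff)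
      then show False using nu by (simp add: cong_iff_dvd_diff algebra_simps)
    qed
    then obtain v where v: "v \<in> plane q"
      "\<not> [X v 1 - \<nu>' * X v 0 = 0] (mod q) \<or> \<not> [Y v 1 - \<nu>' * Y v 0 = 0] (mod q)" by blast
    obtain s where s: "s = 1 \<or> s = - 1" "[X v j = s * X v 0] (mod q)" "[Y v j = s * Y v 0] (mod q)"
      "[X v (Suc j) = s * X v 1] (mod q)" "[Y v (Suc j) = s * Y v 1] (mod q)"
    proof (cases "(?T ^^ j) v = v")
      case True
      then have "X v j = 1 * X v 0" "Y v j = 1 * Y v 0" "X v (Suc j) = 1 * X v 1" "Y v (Suc j) = 1 * Y v 1"
        by (simp_all add: X_def Y_def)
      then show ?thesis using that[of 1] by simp
    next
      case False
      then have eq: "(?T ^^ j) v = neg_mod q v" using pm[OF v(1)] by blast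
      then have "(?T ^^ Suc j) v = neg_mod q (?T v)" by (simp add: mat_act_neg)
      then have "[X v j = (- 1) * X v 0] (mod q)" "[Y v j = (- 1) * Y v 0] (mod q)"
        "[X v (Suc j) = (- 1) * X v 1] (mod q)" "[Y v (Suc j) = (- 1) * Y v 1] (mod q)"
        using eq by (simp_all add: X_def Y_def neg_mod_def case_prod_beta cong_def)
      then show ?thesis using that[of "- 1"] by blast
    qed
    from v(2) show ?thesis
      using key[of "X v", OF _ rec(1) s(2,4,1)] key[of "Y v", OF _ rec(2) s(3,5,1)] by blast
  qed
  ultimately show ?thesis by blast
qed

text \<open>A triangular matrix \<open>A\<close> with diagonal \<open>\<alpha>, \<alpha>'\<close> and an opposite triangular matrix \<open>B\<close> with diagonal
\<open>\<beta>, \<beta>'\<close> have one parameter \<open>t\<close> left, which adjusts the trace of \<open>A B\<close>. In \<open>PSL\<^sub>2\<close> the order of an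
element can be prescribed by its trace.\<close>

lemma finite_triangle_quotient:
  assumes "l \<ge> 2" "m \<ge> 2" "n \<ge> 2"
  shows "\<exists>(Q :: ((int \<times> int) set \<Rightarrow> (int \<times> int) set) monoid) a b c. group Q \<and> finite (carrier Q) \<and>
    a \<in> carrier Q \<and> b \<in> carrier Q \<and> c \<in> carrier Q \<and> a \<otimes>\<^bsub>Q\<^esub> (b \<otimes>\<^bsub>Q\<^esub> c) = \<one>\<^bsub>Q\<^esub> \<and>
    (\<forall>j::nat. a [^]\<^bsub>Q\<^esub> j = \<one>\<^bsub>Q\<^esub> \<longleftrightarrow> l dvd j) \<and> (\<forall>j::nat. b [^]\<^bsub>Q\<^esub> j = \<one>\<^bsub>Q\<^esub> \<longleftrightarrow> m dvd j) \<and>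
    (\<forall>j::nat. c [^]\<^bsub>Q\<^esub> j = \<one>\<^bsub>Q\<^esub> \<longleftrightarrow> n dvd j)"
proof -
  obtain p z :: nat where p: "prime p" "ord p z = 2 * (l * m * n)"
    using exists_prime_ord[of "2 * (l * m * n)"] assms by auto
  define q where "q = int p"
  have q: "prime q" using p by (simp add: q_def)
  have z: "[int z ^ j = 1] (mod q) \<longleftrightarrow> 2 * (l * m * n) dvd j" for j
    using cong_int_iff[of "z ^ j" 1 p] ord_divides[of z j p] p by (simp add: q_def)
  have root: "\<exists>\<nu> \<nu>'. [\<nu> * \<nu>' = 1] (mod q) \<and> (\<forall>j. [\<nu> ^ j = 1] (mod q) \<longleftrightarrow> 2 * k dvd j)"
    if "k * k' = l * m * n" for k k'
  proof -
    have pos: "k > 0" "k' > 0" using that assms by (auto intro!: Nat.gr0I)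
    have iff: "[(int z ^ k') ^ j = 1] (mod q) \<longleftrightarrow> 2 * k dvd j" for j
    proof -
      have "[(int z ^ k') ^ j = 1] (mod q) \<longleftrightarrow> (2 * k) * k' dvd j * k'"
      proof -
        have "2 * (l * m * n) dvd k' * j \<longleftrightarrow> (2 * k) * k' dvd j * k'"
          using that by (simp add: mult.commute[of k' j] mult.assoc)
        then show ?thesis using z[of "k' * j"] by (simp only: power_mult)
      qed
      also have "\<dots> \<longleftrightarrow> 2 * k dvd j" using pos by simp
      finally show ?thesis .
    qed
    moreover have "[int z ^ k' * (int z ^ k') ^ (2 * k - 1) = 1] (mod q)"
      using iff[of "2 * k"] pos by (simp flip: power_Suc)
    ultimately show ?thesis by blast
  qed
  obtain \<alpha> \<alpha>' where \<alpha>: "[\<alpha> * \<alpha>' = 1] (mod q)" "\<And>j. [\<alpha> ^ j = 1] (mod q) \<longleftrightarrow> 2 * l dvd j"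
    using root[of l "m * n"] by (auto simp: ac_simps)
  obtain \<beta> \<beta>' where \<beta>: "[\<beta> * \<beta>' = 1] (mod q)" "\<And>j. [\<beta> ^ j = 1] (mod q) \<longleftrightarrow> 2 * m dvd j"
    using root[of m "l * n"] by (auto simp: ac_simps)
  obtain \<gamma> \<gamma>' where \<gamma>: "[\<gamma> * \<gamma>' = 1] (mod q)" "\<And>j. [\<gamma> ^ j = 1] (mod q) \<longleftrightarrow> 2 * n dvd j"
    using root[of n "l * m"] by (auto simp: ac_simps)
  \<comment> \<open>the trace of \<open>A B\<close> is \<open>\<alpha> \<beta> + t + \<alpha>' \<beta>'\<close>, which has to be \<open>\<gamma> + \<gamma>'\<close>\<close>
  define t where "t = \<gamma> + \<gamma>' - \<alpha> * \<beta> - \<alpha>' * \<beta>'"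
  define A where "A = (\<alpha>, 1 :: int, 0 :: int, \<alpha>')"
  define B where "B = (\<beta>, 0 :: int, t, \<beta>')"
  have AB: "mat_mult A B = (\<alpha> * \<beta> + t, \<beta>', \<alpha>' * t, \<alpha>' * \<beta>')"
    by (simp add: A_def B_def mat_mult_def)
  have un: "unimodular q A" "unimodular q B"
    using \<alpha>(1) \<beta>(1) by (auto simp: unimodular_def A_def B_def)
  then have unAB: "unimodular q (mat_mult A B)" by (rule unimodular_mult)
  let ?Q = "BijGroup (signed_points q)"
  interpret Q: group ?Q by (rule group_BijGroup)
  have q0: "q > 0" using q by (simp add: prime_gt_0_int)
  have car: "sign_perm q A \<in> carrier ?Q" "sign_perm q B \<in> carrier ?Q"
    "sign_perm q (mat_mult A B) \<in> carrier ?Q"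
    using un unAB q0 by (auto intro: sign_perm_Bij)
  define C where "C = inv\<^bsub>?Q\<^esub> sign_perm q (mat_mult A B)"
  have C: "C \<in> carrier ?Q" using car by (simp add: C_def)
  have "sign_perm q A \<otimes>\<^bsub>?Q\<^esub> sign_perm q B = sign_perm q (mat_mult A B)"
    using car q0 by (intro BijGroup_eqI[where S = "signed_points q"]) (auto simp: BijGroup_mult_apply sign_perm_mult)
  then have prod: "sign_perm q A \<otimes>\<^bsub>?Q\<^esub> (sign_perm q B \<otimes>\<^bsub>?Q\<^esub> C) = \<one>\<^bsub>?Q\<^esub>"
    using car C by (simp add: C_def flip: Q.m_assoc)
  have ordA: "sign_perm q A [^]\<^bsub>?Q\<^esub> j = \<one>\<^bsub>?Q\<^esub> \<longleftrightarrow> l dvd j" for j :: nat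
    using \<alpha> assms un by (intro sign_perm_pow_eq_one_iff[OF q A_def]) auto
  have ordB: "sign_perm q B [^]\<^bsub>?Q\<^esub> j = \<one>\<^bsub>?Q\<^esub> \<longleftrightarrow> m dvd j" for j :: nat
    using \<beta> assms un by (intro sign_perm_pow_eq_one_iff[OF q B_def]) auto
  have ordAB: "sign_perm q (mat_mult A B) [^]\<^bsub>?Q\<^esub> j = \<one>\<^bsub>?Q\<^esub> \<longleftrightarrow> n dvd j" for j :: nat
    using \<gamma> assms unAB by (intro sign_perm_pow_eq_one_iff[OF q AB]) (auto simp: t_def)
  have ordC: "C [^]\<^bsub>?Q\<^esub> j = \<one>\<^bsub>?Q\<^esub> \<longleftrightarrow> n dvd j" for j :: nat
  proof -
    have "C [^]\<^bsub>?Q\<^esub> j = inv\<^bsub>?Q\<^esub> (sign_perm q (mat_mult A B) [^]\<^bsub>?Q\<^esub> j)"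
      using car by (simp add: C_def Q.nat_pow_inv)
    then show ?thesis using car ordAB[of j] by (metis Q.inv_eq_1_iff Q.nat_pow_closed)
  qed
  have "finite (carrier ?Q)"
    by (intro finite_BijGroup) (auto simp: signed_points_def plane_def)
  then show ?thesis
    using car C prod ordA ordB ordC group_BijGroup
    by (intro exI[of _ ?Q] exI[of _ "sign_perm q A"] exI[of _ "sign_perm q B"] exI[of _ C]) simp
qed

text \<open>Rotations and reflections of \<open>\<int>/2m\<close>. The rotation by two has order \<open>m\<close>; it is a square, and up to
inversion a commutator, so it can be the image of one \<open>x_i\<close> both for oriented and non-oriented
presentations.\<close>

lemma finite_dihedral_quotient:
  assumes "m \<ge> 1"
  shows "\<exists>(Q :: (int \<Rightarrow> int) monoid) r f. group Q \<and> finite (carrier Q) \<and> r \<in> carrier Q \<and> f \<in> carrier Q \<and>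
    inv\<^bsub>Q\<^esub> f \<otimes>\<^bsub>Q\<^esub> (r \<otimes>\<^bsub>Q\<^esub> f) = inv\<^bsub>Q\<^esub> r \<and>
    (\<forall>j::nat. (r \<otimes>\<^bsub>Q\<^esub> r) [^]\<^bsub>Q\<^esub> j = \<one>\<^bsub>Q\<^esub> \<longleftrightarrow> m dvd j)"
proof -
  define n where "n = 2 * int m"
  have n: "n > 0" using assms by (simp add: n_def)
  define S where "S = {0..<n}"
  let ?Q = "BijGroup S"
  interpret Q: group ?Q by (rule group_BijGroup)
  define r where "r = (\<lambda>i\<in>S. (i + 1) mod n)"
  define f where "f = (\<lambda>i\<in>S. (- i) mod n)"
  have S: "i mod n \<in> S" for i using n by (simp add: S_def)
  have mod: "i mod n = i" if "i \<in> S" for i using that by (simp add: S_def)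
  have "bij_betw r S S"
    by (rule bij_betw_byWitness[of _ "\<lambda>i. (i - 1) mod n"])
      (auto simp: r_def S mod mod_diff_left_eq mod_add_left_eq)
  then have r: "r \<in> carrier ?Q" by (auto simp: r_def BijGroup_def Bij_def)
  have "bij_betw f S S"
    by (rule bij_betw_byWitness[of _ f]) (auto simp: f_def S mod mod_minus_eq)
  then have f: "f \<in> carrier ?Q" by (auto simp: f_def BijGroup_def Bij_def)
  have "r \<otimes>\<^bsub>?Q\<^esub> (f \<otimes>\<^bsub>?Q\<^esub> r) = f"
  proof (rule BijGroup_eqI)
    fix i assume i: "i \<in> S"
    have "(- ((i + 1) mod n) + 1) mod n = (- (i + 1) + 1) mod n"
      by (metis mod_add_left_eq mod_minus_eq)
    then show "(r \<otimes>\<^bsub>?Q\<^esub> (f \<otimes>\<^bsub>?Q\<^esub> r)) i = f i"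
      using i r f BijGroup_closed[OF r i]
      by (simp add: BijGroup_mult_apply) (simp add: r_def f_def S mod_add_left_eq)
  qed (use r f in auto)
  then have "r \<otimes>\<^bsub>?Q\<^esub> f \<otimes>\<^bsub>?Q\<^esub> r = f" using r f by (simp add: Q.m_assoc)
  then have "r \<otimes>\<^bsub>?Q\<^esub> f = f \<otimes>\<^bsub>?Q\<^esub> inv\<^bsub>?Q\<^esub> r"
    using r f by (metis Q.inv_solve_right' Q.m_closed)
  then have conj: "inv\<^bsub>?Q\<^esub> f \<otimes>\<^bsub>?Q\<^esub> (r \<otimes>\<^bsub>?Q\<^esub> f) = inv\<^bsub>?Q\<^esub> r"
    using r f by (simp add: Q.mult_inv_cancel)
  have pow: "(r [^]\<^bsub>?Q\<^esub> j) i = (i + int j) mod n" if i: "i \<in> S" for i j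
  proof -
    have "(r ^^ j) i = (i + int j) mod n"
    proof (induction j)
      case (Suc j)
      then show ?case using S by (simp add: r_def mod_add_left_eq mod_add_right_eq ac_simps)
    qed (simp add: mod i)
    then show ?thesis using BijGroup_pow_apply[OF r i] by simp
  qed
  have one: "\<one>\<^bsub>?Q\<^esub> i = i" if "i \<in> S" for i using that by (simp add: BijGroup_def)
  have "(r \<otimes>\<^bsub>?Q\<^esub> r) [^]\<^bsub>?Q\<^esub> j = \<one>\<^bsub>?Q\<^esub> \<longleftrightarrow> m dvd j" for j :: nat
  proof -
    have "r \<otimes>\<^bsub>?Q\<^esub> r = r [^]\<^bsub>?Q\<^esub> (2::nat)"
      using r by (simp add: numeral_2_eq_2)
    then have eq: "(r \<otimes>\<^bsub>?Q\<^esub> r) [^]\<^bsub>?Q\<^esub> j = r [^]\<^bsub>?Q\<^esub> (2 * j)"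
      using r by (simp add: Q.nat_pow_pow)
    show ?thesis
    proof
      assume "(r \<otimes>\<^bsub>?Q\<^esub> r) [^]\<^bsub>?Q\<^esub> j = \<one>\<^bsub>?Q\<^esub>"
      then have "(0 + int (2 * j)) mod n = 0"
        using pow[of 0 "2 * j"] one[of 0] n eq by (simp add: S_def)
      then have "int (2 * m) dvd int (2 * j)" by (simp add: n_def mod_eq_0_iff_dvd)
      then show "m dvd j" by (simp only: int_dvd_int_iff) simp
    next
      assume "m dvd j"
      then obtain k where k: "j = m * k" by auto
      have "r [^]\<^bsub>?Q\<^esub> (2 * j) = \<one>\<^bsub>?Q\<^esub>"
      proof (rule BijGroup_eqI)
        fix i assume i: "i \<in> S"
        have "i + int (2 * j) = i + n * int k" by (simp add: k n_def)
        then show "(r [^]\<^bsub>?Q\<^esub> (2 * j)) i = \<one>\<^bsub>?Q\<^esub> i"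
          unfolding pow[OF i] one[OF i] by (simp only: mod_mult_self2 mod[OF i])
      qed (use r in auto)
      then show "(r \<otimes>\<^bsub>?Q\<^esub> r) [^]\<^bsub>?Q\<^esub> j = \<one>\<^bsub>?Q\<^esub>" by (simp add: eq)
    qed
  qed
  moreover have "finite (carrier ?Q)" by (intro finite_BijGroup) (simp add: S_def)
  ultimately show ?thesis using r f conj group_BijGroup by blast
qed

section \<open>Fuchsian presentations\<close>

lemma words_UNIV [simp]: "w \<in> words UNIV"
  by (auto simp: words_def)

lemma (in group) word_val_append_UNIV:
  "(\<And>x. \<phi> x \<in> carrier G) \<Longrightarrow> word_val G \<phi> (u @ w) = word_val G \<phi> u \<otimes> word_val G \<phi> w"
  by (rule word_val_append[where X = UNIV]) auto

lemma (in group) word_val_trivial: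
  "(\<And>x b. (x, b) \<in> set w \<Longrightarrow> \<phi> x = \<one>) \<Longrightarrow> word_val G \<phi> w = \<one>"
proof (induction w)
  case (Cons l w)
  obtain x b where l: "l = (x, b)" by (cases l)
  have "\<phi> x = \<one>" using Cons.prems[of x b] l by simp
  moreover have "word_val G \<phi> w = \<one>" using Cons by auto
  ultimately show ?case by (simp add: l)
qed simp

lemma (in group) word_val_single:
  assumes "distinct L" "i \<in> set L" "\<phi> (c i) = a" "a \<in> carrier G"
    "\<And>j. j \<in> set L \<Longrightarrow> j \<noteq> i \<Longrightarrow> \<phi> (c j) = \<one>"
  shows "word_val G \<phi> (map (\<lambda>j. (c j, True)) L) = a"
  using assms(1,2,5)
proof (induction L)
  case (Cons k L)
  show ?case
  proof (cases "k = i")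
    case True
    have "word_val G \<phi> (map (\<lambda>j. (c j, True)) L) = \<one>"
      using Cons.prems True by (intro word_val_trivial) auto
    then show ?thesis using True assms(3,4) by simp
  next
    case False
    then have "word_val G \<phi> (map (\<lambda>j. (c j, True)) L) = a"
      using Cons by auto
    then show ?thesis using Cons.prems False assms(4) by simp
  qed
qed simp

lemma (in group) word_val_replicate:
  "\<phi> x \<in> carrier G \<Longrightarrow> word_val G \<phi> (replicate n (x, True)) = \<phi> x [^] n"
proof (induction n)
  case (Suc n)
  then show ?case using nat_pow_Suc2[of "\<phi> x" n] by simp
qed simp

lemma exact_order_if_quotient:
  assumes G: "group G" "presents G X R \<gamma>" and Q: "group Q" "finite (carrier Q)"
    and \<phi>: "\<And>x. \<phi> x \<in> carrier Q" and rel: "\<And>r. r \<in> R \<Longrightarrow> word_val Q \<phi> r = \<one>\<^bsub>Q\<^esub>"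
    and x: "x \<in> X" "\<And>j::nat. \<phi> x [^]\<^bsub>Q\<^esub> j = \<one>\<^bsub>Q\<^esub> \<Longrightarrow> n dvd j"
  shows "\<exists>N\<in>finite_index_normal G. \<forall>j::nat. \<gamma> x [^]\<^bsub>G\<^esub> j \<in> N \<longrightarrow> n dvd j"
proof -
  obtain \<psi> where \<psi>: "\<psi> \<in> hom G Q" "\<And>x. x \<in> X \<Longrightarrow> \<psi> (\<gamma> x) = \<phi> x"
    using presents_universal[OF G Q(1), of \<phi>] \<phi> rel by auto
  interpret group_hom G Q \<psi>
    using G(1) Q(1) \<psi>(1) by (simp add: group_hom_def group_hom_axioms_def)
  have "\<gamma> x \<in> carrier G" using G(2) x(1) by (auto simp: presents_def)
  then have "n dvd j" if "\<gamma> x [^]\<^bsub>G\<^esub> (j::nat) \<in> kernel G Q \<psi>" for j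
    using that x \<psi>(2)[OF x(1)] by (auto simp: kernel_def hom_nat_pow)
  then show ?thesis
    using group.finite_index_normal_kernel[OF G(1) Q \<psi>(1)] by blast
qed

abbreviation oriented_relator :: "nat \<Rightarrow> nat \<Rightarrow> nat \<Rightarrow> nat \<Rightarrow> fuchsian_gen word" where
  "oriented_relator g d s t \<equiv>
     xyz_word d s t @ concat (map (\<lambda>i. commutator_word (GenA i) (GenB i)) [1..<Suc g])"

abbreviation non_oriented_relator :: "nat \<Rightarrow> nat \<Rightarrow> nat \<Rightarrow> nat \<Rightarrow> fuchsian_gen word" where
  "non_oriented_relator g d s t \<equiv>
     xyz_word d s t @ concat (map (\<lambda>i. replicate 2 (GenA i, True)) [1..<Suc g])"

lemma (in group) word_val_torsion_relator:
  assumes "r \<in> torsion_relators d m" "\<And>x. \<phi> x \<in> carrier G" "\<And>i. i \<in> {1..d} \<Longrightarrow> \<phi> (GenX i) [^] m i = \<one>"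
  shows "word_val G \<phi> r = \<one>"
  using assms by (auto simp: torsion_relators_def word_val_replicate)

lemma (in group) word_val_xyz:
  assumes "\<And>x. \<phi> x \<in> carrier G"
  shows "word_val G \<phi> (xyz_word d s t) =
    word_val G \<phi> (map (\<lambda>i. (GenX i, True)) [1..<Suc d]) \<otimes>
    (word_val G \<phi> (map (\<lambda>i. (GenY i, True)) [1..<Suc s]) \<otimes>
     word_val G \<phi> (map (\<lambda>i. (GenZ i, True)) [1..<Suc t]))"
  unfolding xyz_word_def using assms by (simp only: word_val_append_UNIV)

lemma one_upt_Suc: "1 \<le> g \<Longrightarrow> [Suc 0..<Suc g] = Suc 0 # [2..<Suc g]"
  by (simp add: upt_conv_Cons numeral_2_eq_2)

text \<open>The relator is satisfied by letting a single handle or boundary generator absorb the image of \<open>x_i\<close>.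
Without those, positivity of the measure requires \<open>d \<ge> 3\<close>, and \<open>x_i\<close> together with two others is mapped
to a triangle quotient.\<close>

lemma oriented_exact_order:
  assumes G: "group G" "presents G X (insert (oriented_relator g d s t) (torsion_relators d m)) \<gamma>"
    and m: "\<forall>i\<in>{1..d}. 2 \<le> m i" and pos: "0 < fuchsian_measure (2 * g) d s t m"
    and i: "i \<in> {1..d}" "GenX i \<in> X"
  shows "\<exists>N\<in>finite_index_normal G. \<forall>j::nat. \<gamma> (GenX i) [^]\<^bsub>G\<^esub> j \<in> N \<longrightarrow> m i dvd j"
proof (cases "g \<ge> 1 \<or> s \<ge> 1 \<or> t \<ge> 1")
  case True
  obtain Q :: "(int \<Rightarrow> int) monoid" and r f where Q: "group Q" "finite (carrier Q)" "r \<in> carrier Q" "f \<in> carrier Q"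
    "inv\<^bsub>Q\<^esub> f \<otimes>\<^bsub>Q\<^esub> (r \<otimes>\<^bsub>Q\<^esub> f) = inv\<^bsub>Q\<^esub> r"
    "\<And>j::nat. (r \<otimes>\<^bsub>Q\<^esub> r) [^]\<^bsub>Q\<^esub> j = \<one>\<^bsub>Q\<^esub> \<longleftrightarrow> m i dvd j"
    using finite_dihedral_quotient[of "m i"] m i by force
  interpret Q: group Q by fact
  define \<phi> where "\<phi> x = (case x of
      GenX j \<Rightarrow> if j = i then r \<otimes>\<^bsub>Q\<^esub> r else \<one>\<^bsub>Q\<^esub>
    | GenY j \<Rightarrow> if j = 1 \<and> g = 0 then inv\<^bsub>Q\<^esub> (r \<otimes>\<^bsub>Q\<^esub> r) else \<one>\<^bsub>Q\<^esub>
    | GenZ j \<Rightarrow> if j = 1 \<and> g = 0 \<and> s = 0 then inv\<^bsub>Q\<^esub> (r \<otimes>\<^bsub>Q\<^esub> r) else \<one>\<^bsub>Q\<^esub>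
    | GenA j \<Rightarrow> if j = 1 then r else \<one>\<^bsub>Q\<^esub>
    | GenB j \<Rightarrow> if j = 1 then f else \<one>\<^bsub>Q\<^esub>)" for x
  have \<phi>: "\<phi> x \<in> carrier Q" for x
    using Q by (cases x) (auto simp: \<phi>_def)
  have vX: "word_val Q \<phi> (map (\<lambda>i. (GenX i, True)) [1..<Suc d]) = r \<otimes>\<^bsub>Q\<^esub> r"
    using i Q by (intro Q.word_val_single[of _ i]) (auto simp: \<phi>_def)
  have vY: "word_val Q \<phi> (map (\<lambda>i. (GenY i, True)) [1..<Suc s]) =
      (if s \<ge> 1 \<and> g = 0 then inv\<^bsub>Q\<^esub> (r \<otimes>\<^bsub>Q\<^esub> r) else \<one>\<^bsub>Q\<^esub>)"
  proof (cases "s \<ge> 1 \<and> g = 0")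
    case True
    then have "word_val Q \<phi> (map (\<lambda>i. (GenY i, True)) [1..<Suc s]) = inv\<^bsub>Q\<^esub> (r \<otimes>\<^bsub>Q\<^esub> r)"
      using Q by (intro Q.word_val_single[of _ 1]) (auto simp: \<phi>_def)
    then show ?thesis using True by (simp only: if_True simp_thms)
  next
    case False
    then have "word_val Q \<phi> (map (\<lambda>i. (GenY i, True)) [1..<Suc s]) = \<one>\<^bsub>Q\<^esub>"
      by (intro Q.word_val_trivial) (auto simp: \<phi>_def)
    then show ?thesis using False by (simp only: if_False)
  qed
  have vZ: "word_val Q \<phi> (map (\<lambda>i. (GenZ i, True)) [1..<Suc t]) =
      (if t \<ge> 1 \<and> g = 0 \<and> s = 0 then inv\<^bsub>Q\<^esub> (r \<otimes>\<^bsub>Q\<^esub> r) else \<one>\<^bsub>Q\<^esub>)"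
  proof (cases "t \<ge> 1 \<and> g = 0 \<and> s = 0")
    case True
    then have "word_val Q \<phi> (map (\<lambda>i. (GenZ i, True)) [1..<Suc t]) = inv\<^bsub>Q\<^esub> (r \<otimes>\<^bsub>Q\<^esub> r)"
      using Q by (intro Q.word_val_single[of _ 1]) (auto simp: \<phi>_def)
    then show ?thesis using True by (simp only: if_True simp_thms)
  next
    case False
    then have "word_val Q \<phi> (map (\<lambda>i. (GenZ i, True)) [1..<Suc t]) = \<one>\<^bsub>Q\<^esub>"
      by (intro Q.word_val_trivial) (auto simp: \<phi>_def)
    then show ?thesis using False by (simp only: if_False)
  qed
  have vC: "word_val Q \<phi> (concat (map (\<lambda>i. commutator_word (GenA i) (GenB i)) [1..<Suc g])) =
      (if g \<ge> 1 then inv\<^bsub>Q\<^esub> (r \<otimes>\<^bsub>Q\<^esub> r) else \<one>\<^bsub>Q\<^esub>)"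
  proof (cases "g \<ge> 1")
    case True
    have "word_val Q \<phi> (concat (map (\<lambda>i. commutator_word (GenA i) (GenB i)) [2..<Suc g])) = \<one>\<^bsub>Q\<^esub>"
      by (intro Q.word_val_trivial) (auto simp: commutator_word_def \<phi>_def)
    moreover have "word_val Q \<phi> (commutator_word (GenA 1) (GenB 1)) = inv\<^bsub>Q\<^esub> r \<otimes>\<^bsub>Q\<^esub> inv\<^bsub>Q\<^esub> r"
      using Q by (simp add: commutator_word_def \<phi>_def)
    ultimately show ?thesis
      using True Q by (simp add: one_upt_Suc Q.word_val_append_UNIV[OF \<phi>] Q.inv_mult_group del: upt_Suc)
  qed simp
  have long: "word_val Q \<phi> (oriented_relator g d s t) = \<one>\<^bsub>Q\<^esub>"
    unfolding Q.word_val_append_UNIV[OF \<phi>] Q.word_val_xyz[OF \<phi>] vX vY vZ vC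
    using True Q(3) by (auto simp: Q.r_inv)
  have torsion: "word_val Q \<phi> r = \<one>\<^bsub>Q\<^esub>" if "r \<in> torsion_relators d m" for r
    by (rule Q.word_val_torsion_relator[OF that \<phi>]) (auto simp: \<phi>_def Q(6))
  show ?thesis
  proof (rule exact_order_if_quotient[where \<phi> = \<phi>, OF G Q(1,2) \<phi>])
    show "word_val Q \<phi> r = \<one>\<^bsub>Q\<^esub>" if "r \<in> insert (oriented_relator g d s t) (torsion_relators d m)" for r
      using that long torsion by blast
    show "GenX i \<in> X" by fact
    show "m i dvd j" if "\<phi> (GenX i) [^]\<^bsub>Q\<^esub> j = \<one>\<^bsub>Q\<^esub>" for j :: nat
      using that Q(6) by (simp add: \<phi>_def)
  qed
next
  case False
  then have 0: "g = 0" "s = 0" "t = 0" by auto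
  have "(\<Sum>i = 1..d. 1 - 1 / real (m i)) \<le> (\<Sum>i = 1..d. 1)"
    by (intro sum_mono) simp
  then have d: "d \<ge> 3" using pos by (simp add: fuchsian_measure_def 0)
  \<comment> \<open>the indices \<open>1 < 2 < k\<close> include \<open>i\<close>, and keep their order in the relator\<close>
  define k where "k = max i 3"
  have k: "k \<in> {3..d}" "i = 1 \<or> i = 2 \<or> i = k" using i d by (auto simp: k_def)
  have "2 \<le> m 1" "2 \<le> m 2" "2 \<le> m k" using m k d by auto
  then obtain Q :: "((int \<times> int) set \<Rightarrow> (int \<times> int) set) monoid" and a b c where Q: "group Q" "finite (carrier Q)"
    "a \<in> carrier Q" "b \<in> carrier Q" "c \<in> carrier Q" "a \<otimes>\<^bsub>Q\<^esub> (b \<otimes>\<^bsub>Q\<^esub> c) = \<one>\<^bsub>Q\<^esub>"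
    and ord: "\<And>j::nat. a [^]\<^bsub>Q\<^esub> j = \<one>\<^bsub>Q\<^esub> \<longleftrightarrow> m 1 dvd j" "\<And>j::nat. b [^]\<^bsub>Q\<^esub> j = \<one>\<^bsub>Q\<^esub> \<longleftrightarrow> m 2 dvd j"
    "\<And>j::nat. c [^]\<^bsub>Q\<^esub> j = \<one>\<^bsub>Q\<^esub> \<longleftrightarrow> m k dvd j"
    using finite_triangle_quotient[of "m 1" "m 2" "m k"] by blast
  interpret Q: group Q by fact
  define \<phi> where "\<phi> x = (case x of
      GenX j \<Rightarrow> if j = 1 then a else if j = 2 then b else if j = k then c else \<one>\<^bsub>Q\<^esub>
    | _ \<Rightarrow> \<one>\<^bsub>Q\<^esub>)" for x
  have \<phi>: "\<phi> x \<in> carrier Q" for x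
    using Q by (cases x) (auto simp: \<phi>_def)
  have "[1..<Suc d] = 1 # 2 # [3..<Suc d]"
    using d by (simp add: upt_conv_Cons numeral_2_eq_2 numeral_3_eq_3)
  moreover have "word_val Q \<phi> (map (\<lambda>i. (GenX i, True)) [3..<Suc d]) = c"
    using k Q by (intro Q.word_val_single[of _ k]) (auto simp: \<phi>_def)
  ultimately have "word_val Q \<phi> (map (\<lambda>i. (GenX i, True)) [1..<Suc d]) = \<one>\<^bsub>Q\<^esub>"
    using Q(6) by (simp add: \<phi>_def del: upt_Suc)
  then have long: "word_val Q \<phi> (oriented_relator g d s t) = \<one>\<^bsub>Q\<^esub>"
    unfolding Q.word_val_append_UNIV[OF \<phi>] Q.word_val_xyz[OF \<phi>] by (simp add: 0 del: upt_Suc)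
  have torsion: "word_val Q \<phi> r = \<one>\<^bsub>Q\<^esub>" if "r \<in> torsion_relators d m" for r
    by (rule Q.word_val_torsion_relator[OF that \<phi>]) (auto simp: \<phi>_def ord)
  show ?thesis
  proof (rule exact_order_if_quotient[where \<phi> = \<phi>, OF G Q(1,2) \<phi>])
    show "word_val Q \<phi> r = \<one>\<^bsub>Q\<^esub>" if "r \<in> insert (oriented_relator g d s t) (torsion_relators d m)" for r
      using that long torsion by blast
    show "GenX i \<in> X" by fact
    show "m i dvd j" if "\<phi> (GenX i) [^]\<^bsub>Q\<^esub> j = \<one>\<^bsub>Q\<^esub>" for j :: nat
      using that k ord by (auto simp: \<phi>_def split: if_splits)
  qed
qed

lemma non_oriented_exact_order:
  assumes G: "group G" "presents G X (insert (non_oriented_relator g d s t) (torsion_relators d m)) \<gamma>"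
    and m: "\<forall>i\<in>{1..d}. 2 \<le> m i" and g: "g \<ge> 1" and i: "i \<in> {1..d}" "GenX i \<in> X"
  shows "\<exists>N\<in>finite_index_normal G. \<forall>j::nat. \<gamma> (GenX i) [^]\<^bsub>G\<^esub> j \<in> N \<longrightarrow> m i dvd j"
proof -
  obtain Q :: "(int \<Rightarrow> int) monoid" and r f where Q: "group Q" "finite (carrier Q)" "r \<in> carrier Q"
    "\<And>j::nat. (r \<otimes>\<^bsub>Q\<^esub> r) [^]\<^bsub>Q\<^esub> j = \<one>\<^bsub>Q\<^esub> \<longleftrightarrow> m i dvd j"
    using finite_dihedral_quotient[of "m i"] m i by force
  interpret Q: group Q by fact
  define \<phi> where "\<phi> x = (case x of
      GenX j \<Rightarrow> if j = i then r \<otimes>\<^bsub>Q\<^esub> r else \<one>\<^bsub>Q\<^esub>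
    | GenA j \<Rightarrow> if j = 1 then inv\<^bsub>Q\<^esub> r else \<one>\<^bsub>Q\<^esub>
    | _ \<Rightarrow> \<one>\<^bsub>Q\<^esub>)" for x
  have \<phi>: "\<phi> x \<in> carrier Q" for x
    using Q by (cases x) (auto simp: \<phi>_def)
  have vX: "word_val Q \<phi> (map (\<lambda>i. (GenX i, True)) [1..<Suc d]) = r \<otimes>\<^bsub>Q\<^esub> r"
    using i Q by (intro Q.word_val_single[of _ i]) (auto simp: \<phi>_def)
  have vYZ: "word_val Q \<phi> (map (\<lambda>i. (GenY i, True)) [1..<Suc s]) = \<one>\<^bsub>Q\<^esub>"
    "word_val Q \<phi> (map (\<lambda>i. (GenZ i, True)) [1..<Suc t]) = \<one>\<^bsub>Q\<^esub>"
    by (intro Q.word_val_trivial; auto simp: \<phi>_def)+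
  have "word_val Q \<phi> (concat (map (\<lambda>i. replicate 2 (GenA i, True)) [2..<Suc g])) = \<one>\<^bsub>Q\<^esub>"
    by (intro Q.word_val_trivial) (auto simp: \<phi>_def)
  moreover have "word_val Q \<phi> (replicate 2 (GenA 1, True)) = inv\<^bsub>Q\<^esub> r \<otimes>\<^bsub>Q\<^esub> inv\<^bsub>Q\<^esub> r"
    using Q by (simp add: \<phi>_def numeral_2_eq_2)
  ultimately have vA: "word_val Q \<phi> (concat (map (\<lambda>i. replicate 2 (GenA i, True)) [1..<Suc g])) =
      inv\<^bsub>Q\<^esub> (r \<otimes>\<^bsub>Q\<^esub> r)"
    using g Q by (simp add: one_upt_Suc Q.word_val_append_UNIV[OF \<phi>] Q.inv_mult_group del: upt_Suc)
  have long: "word_val Q \<phi> (non_oriented_relator g d s t) = \<one>\<^bsub>Q\<^esub>"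
    unfolding Q.word_val_append_UNIV[OF \<phi>] Q.word_val_xyz[OF \<phi>] vX vYZ vA
    using Q(1,3) by (simp add: Q.r_inv)
  have torsion: "word_val Q \<phi> r = \<one>\<^bsub>Q\<^esub>" if "r \<in> torsion_relators d m" for r
    by (rule Q.word_val_torsion_relator[OF that \<phi>]) (auto simp: \<phi>_def Q(4))
  show ?thesis
  proof (rule exact_order_if_quotient[where \<phi> = \<phi>, OF G Q(1,2) \<phi>])
    show "word_val Q \<phi> r = \<one>\<^bsub>Q\<^esub>" if "r \<in> insert (non_oriented_relator g d s t) (torsion_relators d m)" for r
      using that long torsion by blast
    show "GenX i \<in> X" by fact
    show "m i dvd j" if "\<phi> (GenX i) [^]\<^bsub>Q\<^esub> j = \<one>\<^bsub>Q\<^esub>" for j :: nat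
      using that Q(4) by (simp add: \<phi>_def)
  qed
qed

lemma card_xyz_gens:
  "finite (xyz_gens d s t)" "card (xyz_gens d s t) = d + s + t"
proof -
  show "finite (xyz_gens d s t)" by (auto simp: xyz_gens_def)
  have "card (GenX ` {1..d} \<union> GenY ` {1..s} \<union> GenZ ` {1..t}) =
      card (GenX ` {1..d} \<union> GenY ` {1..s}) + card (GenZ ` {1..t})"
    by (rule card_Un_disjoint) auto
  also have "card (GenX ` {1..d} \<union> GenY ` {1..s}) = card (GenX ` {1..d}) + card (GenY ` {1..s})"
    by (rule card_Un_disjoint) auto
  finally show "card (xyz_gens d s t) = d + s + t"
    by (simp add: xyz_gens_def card_image inj_on_def)
qed

text \<open>\<open>Y\<close> consists of the generators \<open>a_i\<close> and \<open>b_i\<close>, whose number is the contribution \<open>v\<close> of the genus to the measure.\<close>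

lemma not_FIG_if_fuchsian_size:
  assumes G: "group G" "presents G (Y \<union> xyz_gens d s t) (insert \<rho> (torsion_relators d m)) \<gamma>"
    and Y: "finite Y" "card Y = v" "Y \<inter> xyz_gens d s t = {}" and \<rho>: "\<rho> \<in> words (Y \<union> xyz_gens d s t)"
    and pos: "0 < fuchsian_measure v d s t m"
    and exact: "\<And>i. i \<in> {1..d} \<Longrightarrow>
      \<exists>N\<in>finite_index_normal G. \<forall>j::nat. \<gamma> (GenX i) [^]\<^bsub>G\<^esub> j \<in> N \<longrightarrow> m i dvd j"
  shows "\<not> FIG (profinite_completion G) (profinite_completion_topology G)"
proof (rule group.not_FIG_if_presentation[OF G])
  let ?m = "\<lambda>x. case x of GenX i \<Rightarrow> m i | _ \<Rightarrow> 0"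
  show "finite (Y \<union> xyz_gens d s t)" using Y card_xyz_gens by blast
  show "\<rho> \<in> words (Y \<union> xyz_gens d s t)" by fact
  show "insert \<rho> (torsion_relators d m) =
      insert \<rho> ((\<lambda>x. replicate (?m x) (x, True)) ` GenX ` {1..d})"
    by (auto simp: torsion_relators_def image_image)
  show "GenX ` {1..d} \<subseteq> Y \<union> xyz_gens d s t" by (auto simp: xyz_gens_def)
  have "(\<Sum>x\<in>GenX ` {1..d}. 1 / real (?m x)) = (\<Sum>i = 1..d. 1 / real (m i))"
    by (subst sum.reindex) (auto simp: inj_on_def)
  moreover have "card (Y \<union> xyz_gens d s t) = v + (d + s + t)"
    using Y card_xyz_gens by (simp add: card_Un_disjoint)
  ultimately show "2 + (\<Sum>x\<in>GenX ` {1..d}. 1 / real (?m x)) < real (card (Y \<union> xyz_gens d s t))"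
    using pos by (simp add: fuchsian_measure_def sum_subtractf)
  show "\<exists>N\<in>finite_index_normal G. \<forall>j::nat. \<gamma> x [^]\<^bsub>G\<^esub> j \<in> N \<longrightarrow> ?m x dvd j" if "x \<in> GenX ` {1..d}" for x
    using that exact by auto
qed

lemma xyz_word_words: "xyz_gens d s t \<subseteq> X \<Longrightarrow> xyz_word d s t \<in> words X"
  by (auto simp: xyz_word_def words_def xyz_gens_def in_lists_conv_set subset_iff image_iff simp del: upt_Suc)

lemma group_hyp_isometry_group: "group hyp_isometry_group"
proof -
  let ?I = "{f \<in> Bij hyp_disc. \<forall>z\<in>hyp_disc. \<forall>w\<in>hyp_disc. hyp_dist (f z) (f w) = hyp_dist z w}"
  interpret B: group "BijGroup hyp_disc" by (rule group_BijGroup)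
  have "subgroup ?I (BijGroup hyp_disc)"
  proof (rule B.subgroupI)
    show "?I \<subseteq> carrier (BijGroup hyp_disc)" by (auto simp: BijGroup_def)
    have "(\<lambda>z\<in>hyp_disc. z) \<in> ?I" using id_Bij by auto
    then show "?I \<noteq> {}" by blast
  next
    fix f assume f: "f \<in> ?I"
    have eq: "hyp_dist (inv_into hyp_disc f z) (inv_into hyp_disc f w) = hyp_dist z w"
      if zw: "z \<in> hyp_disc" "w \<in> hyp_disc" for z w
    proof -
      have "inv_into hyp_disc f z \<in> hyp_disc" "inv_into hyp_disc f w \<in> hyp_disc"
        using f zw Bij_inv_into_mem[of f hyp_disc] by auto
      then have "hyp_dist (f (inv_into hyp_disc f z)) (f (inv_into hyp_disc f w)) =
          hyp_dist (inv_into hyp_disc f z) (inv_into hyp_disc f w)"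
        using f by blast
      moreover have "f (inv_into hyp_disc f z) = z" "f (inv_into hyp_disc f w) = w"
        using f zw by (auto simp: Bij_def bij_betw_def f_inv_into_f)
      ultimately show ?thesis by simp
    qed
    have fB: "f \<in> Bij hyp_disc" using f by simp
    have "(\<lambda>z\<in>hyp_disc. inv_into hyp_disc f z) \<in> ?I"
      using restrict_inv_into_Bij[OF fB] eq by simp
    then show "inv\<^bsub>BijGroup hyp_disc\<^esub> f \<in> ?I" by (simp only: inv_BijGroup[OF fB])
    fix h assume h: "h \<in> ?I"
    then have hB: "h \<in> Bij hyp_disc" by simp
    have "h z \<in> hyp_disc" if "z \<in> hyp_disc" for z using Bij_imp_funcset[OF hB] that by auto
    then have "compose hyp_disc f h \<in> ?I"
      using f h compose_Bij[OF fB hB] by (simp add: compose_def)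
    then show "f \<otimes>\<^bsub>BijGroup hyp_disc\<^esub> h \<in> ?I" using fB hB by (simp add: BijGroup_def)
  qed
  from subgroup.subgroup_is_group[OF this group_BijGroup] show ?thesis
    by (simp add: hyp_isometry_group_def)
qed

theorem theorem1p5:
  fixes G :: "(complex \<Rightarrow> complex) monoid"
  assumes "fuchsian_group G"
  shows "\<not> FIG (profinite_completion G) (profinite_completion_topology G)"
proof -
  obtain \<Gamma> where \<Gamma>: "subgroup \<Gamma> hyp_isometry_group" "G = hyp_isometry_group\<lparr>carrier := \<Gamma>\<rparr>"
    and pres: "has_fuchsian_presentation G"
    using assms by (auto simp: fuchsian_group_def)
  have G: "group G"
    using subgroup.subgroup_is_group[OF \<Gamma>(1) group_hyp_isometry_group] by (simp add: \<Gamma>(2))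
  from pres obtain g d s t m where m: "\<forall>i\<in>{1..d}. 2 \<le> m i"
    and cases: "0 < fuchsian_measure (2 * g) d s t m \<and> G \<cong> oriented_group g d s t m \<or>
      1 \<le> g \<and> 0 < fuchsian_measure g d s t m \<and> G \<cong> non_oriented_group g d s t m"
    unfolding has_fuchsian_presentation_def by (elim exE conjE) (rule that)
  have x: "GenX i \<in> xyz_gens d s t" if "i \<in> {1..d}" for i using that by (auto simp: xyz_gens_def)
  from cases show ?thesis
  proof (elim disjE conjE)
    assume pos: "0 < fuchsian_measure (2 * g) d s t m" and iso: "G \<cong> oriented_group g d s t m"
    let ?Y = "GenA ` {1..g} \<union> GenB ` {1..g}"
    obtain \<gamma> where \<gamma>: "presents G (?Y \<union> xyz_gens d s t)
        (insert (oriented_relator g d s t) (torsion_relators d m)) \<gamma>"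
      using presents_if_iso[OF G iso[unfolded oriented_group_def]] by blast
    show ?thesis
    proof (rule not_FIG_if_fuchsian_size[OF G \<gamma> _ _ _ _ pos])
      show "card ?Y = 2 * g"
        by (subst card_Un_disjoint) (auto simp: card_image inj_on_def)
      show "oriented_relator g d s t \<in> words (?Y \<union> xyz_gens d s t)"
        using xyz_word_words[of d s t "?Y \<union> xyz_gens d s t"]
        by (auto simp: words_def commutator_word_def in_lists_conv_set simp del: upt_Suc)
    qed (use oriented_exact_order[OF G \<gamma> m pos] x in \<open>auto simp: xyz_gens_def\<close>)
  next
    assume g: "1 \<le> g" and pos: "0 < fuchsian_measure g d s t m" and iso: "G \<cong> non_oriented_group g d s t m"
    let ?Y = "GenA ` {1..g}"
    obtain \<gamma> where \<gamma>: "presents G (?Y \<union> xyz_gens d s t)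
        (insert (non_oriented_relator g d s t) (torsion_relators d m)) \<gamma>"
      using presents_if_iso[OF G iso[unfolded non_oriented_group_def]] by blast
    show ?thesis
    proof (rule not_FIG_if_fuchsian_size[OF G \<gamma> _ _ _ _ pos])
      show "card ?Y = g" by (auto simp: card_image inj_on_def)
      show "non_oriented_relator g d s t \<in> words (?Y \<union> xyz_gens d s t)"
        using xyz_word_words[of d s t "?Y \<union> xyz_gens d s t"]
        by (auto simp: words_def in_lists_conv_set simp del: upt_Suc)
    qed (use non_oriented_exact_order[OF G \<gamma> m g] x in \<open>auto simp: xyz_gens_def\<close>)
  qed
qed

end
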